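(* Let $C$ be a $d$-dimensional copula such that, for each $i\in\{1,\dots,d\}$, the first-order partial derivative $\partial_iC$ exists and is continuous on $\{\mathbf{u}\in[0,1]^d:0<u_i<1\}$. Let $C_n$ be the empirical copula of a random sample of size $n$ from a $d$-dimensional distribution function $F$ with copula $C$ and continuous marginals. For any copula $D\ne C$, the statistic $$T_n(C,D)=\sqrt{n}\,\big(\|C_n-D\|_\infty-\|C-D\|_\infty\big)$$ converges in distribution, as $n\to\infty$, to $$\delta'_{C-D}(\mathbb{C})=\sup_{M^+(|C-D|)}\big(\mathbb{C}\cdot\operatorname{sgn}(C-D)\big),$$ where $\mathbb{C}$ is the Gaussian process $$\mathbb{C}(\mathbf{u})=\mathbb{B}_C(\mathbf{u})-\sum_{i=1}^d\partial_iC(\mathbf{u})\,\mathbb{B}^{(i)}_C(u_i),\qquad\mathbf{u}=(u_1,\dots,u_d)\in[0,1]^d,$$ with $\mathbb{B}_C$ a $C$-Brownian bridge and $\mathbb{B}^{(i)}_C(u_i)=\mathbb{B}_C(1,\dots,1,u_i,1,\dots,1)$ ($u_i$ in the $i$-th entry).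
   Context: $F(\mathbf{x})=C(F_1(x_1),\dots,F_d(x_d))$ with $F_1,\dots,F_d$ the continuous marginal distribution functions. With $F_n$ and $F_{n,i}$ the empirical joint and $i$-th marginal distribution functions of the sample, the empirical copula is $C_n(\mathbf{u})=F_n(F_{n,1}^{-1}(u_1),\dots,F_{n,d}^{-1}(u_d))$, $\mathbf{u}\in[0,1]^d$, where $F_{n,i}^{-1}$ is the generalized inverse (quantile function) of $F_{n,i}$. A $C$-Brownian bridge is a (tight, with continuous paths) centered Gaussian process on $[0,1]^d$ with covariance $\mathrm{E}(\mathbb{B}_C(\mathbf{u})\mathbb{B}_C(\mathbf{w}))=C(\mathbf{u}\wedge\mathbf{w})-C(\mathbf{u})C(\mathbf{w})$, $\wedge$ the coordinatewise minimum. The $i$-th term $\partial_iC(\mathbf{u})\mathbb{B}^{(i)}_C(u_i)$ is read as $0$ when $u_i\in\{0,1\}$. $\|\cdot\|_\infty$ is the supremum norm on $[0,1]^d$; $\operatorname{sgn}$ is the sign function; $M^+(h)=\{\mathbf{u}\in[0,1]^d:h(\mathbf{u})=\sup_{[0,1]^d}h\}$. *)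

theory Defs
  imports "HOL-Probability.Probability"
begin

text \<open>
  Throughout, the dimension \<open>d\<close> is \<open>CARD('d)\<close>. The order on \<^typ>\<open>real ^ 'd\<close> is the
  coordinatewise one, so \<open>{0..1}\<close> is the unit cube, \<open>{..x}\<close> a lower orthant and
  \<open>inf u w\<close> the coordinatewise minimum.
\<close>

definition vec_upd :: "'a ^ 'd \<Rightarrow> 'd \<Rightarrow> 'a \<Rightarrow> 'a ^ 'd" where
  "vec_upd u i t = (\<chi> j. if j = i then t else u $ j)"

subsection \<open>Distribution functions and copulas\<close>

definition joint_cdf :: "(real ^ 'd) measure \<Rightarrow> real ^ 'd \<Rightarrow> real" where
  "joint_cdf P x = measure P {..x}"

definition marginal_cdf :: "(real ^ 'd) measure \<Rightarrow> 'd \<Rightarrow> real \<Rightarrow> real" where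
  "marginal_cdf P i = cdf (distr P borel (\<lambda>x. x $ i))"

text \<open>
  A copula is the restriction to the unit cube of a distribution function with standard uniform
  margins; values outside the cube are irrelevant.
\<close>

definition copula :: "(real ^ 'd \<Rightarrow> real) \<Rightarrow> bool" where
  "copula C \<longleftrightarrow>
     (\<exists>P. prob_space P \<and> sets P = sets borel \<and>
          (\<forall>i. \<forall>t\<in>{0..1}. marginal_cdf P i t = t) \<and>
          (\<forall>u\<in>{0..1}. C u = joint_cdf P u))"

definition copula_of :: "(real ^ 'd \<Rightarrow> real) \<Rightarrow> (real ^ 'd) measure \<Rightarrow> bool" where
  "copula_of C P \<longleftrightarrow> (\<forall>x. joint_cdf P x = C (\<chi> i. marginal_cdf P i (x $ i)))"

definition partial_slice :: "(real ^ 'd \<Rightarrow> real) \<Rightarrow> 'd \<Rightarrow> real ^ 'd \<Rightarrow> real \<Rightarrow> real" where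
  "partial_slice C i u t = C (vec_upd u i t)"

definition partial_deriv :: "(real ^ 'd \<Rightarrow> real) \<Rightarrow> 'd \<Rightarrow> real ^ 'd \<Rightarrow> real" where
  "partial_deriv C i u = deriv (partial_slice C i u) (u $ i)"

definition open_slab :: "'d \<Rightarrow> (real ^ 'd) set" where
  "open_slab i = {u \<in> {0..1}. 0 < u $ i \<and> u $ i < 1}"

definition continuous_partial :: "(real ^ 'd \<Rightarrow> real) \<Rightarrow> 'd \<Rightarrow> bool" where
  "continuous_partial C i \<longleftrightarrow>
     (\<forall>u\<in>open_slab i. partial_slice C i u field_differentiable at (u $ i)) \<and>
     continuous_on (open_slab i) (partial_deriv C i)"

subsection \<open>The empirical copula\<close>

text \<open>
  Extended real arguments, because the generalized inverse of an empirical distribution function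
  at \<open>0\<close> is \<open>-\<infinity>\<close>. Hence \<open>emp_copula n x u = 0\<close> as soon as some \<open>u $ i\<close> is \<open>0\<close>.
  The sample of size \<open>n\<close> consists of \<open>x 0, \<dots>, x (n - 1)\<close>.
\<close>

definition emp_cdf :: "nat \<Rightarrow> (nat \<Rightarrow> real ^ 'd) \<Rightarrow> ereal ^ 'd \<Rightarrow> real" where
  "emp_cdf n x y = real (card {k. k < n \<and> (\<forall>i. ereal (x k $ i) \<le> y $ i)}) / real n"

definition emp_marginal :: "nat \<Rightarrow> (nat \<Rightarrow> real ^ 'd) \<Rightarrow> 'd \<Rightarrow> real \<Rightarrow> real" where
  "emp_marginal n x i t = real (card {k. k < n \<and> x k $ i \<le> t}) / real n"

definition quantile :: "(real \<Rightarrow> real) \<Rightarrow> real \<Rightarrow> ereal" where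
  "quantile G p = (INF t\<in>{t. p \<le> G t}. ereal t)"

definition emp_copula :: "nat \<Rightarrow> (nat \<Rightarrow> real ^ 'd) \<Rightarrow> real ^ 'd \<Rightarrow> real" where
  "emp_copula n x u = emp_cdf n x (\<chi> i. quantile (emp_marginal n x i) (u $ i))"

subsection \<open>The supremum norm and its directional derivative\<close>

definition sup_norm :: "(real ^ 'd \<Rightarrow> real) \<Rightarrow> real" where
  "sup_norm h = (SUP u\<in>{0..1}. \<bar>h u\<bar>)"

definition argmax_set :: "(real ^ 'd \<Rightarrow> real) \<Rightarrow> (real ^ 'd) set" where
  "argmax_set h = {u \<in> {0..1}. h u = (SUP v\<in>{0..1}. h v)}"

text \<open>
  Hadamard directional differentiability, at \<open>f\<close> in direction \<open>g\<close> and with derivative \<open>L\<close>, of a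
  functional on the space of bounded functions on the unit cube with the supremum norm.
\<close>

definition has_hadamard_dir_deriv ::
  "((real ^ 'd \<Rightarrow> real) \<Rightarrow> real) \<Rightarrow> (real ^ 'd \<Rightarrow> real) \<Rightarrow> (real ^ 'd \<Rightarrow> real) \<Rightarrow> real \<Rightarrow> bool"
where
  "has_hadamard_dir_deriv \<phi> f g L \<longleftrightarrow>
     bounded (f ` {0..1}) \<and> bounded (g ` {0..1}) \<and>
     (\<forall>(s :: nat \<Rightarrow> real) h.
        (\<forall>k. 0 < s k) \<longrightarrow> s \<longlonglongrightarrow> 0 \<longrightarrow>
        (\<forall>k. bounded (h k ` {0..1})) \<longrightarrow> (\<lambda>k. sup_norm (\<lambda>u. h k u - g u)) \<longlonglongrightarrow> 0 \<longrightarrow>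
        (\<lambda>k. (\<phi> (\<lambda>u. f u + s k * h k u) - \<phi> f) / s k) \<longlonglongrightarrow> L)"

subsection \<open>Gaussian processes and the limit process\<close>

definition normal_law :: "real \<Rightarrow> real \<Rightarrow> real measure" where
  "normal_law m \<sigma> =
     (if \<sigma> = 0 then return borel m else density lborel (\<lambda>x. ennreal (normal_density m \<sigma> x)))"

definition gaussian_process :: "'b measure \<Rightarrow> 'i set \<Rightarrow> ('i \<Rightarrow> 'b \<Rightarrow> real) \<Rightarrow> bool" where
  "gaussian_process N I B \<longleftrightarrow>
     (\<forall>u\<in>I. B u \<in> borel_measurable N) \<and>
     (\<forall>S a. finite S \<longrightarrow> S \<subseteq> I \<longrightarrow>
        (\<exists>m \<sigma>. 0 \<le> \<sigma> \<and> distr N borel (\<lambda>\<omega>. \<Sum>u\<in>S. a u * B u \<omega>) = normal_law m \<sigma>))"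

text \<open>
  Tightness is not a separate requirement: a process with continuous paths on the compact cube is
  a Borel random element of the Polish space of continuous functions, hence tight.
\<close>

definition copula_bridge ::
  "'b measure \<Rightarrow> (real ^ 'd \<Rightarrow> real) \<Rightarrow> (real ^ 'd \<Rightarrow> 'b \<Rightarrow> real) \<Rightarrow> bool"
where
  "copula_bridge N C B \<longleftrightarrow>
     gaussian_process N {0..1} B \<and>
     (\<forall>\<omega>\<in>space N. continuous_on {0..1} (\<lambda>u. B u \<omega>)) \<and>
     (\<forall>u\<in>{0..1}. integral\<^sup>L N (B u) = 0) \<and>
     (\<forall>u\<in>{0..1}. \<forall>w\<in>{0..1}.
        integral\<^sup>L N (\<lambda>\<omega>. B u \<omega> * B w \<omega>) = C (inf u w) - C u * C w)"

definition limit_process ::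
  "(real ^ 'd \<Rightarrow> real) \<Rightarrow> (real ^ 'd \<Rightarrow> 'b \<Rightarrow> real) \<Rightarrow> real ^ 'd \<Rightarrow> 'b \<Rightarrow> real"
where
  "limit_process C B u \<omega> =
     B u \<omega> - (\<Sum>i\<in>UNIV. if 0 < u $ i \<and> u $ i < 1
                         then partial_deriv C i u * B (vec_upd 1 i (u $ i)) \<omega> else 0)"

text \<open>The library's \<^const>\<open>weak_conv_m\<close> speaks about laws and does not check measurability.\<close>

definition converges_in_distribution ::
  "'a measure \<Rightarrow> (nat \<Rightarrow> 'a \<Rightarrow> real) \<Rightarrow> 'b measure \<Rightarrow> ('b \<Rightarrow> real) \<Rightarrow> bool"
where
  "converges_in_distribution M T N Z \<longleftrightarrow>
     (\<forall>n. T n \<in> borel_measurable M) \<and> Z \<in> borel_measurable N \<and>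
     weak_conv_m (\<lambda>n. distr M borel (T n)) (distr N borel Z)"

end

theory Submission
  imports Defs "HOL-Real_Asymp.Real_Asymp"
begin

text \<open>
  The empirical copula depends on the sample only through ranks, so the sample may be replaced by
  \<open>U k\<close>, with coordinates \<open>F\<^sub>i (X k $ i)\<close>, which has uniform margins and distribution function \<open>C\<close>.
  Its empirical process \<open>\<alpha> n\<close> is asymptotically equicontinuous: along the grids of mesh \<open>4\<^sup>-\<^sup>k\<close>
  a Bernstein bound for the increments beats the number of pairs of neighbouring grid points.
  Equicontinuity and the mean value theorem give, uniformly on the cube,
  \<open>sqrt n * (C\<^sub>n - C) = L (\<alpha> n) + o(1)\<close> in probability, where \<open>L\<close> is the linear map that defines the
  limit process. It also makes \<open>L (\<alpha> n)\<close> equicontinuous, although the partial derivatives of \<open>C\<close> may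
  be discontinuous on the faces: there they are multiplied by small values of \<open>\<alpha> n\<close>.
  Expanding the supremum norm at \<open>C - D\<close>, the statistic is within any \<open>\<epsilon>\<close> of the maximum of
  \<open>L (\<alpha> n) * sgn (C - D)\<close> over a finite net in the set of maximizers. That maximum is a continuous
  function of finitely many values of \<open>\<alpha> n\<close>, whose laws converge by the central limit theorem applied
  to linear combinations.
\<close>

text \<open>No weak convergence in a function space is used. The paths of \<open>\<alpha> n\<close>
  jump, so the analysis is done path by path with one pair \<open>\<delta>\<close>,
  \<open>\<epsilon>\<close> at a time (\<open>cube_modulus\<close>). The deterministic lemmas have
  thresholds that do not depend on the path, and equicontinuity enters through one event of large
  probability. That event also bounds the paths: a modulus together with the value 0 at the origin
  does so. The chaining allows increments proportional to \<open>(3 / 4) ^ k\<close> on level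
  \<open>k\<close>. Any ratio strictly between 1/2 and 1 would do: below 1 the allowances are
  summable, above 1/2 the exponent \<open>2 ^ k * (3 / 4) ^ k\<close> of the tail bound still grows.
  The chain cannot go below a mesh of order \<open>1 / n\<close>, because the exponential moment
  bound requires \<open>2 ^ k <= sqrt n / 2\<close>. The rest is bridged by monotonicity of the
  empirical distribution function, at a cost of order \<open>1 / sqrt n\<close>.\<close>

section \<open>Weak convergence through linear combinations\<close>

text \<open>Stone--Weierstrass needs a Hausdorff type, and the library makes functions one only for a
  countable domain.\<close>

instance "fun" :: (type, t0_space) t0_space
proof
  fix x y :: "'a \<Rightarrow> 'b" assume "x \<noteq> y"
  then obtain i where i: "x i \<noteq> y i" by auto
  then obtain U where U: "open U" "\<not> (x i \<in> U \<longleftrightarrow> y i \<in> U)" using iffD1[OF separation_t0 i] by blast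
  have "open ((\<lambda>f::'a \<Rightarrow> 'b. f i) -` U)"
    using U(1) continuous_on_product_coordinates by (rule open_vimage)
  with U(2) show "\<exists>U. open U \<and> \<not> (x \<in> U \<longleftrightarrow> y \<in> U)"
    by (metis vimage_eq)
qed
instance "fun" :: (type, t1_space) t1_space
proof
  fix x y :: "'a \<Rightarrow> 'b" assume "x \<noteq> y"
  then obtain i where i: "x i \<noteq> y i" by auto
  then obtain U where U: "open U" "x i \<in> U" "y i \<notin> U" using iffD1[OF separation_t1 i] by blast
  have "open ((\<lambda>f::'a \<Rightarrow> 'b. f i) -` U)"
    using U(1) continuous_on_product_coordinates by (rule open_vimage)
  with U(2,3) show "\<exists>U. open U \<and> x \<in> U \<and> y \<notin> U"
    by (metis vimage_eq)
qed
instance "fun" :: (type, t2_space) t2_space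
proof
  fix x y :: "'a \<Rightarrow> 'b" assume "x \<noteq> y"
  then obtain i where i: "x i \<noteq> y i" by auto
  then obtain U V where U: "open U" "open V" "x i \<in> U" "y i \<in> V" "U \<inter> V = {}" using iffD1[OF separation_t2 i] by blast
  have "open ((\<lambda>f::'a \<Rightarrow> 'b. f i) -` U)" "open ((\<lambda>f::'a \<Rightarrow> 'b. f i) -` V)" 
    by (rule open_vimage[OF U(1) continuous_on_product_coordinates] open_vimage[OF U(2) continuous_on_product_coordinates])+
  with U(3-) show "\<exists>U V. open U \<and> open V \<and> x \<in> U \<and> y \<in> V \<and> U \<inter> V = {}"
    by (intro exI[of _ "(\<lambda>f. f i) -` U"] exI[of _ "(\<lambda>f. f i) -` V"])
      auto
qed
text \<open>Tychonoff's theorem. The index type is arbitrary because the indices will be all points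
  of \<open>real ^ 'd\<close>.\<close>

lemma compact_cube_fun: "compact (PiE UNIV (\<lambda>_::'a. {-1..1::real}))"
proof -
  have "compactin (product_topology (\<lambda>_::'a. euclidean::real topology) UNIV) (PiE UNIV (\<lambda>_. {-1..1}))"
    unfolding compactin_PiE by (simp only: compactin_euclidean_iff compact_Icc simp_thms ball_simps) simp
  then show ?thesis unfolding euclidean_product_topology compactin_euclidean_iff by blast
qed

text \<open>The phase \<open>p\<close> provides constants and sines, so sums of such cosines form an
  algebra, by the product-to-sum formulas. The expectation of each generator is determined by the
  law of one linear combination.\<close>

inductive trig_poly :: "(('i \<Rightarrow> real) \<Rightarrow> real) \<Rightarrow> bool" where
  cosine: "finite S \<Longrightarrow> trig_poly (\<lambda>y. c * cos ((\<Sum>u\<in>S. a u * y u) + p))"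
| add: "trig_poly f \<Longrightarrow> trig_poly g \<Longrightarrow> trig_poly (\<lambda>y. f y + g y)"

lemma trig_poly_const: "trig_poly (\<lambda>y. c)"
  using trig_poly.cosine[of "{}" c _ 0] by simp

lemma trig_poly_sin: "trig_poly (\<lambda>y. sin (y u / R))"
proof -
  have "sin (y u / R) = 1 * cos ((\<Sum>v\<in>{u}. (1/R) * y v) + - (pi/2))" for y
    by (simp add: cos_diff)
  then show ?thesis using trig_poly.cosine[of "{u}" 1 "\<lambda>_. 1/R" "- (pi/2)"] by simp
qed

lemma trig_poly_mult_cosine:
  assumes "finite S" "trig_poly g"
  shows "trig_poly (\<lambda>y. c * cos ((\<Sum>u\<in>S. a u * y u) + p) * g y)"
  using assms(2)
proof induction
  case (cosine T c' a' p')
  \<comment> \<open>Coefficients of the sum (\<open>s = 1\<close>) and the difference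
    (\<open>s = -1\<close>) of the two linear forms, each extended by zero to the union of the
    supports.\<close>
  let ?e = "\<lambda>s u. (if u \<in> S then a u else 0) + s * (if u \<in> T then a' u else 0)"
  have sum: "(\<Sum>u\<in>S \<union> T. ?e s u * y u) = (\<Sum>u\<in>S. a u * y u) + s * (\<Sum>u\<in>T. a' u * y u)" for s y
  proof -
    have "(\<Sum>u\<in>S. a u * y u) = (\<Sum>u\<in>S \<union> T. (if u \<in> S then a u else 0) * y u)"
      "(\<Sum>u\<in>T. a' u * y u) = (\<Sum>u\<in>S \<union> T. (if u \<in> T then a' u else 0) * y u)"
      using assms(1) cosine by (auto intro!: sum.mono_neutral_cong_left)
    then show ?thesis
      by (simp add: sum_distrib_left sum.distrib[symmetric] algebra_simps)
  qed
  have "c * cos ((\<Sum>u\<in>S. a u * y u) + p) * (c' * cos ((\<Sum>u\<in>T. a' u * y u) + p')) =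
     (c * c' / 2) * cos ((\<Sum>u\<in>S \<union> T. ?e 1 u * y u) + (p + p')) +
     (c * c' / 2) * cos ((\<Sum>u\<in>S \<union> T. ?e (-1) u * y u) + (p - p'))" for y
  proof -
    have "c * cos A * (c' * cos B) = (c * c' / 2) * cos (A + B) + (c * c' / 2) * cos (A - B)" for A B
      by (simp add: cos_add cos_diff algebra_simps)
    from this[of "(\<Sum>u\<in>S. a u * y u) + p" "(\<Sum>u\<in>T. a' u * y u) + p'"] show ?thesis
      unfolding sum by (simp add: algebra_simps)
  qed
  then show ?case
    using assms(1) cosine by (simp only:) (intro trig_poly.intros; simp)
next
  case (add f g)
  then show ?case
    using trig_poly.add[OF add(3,4)] by (simp add: distrib_left)
qed

lemma trig_poly_mult:
  assumes "trig_poly f" "trig_poly g"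
  shows "trig_poly (\<lambda>y. f y * g y)"
  using assms(1)
proof induction
  case (cosine S c a p)
  then show ?case using trig_poly_mult_cosine[OF _ assms(2)] by blast
next
  case (add f1 f2)
  then show ?case
    using trig_poly.add[OF add(3,4)] by (simp add: distrib_right)
qed

lemma expectation_cos_char:
  assumes "prob_space M" and [measurable]: "L \<in> borel_measurable M"
  shows "integral\<^sup>L M (\<lambda>\<omega>. c * cos (L \<omega> + p)) = c * Re (iexp p * char (distr M borel L) 1)"
proof -
  interpret prob_space M by fact
  have int: "complex_integrable M (\<lambda>\<omega>. iexp (L \<omega>))"
    by (rule integrable_const_bound[where B=1]) auto
  have "iexp p * char (distr M borel L) 1 = integral\<^sup>L M (\<lambda>\<omega>. iexp p * iexp (L \<omega>))"
    using int by (simp add: char_def integral_distr)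
  also have "Re \<dots> = integral\<^sup>L M (\<lambda>\<omega>. Re (iexp p * iexp (L \<omega>)))"
    using int by (intro integral_Re[symmetric]) simp
  also have "\<dots> = integral\<^sup>L M (\<lambda>\<omega>. cos (L \<omega> + p))"
    by (intro Bochner_Integration.integral_cong) (auto simp: exp_add[symmetric] Re_exp add.commute)
  finally show ?thesis by simp
qed

text \<open>The expectation of one cosine is read off from a characteristic function at 1; any other
  argument is absorbed in the coefficients \<open>a\<close>. Integrability is part of the induction
  so that expectations may be added.\<close>

lemma trig_poly_expectation:
  assumes "prob_space M" "prob_space N"
    and Y[measurable]: "\<And>n u. Y n u \<in> borel_measurable M" and Z[measurable]: "\<And>u. Z u \<in> borel_measurable N"
    and lin: "\<And>S a. finite S \<Longrightarrow>
       (\<lambda>n. char (distr M borel (\<lambda>\<omega>. \<Sum>u\<in>S. a u * Y n u \<omega>)) 1)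
         \<longlonglongrightarrow> char (distr N borel (\<lambda>\<omega>. \<Sum>u\<in>S. a u * Z u \<omega>)) 1"
    and "trig_poly f"
  shows "(\<forall>n. integrable M (\<lambda>\<omega>. f (\<lambda>u. Y n u \<omega>))) \<and> integrable N (\<lambda>\<omega>. f (\<lambda>u. Z u \<omega>)) \<and>
    (\<lambda>n. integral\<^sup>L M (\<lambda>\<omega>. f (\<lambda>u. Y n u \<omega>))) \<longlonglongrightarrow> integral\<^sup>L N (\<lambda>\<omega>. f (\<lambda>u. Z u \<omega>))"
  using \<open>trig_poly f\<close>
proof induction
  case (cosine S c a p)
  interpret M: prob_space M by fact
  interpret N: prob_space N by fact
  have "integrable M (\<lambda>\<omega>. c * cos ((\<Sum>u\<in>S. a u * Y n u \<omega>) + p))" for n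
    by (rule M.integrable_const_bound[where B="\<bar>c\<bar>"]) (auto simp: abs_mult mult_left_le)
  moreover have "integrable N (\<lambda>\<omega>. c * cos ((\<Sum>u\<in>S. a u * Z u \<omega>) + p))"
    by (rule N.integrable_const_bound[where B="\<bar>c\<bar>"]) (auto simp: abs_mult mult_left_le)
  moreover have "(\<lambda>n. c * Re (iexp p * char (distr M borel (\<lambda>\<omega>. \<Sum>u\<in>S. a u * Y n u \<omega>)) 1))
    \<longlonglongrightarrow> c * Re (iexp p * char (distr N borel (\<lambda>\<omega>. \<Sum>u\<in>S. a u * Z u \<omega>)) 1)"
    by (intro tendsto_intros lin cosine)
  ultimately show ?case
    unfolding expectation_cos_char[OF assms(1) borel_measurable_sum[OF borel_measurable_times[OF borel_measurable_const Y]]]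
      expectation_cos_char[OF assms(2) borel_measurable_sum[OF borel_measurable_times[OF borel_measurable_const Z]]]
    by blast
next
  case (add f g)
  then show ?case by (auto intro!: tendsto_add)
qed

text \<open>Where \<open>\<bar>y u\<bar> \<le> R\<close> one has \<open>y u = R * arcsin (sin (y u / R))\<close>. So, up to an error controlled by
  the second moments, \<open>h y\<close> is a continuous function of the numbers \<open>sin (y u / R)\<close> in \<open>[-1, 1]\<close>,
  and polynomials in these are trigonometric polynomials in \<open>y\<close>.\<close>

lemma cramer_wold_expectation:
  fixes Y :: "nat \<Rightarrow> 'i \<Rightarrow> 'a \<Rightarrow> real" and Z :: "'i \<Rightarrow> 'b \<Rightarrow> real"
    and h :: "('i \<Rightarrow> real) \<Rightarrow> real"
  assumes M: "prob_space M" and N: "prob_space N"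
    and Y[measurable]: "\<And>n u. Y n u \<in> borel_measurable M" and Z[measurable]: "\<And>u. Z u \<in> borel_measurable N"
    and lin: "\<And>S a. finite S \<Longrightarrow>
       (\<lambda>n. char (distr M borel (\<lambda>\<omega>. \<Sum>u\<in>S. a u * Y n u \<omega>)) 1)
         \<longlonglongrightarrow> char (distr N borel (\<lambda>\<omega>. \<Sum>u\<in>S. a u * Z u \<omega>)) 1"
    and Y2: "\<And>n u. integrable M (\<lambda>\<omega>. (Y n u \<omega>)\<^sup>2)" "\<And>n u. integral\<^sup>L M (\<lambda>\<omega>. (Y n u \<omega>)\<^sup>2) \<le> V"
    and Z2: "\<And>u. integrable N (\<lambda>\<omega>. (Z u \<omega>)\<^sup>2)" "\<And>u. integral\<^sup>L N (\<lambda>\<omega>. (Z u \<omega>)\<^sup>2) \<le> V"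
    and h: "continuous_on UNIV h" "\<And>y. \<bar>h y\<bar> \<le> H" "finite S"
      "\<And>y y'. (\<forall>u\<in>S. y u = y' u) \<Longrightarrow> h y = h y'"
    and hY[measurable]: "\<And>n. (\<lambda>\<omega>. h (\<lambda>u. Y n u \<omega>)) \<in> borel_measurable M"
    and hZ[measurable]: "(\<lambda>\<omega>. h (\<lambda>u. Z u \<omega>)) \<in> borel_measurable N"
  shows "(\<lambda>n. integral\<^sup>L M (\<lambda>\<omega>. h (\<lambda>u. Y n u \<omega>))) \<longlonglongrightarrow> integral\<^sup>L N (\<lambda>\<omega>. h (\<lambda>u. Z u \<omega>))"
proof (rule LIMSEQ_I)
  fix r :: real assume "0 < r"
  \<comment> \<open>Budget: \<open>2 * e\<close> for replacing \<open>h\<close> by a trigonometric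
    polynomial under each of the two measures, and less than \<open>e\<close> for the convergence of
    its expectations.\<close>
  define e where "e = r / 6"
  have e: "e > 0" "r = 6 * e" using \<open>0 < r\<close> by (auto simp: e_def)
  interpret M: prob_space M by fact
  interpret N: prob_space N by fact
  have H: "H \<ge> 0" using h(2)[of "\<lambda>_. 0"] by linarith
  have V: "V \<ge> 0" using Z2(2)[of undefined] by (smt (verit) integral_nonneg_AE AE_I2 zero_le_power2)
  \<comment> \<open>Outside the box of radius \<open>R\<close> the error is at most
    \<open>2 * H + e\<close>. As in Chebyshev's inequality, the second moments bound the
    contribution of that region by \<open>D / R^2\<close>, and \<open>R = D / e + 1\<close> makes
    this at most \<open>e\<close>.\<close>
  define D where "D = (2 * H + e) * real (card S) * V"
  have D: "D \<ge> 0" using H V e by (simp add: D_def)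
  define R where "R = D / e + 1"
  have R: "R \<ge> 1" "D / R\<^sup>2 \<le> e"
  proof -
    show R1: "R \<ge> 1" using D e by (simp add: R_def)
    have "D \<le> e * R" using e by (simp add: R_def field_simps)
    also have "\<dots> \<le> e * R\<^sup>2" using R1 e by (simp add: power2_eq_square)
    finally show "D / R\<^sup>2 \<le> e" using R1 by (simp add: field_simps)
  qed
  define Q where "Q = PiE UNIV (\<lambda>_::'i. {-1..1::real})"
  define ht where "ht b = h (\<lambda>u. R * arcsin (b u))" for b :: "'i \<Rightarrow> real"
  have cont: "continuous_on Q ht"
    unfolding ht_def
    by (rule continuous_on_compose2[OF h(1)])
      (auto intro!: continuous_on_coordinatewise_then_product continuous_intros
         continuous_on_subset[OF continuous_on_product_coordinates] simp: Q_def PiE_UNIV_domain Pi_def)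
  have "\<exists>g. (trig_poly (\<lambda>y. g (\<lambda>u. sin (y u / R))) \<and> continuous_on Q g) \<and> (\<forall>b\<in>Q. \<bar>ht b - g b\<bar> < e)"
  proof (rule Stone_Weierstrass_HOL[OF _ _ _ _ _ _ cont e(1)])
    show "compact Q" unfolding Q_def by (rule compact_cube_fun)
  next
    fix x y assume "x \<in> Q \<and> y \<in> Q \<and> x \<noteq> y"
    then obtain u where "x u \<noteq> y u" by auto
    moreover have "continuous_on Q (\<lambda>b. b u)"
      by (rule continuous_on_subset[OF continuous_on_product_coordinates]) simp
    ultimately show "\<exists>f. (trig_poly (\<lambda>y. f (\<lambda>u. sin (y u / R))) \<and> continuous_on Q f) \<and> f x \<noteq> f y"
      using trig_poly_sin by (intro exI[of _ "\<lambda>b. b u"]) auto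
  qed (auto intro: trig_poly_const trig_poly.add trig_poly_mult continuous_intros)
  then obtain g where g: "trig_poly (\<lambda>y. g (\<lambda>u. sin (y u / R)))" "\<And>b. b \<in> Q \<Longrightarrow> \<bar>ht b - g b\<bar> < e"
    by blast
  let ?g = "\<lambda>y. g (\<lambda>u. sin (y u / R))"
  \<comment> \<open>The polynomial is bounded by \<open>H + e\<close> everywhere, since the sines
    stay in the cube even for large arguments. Outside the box the crude bound
    \<open>2 * H + e\<close> is multiplied by a quantity that is at least 1 there.\<close>
  have pt: "\<bar>h y - ?g y\<bar> \<le> e + (2 * H + e) / R\<^sup>2 * (\<Sum>u\<in>S. (y u)\<^sup>2)" for y
  proof -
    have Qy: "(\<lambda>u. sin (y u / R)) \<in> Q" by (simp add: Q_def PiE_UNIV_domain)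
    have pos: "0 \<le> (2 * H + e) / R\<^sup>2 * (\<Sum>u\<in>S. (y u)\<^sup>2)"
      using H e by (intro mult_nonneg_nonneg sum_nonneg) auto
    show ?thesis
    proof (cases "\<forall>u\<in>S. \<bar>y u\<bar> \<le> R")
      case True
      have "h y = ht (\<lambda>u. sin (y u / R))"
        unfolding ht_def
      proof (rule h(4), safe)
        fix u assume "u \<in> S"
        then have "\<bar>y u\<bar> \<le> R" using True by auto
        then have "\<bar>y u / R\<bar> \<le> 1" using R by simp
        then have "arcsin (sin (y u / R)) = y u / R"
          using pi_gt3 by (intro arcsin_sin) linarith+
        then show "y u = R * arcsin (sin (y u / R))" using R by simp
      qed
      then show ?thesis using g(2)[OF Qy] pos by linarith
    next
      case False
      then obtain u where u: "u \<in> S" "\<bar>y u\<bar> > R" by auto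
      have "\<bar>h y - ?g y\<bar> \<le> 2 * H + e"
        using g(2)[OF Qy] h(2)[of y] h(2)[of "\<lambda>u. R * arcsin (sin (y u / R))"] unfolding ht_def by linarith
      moreover have "1 \<le> (\<Sum>u\<in>S. (y u)\<^sup>2) / R\<^sup>2"
      proof -
        have "R\<^sup>2 \<le> (y u)\<^sup>2" using u R by (simp add: abs_le_square_iff[symmetric])
        also have "\<dots> \<le> (\<Sum>u\<in>S. (y u)\<^sup>2)" using u h(3) by (intro member_le_sum) auto
        finally show ?thesis using R by simp
      qed
      then have "2 * H + e \<le> (2 * H + e) / R\<^sup>2 * (\<Sum>u\<in>S. (y u)\<^sup>2)"
        using mult_left_mono[of 1 "(\<Sum>u\<in>S. (y u)\<^sup>2) / R\<^sup>2" "2 * H + e"] H e by simp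
      ultimately show ?thesis using e by linarith
    qed
  qed
  have E: "\<bar>integral\<^sup>L K (\<lambda>\<omega>. h (\<lambda>u. W u \<omega>)) - integral\<^sup>L K (\<lambda>\<omega>. ?g (\<lambda>u. W u \<omega>))\<bar> \<le> 2 * e"
    if "prob_space K" and [measurable]: "(\<lambda>\<omega>. h (\<lambda>u. W u \<omega>)) \<in> borel_measurable K"
      and ig: "integrable K (\<lambda>\<omega>. ?g (\<lambda>u. W u \<omega>))"
      and W2: "\<And>u. integrable K (\<lambda>\<omega>. (W u \<omega>)\<^sup>2)" "\<And>u. integral\<^sup>L K (\<lambda>\<omega>. (W u \<omega>)\<^sup>2) \<le> V"
    for K :: "'k measure" and W :: "'i \<Rightarrow> 'k \<Rightarrow> real"
  proof -
    interpret K: prob_space K by fact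
    have ih: "integrable K (\<lambda>\<omega>. h (\<lambda>u. W u \<omega>))"
      by (rule K.integrable_const_bound[where B=H]) (auto simp: h)
    have "\<bar>integral\<^sup>L K (\<lambda>\<omega>. h (\<lambda>u. W u \<omega>)) - integral\<^sup>L K (\<lambda>\<omega>. ?g (\<lambda>u. W u \<omega>))\<bar>
      = \<bar>integral\<^sup>L K (\<lambda>\<omega>. h (\<lambda>u. W u \<omega>) - ?g (\<lambda>u. W u \<omega>))\<bar>"
      using ih ig by simp
    also have "\<dots> \<le> integral\<^sup>L K (\<lambda>\<omega>. \<bar>h (\<lambda>u. W u \<omega>) - ?g (\<lambda>u. W u \<omega>)\<bar>)"
      by (rule integral_abs_bound)
    also have "\<dots> \<le> integral\<^sup>L K (\<lambda>\<omega>. e + (2 * H + e) / R\<^sup>2 * (\<Sum>u\<in>S. (W u \<omega>)\<^sup>2))"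
      using ih ig W2(1) by (intro integral_mono pt) auto
    also have "\<dots> = e + (2 * H + e) / R\<^sup>2 * (\<Sum>u\<in>S. integral\<^sup>L K (\<lambda>\<omega>. (W u \<omega>)\<^sup>2))"
      using W2(1) by (simp add: K.prob_space)
    also have "\<dots> \<le> e + (2 * H + e) / R\<^sup>2 * (\<Sum>u\<in>S. V)"
      using H e by (intro add_left_mono mult_left_mono sum_mono W2) auto
    also have "\<dots> = e + D / R\<^sup>2" by (simp add: D_def)
    also have "\<dots> \<le> 2 * e" using R by simp
    finally show ?thesis .
  qed
  note tp = trig_poly_expectation[OF M N Y Z lin g(1)]
  then obtain n0 where n0: "\<And>n. n \<ge> n0 \<Longrightarrow>
     \<bar>integral\<^sup>L M (\<lambda>\<omega>. ?g (\<lambda>u. Y n u \<omega>)) - integral\<^sup>L N (\<lambda>\<omega>. ?g (\<lambda>u. Z u \<omega>))\<bar> < e"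
    using e(1) LIMSEQ_D[of "\<lambda>n. integral\<^sup>L M (\<lambda>\<omega>. ?g (\<lambda>u. Y n u \<omega>))"] by (metis real_norm_def)
  show "\<exists>no. \<forall>n\<ge>no. norm (integral\<^sup>L M (\<lambda>\<omega>. h (\<lambda>u. Y n u \<omega>)) - integral\<^sup>L N (\<lambda>\<omega>. h (\<lambda>u. Z u \<omega>))) < r"
  proof (intro exI[of _ n0] allI impI)
    fix n assume "n0 \<le> n"
    then show "norm (integral\<^sup>L M (\<lambda>\<omega>. h (\<lambda>u. Y n u \<omega>)) - integral\<^sup>L N (\<lambda>\<omega>. h (\<lambda>u. Z u \<omega>))) < r"
      using n0[of n] E[OF M hY _ Y2, of n] E[OF N hZ _ Z2] tp e by (auto simp: abs_less_iff abs_le_iff)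
  qed
qed

section \<open>Copulas\<close>

lemma vec_upd_nth [simp]: "vec_upd u i t $ j = (if j = i then t else u $ j)"
  by (simp add: vec_upd_def)

lemma vec_upd_mem_cube: "u \<in> {0..1} \<Longrightarrow> t \<in> {0..1} \<Longrightarrow> vec_upd u i t \<in> {0..1::real^'d}"
  by (auto simp: less_eq_vec_def)

lemma mem_cube_iff: "u \<in> {0..1::real^'d} \<longleftrightarrow> (\<forall>i. 0 \<le> u $ i \<and> u $ i \<le> 1)"
  by (auto simp: less_eq_vec_def)

lemma measurable_vec_nth_borel [measurable]: "(\<lambda>x::real^'d. x $ i) \<in> borel_measurable borel"
  by (intro borel_measurable_continuous_onI continuous_intros)

text \<open>All claims come from the measure behind \<open>C\<close>: the orthant
  \<open>{..u}\<close> minus \<open>{..v}\<close> is covered by the strips between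
  \<open>v $ i\<close> and \<open>u $ i\<close>, whose masses are the lengths of these intervals
  because the margins are uniform.\<close>

lemma
  assumes "copula (C :: real ^ 'd \<Rightarrow> real)"
  shows copula_diff_le: "u \<in> {0..1} \<Longrightarrow> v \<in> {0..1} \<Longrightarrow> C u - C v \<le> (\<Sum>i\<in>UNIV. max 0 (u $ i - v $ i))"
    and copula_mono: "u \<in> {0..1} \<Longrightarrow> v \<in> {0..1} \<Longrightarrow> u \<le> v \<Longrightarrow> C u \<le> C v"
    and copula_margin: "t \<in> {0..1} \<Longrightarrow> C (vec_upd 1 i t) = t"
    and copula_range: "u \<in> {0..1} \<Longrightarrow> C u \<in> {0..1}"
    and copula_one: "C 1 = 1"
proof -
  obtain Q where "prob_space Q" and Qb: "sets Q = sets borel"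
    and marg: "\<And>i t. t \<in> {0..1} \<Longrightarrow> marginal_cdf Q i t = t" and C: "\<And>u. u \<in> {0..1} \<Longrightarrow> C u = measure Q {..u}"
    using assms unfolding copula_def joint_cdf_def by blast
  interpret Q: prob_space Q by fact
  have sp: "space Q = UNIV" using sets_eq_imp_space_eq[OF Qb] by simp
  have meas [measurable]: "(\<lambda>x. x $ i) \<in> borel_measurable Q" for i
    using measurable_vec_nth_borel measurable_cong_sets[OF Qb refl] by blast
  have marg': "measure Q {x. x $ i \<le> t} = t" if "t \<in> {0..1}" for i t
    using marg[OF that, of i] unfolding marginal_cdf_def cdf_def
    by (subst (asm) measure_distr) (auto simp: sp vimage_def)
  have S1 [measurable]: "{x. x $ i \<le> t} \<in> sets Q" for i t
    using measurable_sets[OF meas, of "{..t}" i] by (simp add: vimage_def sp)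
  have S [measurable]: "{..u} \<in> sets Q" for u by (simp add: Qb)
  show "C u - C v \<le> (\<Sum>i\<in>UNIV. max 0 (u $ i - v $ i))" if uv: "u \<in> {0..1}" "v \<in> {0..1}"
  proof -
    let ?A = "\<lambda>i. {x. x $ i \<le> u $ i} - {x. x $ i \<le> v $ i}"
    have "C u - C v = Q.prob {..u} - Q.prob {..v}" using C uv by simp
    also have "\<dots> \<le> Q.prob ({..v} \<union> (\<Union>i. ?A i)) - Q.prob {..v}"
      by (intro diff_right_mono Q.finite_measure_mono) (auto simp: less_eq_vec_def not_le; metis not_le)+
    also have "\<dots> \<le> Q.prob (\<Union>i. ?A i)"
      using measure_Un_le[of "{..v}" Q "\<Union>i. ?A i"] by auto
    also have "\<dots> \<le> (\<Sum>i\<in>UNIV. Q.prob (?A i))"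
      by (intro Q.finite_measure_subadditive_finite) auto
    also have "\<dots> \<le> (\<Sum>i\<in>UNIV. max 0 (u $ i - v $ i))"
    proof (rule sum_mono)
      fix i
      show "Q.prob (?A i) \<le> max 0 (u $ i - v $ i)"
      proof (cases "u $ i \<le> v $ i")
        case True
        then have A: "?A i = {}" by auto
        show ?thesis unfolding A by simp
      next
        case False
        then have "Q.prob (?A i) = Q.prob {x. x $ i \<le> u $ i} - Q.prob {x. x $ i \<le> v $ i}"
          by (intro Q.finite_measure_Diff) auto
        also have "\<dots> = u $ i - v $ i" using marg'[of "u $ i" i] marg'[of "v $ i" i] uv unfolding mem_cube_iff by auto
        finally show ?thesis by simp
      qed
    qed
    finally show ?thesis .
  qed
  show "C u \<le> C v" if "u \<in> {0..1}" "v \<in> {0..1}" "u \<le> v"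
    using that C by (auto intro!: Q.finite_measure_mono)
  show "C u \<in> {0..1}" if "u \<in> {0..1}"
    using that C by auto
  have ae1: "AE x in Q. x $ i \<le> 1" for i
    using Q.prob_eq_1[of "{x. x $ i \<le> 1}"] marg'[of 1] by simp
  have up: "C (vec_upd 1 i t) = t" if "t \<in> {0..1}" for i t
  proof -
    \<comment> \<open>Almost every point has all coordinates at most 1, so the bounds 1 in the other
      coordinates of \<open>vec_upd 1 i t\<close> cut off no mass.\<close>
    have ae: "AE x in Q. \<forall>j. x $ j \<le> 1" using ae1 by (simp add: AE_all_countable)
    have "C (vec_upd 1 i t) = Q.prob {..vec_upd 1 i t}"
      by (rule C, rule vec_upd_mem_cube[OF _ that]) (simp add: less_eq_vec_def)
    also have "\<dots> = Q.prob {x. x $ i \<le> t}"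
      using ae that by (intro Q.finite_measure_eq_AE) (auto elim!: eventually_mono simp: less_eq_vec_def)
    finally show ?thesis using marg'[OF that] by simp
  qed
  show "t \<in> {0..1} \<Longrightarrow> C (vec_upd 1 i t) = t" by (rule up)
  have "vec_upd 1 undefined 1 = (1 :: real^'d)" by (simp add: vec_eq_iff)
  with up[of 1 undefined] show "C 1 = 1" by simp
qed

lemma copula_lipschitz:
  assumes "copula (C :: real ^ 'd \<Rightarrow> real)" "u \<in> {0..1}" "v \<in> {0..1}"
  shows "\<bar>C u - C v\<bar> \<le> (\<Sum>i\<in>UNIV. \<bar>u $ i - v $ i\<bar>)"
proof -
  have "(\<Sum>i\<in>UNIV. max 0 (u $ i - v $ i)) \<le> (\<Sum>i\<in>UNIV. \<bar>u $ i - v $ i\<bar>)"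
    "(\<Sum>i\<in>UNIV. max 0 (v $ i - u $ i)) \<le> (\<Sum>i\<in>UNIV. \<bar>u $ i - v $ i\<bar>)"
    by (auto intro!: sum_mono)
  then show ?thesis
    using copula_diff_le[OF assms] copula_diff_le[OF assms(1,3,2)] by linarith
qed

lemma copula_zero:
  assumes "copula (C :: real ^ 'd \<Rightarrow> real)" "u \<in> {0..1}" "u $ i = 0"
  shows "C u = 0"
proof -
  have "C u \<le> C (vec_upd 1 i 0)"
    using assms by (intro copula_mono) (auto simp: less_eq_vec_def)
  then show ?thesis using copula_margin[OF assms(1), of 0 i] copula_range[OF assms(1,2)] by auto
qed

lemma copula_continuous:
  assumes "copula (C :: real ^ 'd \<Rightarrow> real)"
  shows "continuous_on {0..1} C"
proof (rule continuous_on_eq_continuous_within[THEN iffD2], rule ballI)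
  fix u :: "real^'d" assume u: "u \<in> {0..1}"
  have "((\<lambda>v. \<Sum>i\<in>UNIV. \<bar>v $ i - u $ i\<bar>) \<longlongrightarrow> (\<Sum>i\<in>UNIV. \<bar>u $ i - u $ i\<bar>)) (at u within {0..1})"
    by (intro tendsto_intros)
  then have "((\<lambda>v. \<Sum>i\<in>UNIV. \<bar>v $ i - u $ i\<bar>) \<longlongrightarrow> 0) (at u within {0..1})" by simp
  moreover have "\<forall>\<^sub>F v in at u within {0..1}. norm (C v - C u) \<le> (\<Sum>i\<in>UNIV. \<bar>v $ i - u $ i\<bar>)"
    using copula_lipschitz[OF assms _ u] by (auto simp: eventually_at_filter)
  ultimately have "((\<lambda>v. C v - C u) \<longlongrightarrow> 0) (at u within {0..1})" by (rule Lim_null_comparison[rotated])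
  then show "continuous (at u within {0..1}) C"
    unfolding continuous_within by (simp add: Lim_null[of C])
qed

lemma partial_slice_lipschitz:
  assumes "copula (C :: real ^ 'd \<Rightarrow> real)" "u \<in> {0..1}" "s \<in> {0..1}" "t \<in> {0..1}" "s \<le> t"
  shows "partial_slice C i u s \<le> partial_slice C i u t"
    "partial_slice C i u t - partial_slice C i u s \<le> t - s"
proof -
  have m: "vec_upd u i s \<in> {0..1}" "vec_upd u i t \<in> {0..1}"
    by (rule vec_upd_mem_cube[OF assms(2) assms(3)], rule vec_upd_mem_cube[OF assms(2) assms(4)])
  show "partial_slice C i u s \<le> partial_slice C i u t"
    unfolding partial_slice_def using assms
    by (intro copula_mono m) (auto simp: less_eq_vec_def)
  have "(\<Sum>j\<in>UNIV. max 0 (vec_upd u i t $ j - vec_upd u i s $ j)) = (\<Sum>j\<in>UNIV. if j = i then t - s else 0)"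
    using assms(5) by (intro sum.cong) auto
  then show "partial_slice C i u t - partial_slice C i u s \<le> t - s"
    unfolding partial_slice_def using copula_diff_le[OF assms(1) m(2,1)] by simp
qed

text \<open>A slice of a copula is nondecreasing and 1-Lipschitz, so its right difference quotients
  lie in \<open>[0, 1]\<close>, and so does their limit.\<close>

lemma partial_deriv_bounds:
  assumes C: "copula (C :: real ^ 'd \<Rightarrow> real)" and "continuous_partial C i" "u \<in> open_slab i"
  shows "0 \<le> partial_deriv C i u" "partial_deriv C i u \<le> 1"
    and "(partial_slice C i u has_field_derivative partial_deriv C i u) (at (u $ i))"
proof -
  let ?f = "partial_slice C i u"
  have u: "u \<in> {0..1}" "0 < u $ i" "u $ i < 1" using assms by (auto simp: open_slab_def)
  show D: "(?f has_field_derivative partial_deriv C i u) (at (u $ i))"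
    using assms by (simp add: continuous_partial_def partial_deriv_def DERIV_deriv_iff_field_differentiable)
  have lim: "((\<lambda>h. (?f (u $ i + h) - ?f (u $ i)) / h) \<longlongrightarrow> partial_deriv C i u) (at_right 0)"
    using D unfolding DERIV_def by (rule tendsto_mono[rotated]) (simp add: at_within_le_at)
  have ev: "\<forall>\<^sub>F h in at_right 0. h \<in> {0<..<1 - u $ i}"
    using u by (intro eventually_at_right_real) auto
  have ineq: "0 \<le> (?f (u $ i + h) - ?f (u $ i)) / h" "(?f (u $ i + h) - ?f (u $ i)) / h \<le> 1"
    if "h \<in> {0<..<1 - u $ i}" for h
    using partial_slice_lipschitz[OF C u(1), of "u $ i" "u $ i + h" i] that u by auto
  show "0 \<le> partial_deriv C i u"
    by (rule tendsto_lowerbound[OF lim]) (use ev ineq in \<open>auto elim!: eventually_mono\<close>)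
  show "partial_deriv C i u \<le> 1"
    by (rule tendsto_upperbound[OF lim]) (use ev ineq in \<open>auto elim!: eventually_mono\<close>)
qed

section \<open>The supremum norm near a function\<close>

text \<open>A single pair \<open>\<delta>\<close>, \<open>\<epsilon>\<close> instead of a modulus
  for every \<open>\<epsilon>\<close>: a path with jumps can satisfy the former but not the latter.
  Distances are coordinatewise to fit the grids of the chaining argument.\<close>

definition cube_modulus :: "(real ^ 'd \<Rightarrow> real) \<Rightarrow> real \<Rightarrow> real \<Rightarrow> bool" where
  "cube_modulus g \<delta> \<epsilon> \<longleftrightarrow>
     (\<forall>u\<in>{0..1}. \<forall>v\<in>{0..1}. (\<forall>i. \<bar>u $ i - v $ i\<bar> \<le> \<delta>) \<longrightarrow> \<bar>g u - g v\<bar> \<le> \<epsilon>)"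

lemma cube_modulusD:
  "cube_modulus g \<delta> \<epsilon> \<Longrightarrow> u \<in> {0..1} \<Longrightarrow> v \<in> {0..1} \<Longrightarrow> (\<And>i. \<bar>u $ i - v $ i\<bar> \<le> \<delta>) \<Longrightarrow> \<bar>g u - g v\<bar> \<le> \<epsilon>"
  by (auto simp: cube_modulus_def)

lemma zero_le_one_vec [simp]: "(0 :: real ^ 'd) \<le> 1"
  by (simp add: less_eq_vec_def)

lemma compact_cube: "compact {0..1::real^'d}"
  by (simp add: interval_cbox_cart)

lemma dist_le_sup_coordinates:
  fixes u v :: "real ^ 'd"
  assumes "\<And>i. \<bar>u $ i - v $ i\<bar> \<le> \<delta>"
  shows "dist u v \<le> real CARD('d) * \<delta>"
proof -
  have "dist u v \<le> (\<Sum>i\<in>UNIV. \<bar>(u - v) $ i\<bar>)"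
    unfolding dist_norm by (rule norm_le_l1_cart)
  also have "\<dots> \<le> (\<Sum>i\<in>(UNIV::'d set). \<delta>)" using assms by (intro sum_mono) simp
  finally show ?thesis by simp
qed

lemma abs_coordinate_le_dist: "\<bar>u $ i - v $ i\<bar> \<le> dist u (v :: real ^ 'd)"
  using component_le_norm_cart[of "u - v" i] by (simp add: dist_norm)

lemma uniformly_continuous_on_coordinates:
  fixes g :: "real ^ 'd \<Rightarrow> real"
  assumes "compact S" "continuous_on S g" "0 < \<epsilon>"
  obtains \<delta> where "0 < \<delta>"
    "\<And>u v. u \<in> S \<Longrightarrow> v \<in> S \<Longrightarrow> (\<And>i. \<bar>u $ i - v $ i\<bar> \<le> \<delta>) \<Longrightarrow> \<bar>g u - g v\<bar> \<le> \<epsilon>"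
proof -
  obtain \<eta> where \<eta>: "\<eta> > 0" "\<And>u v. u \<in> S \<Longrightarrow> v \<in> S \<Longrightarrow> dist u v < \<eta> \<Longrightarrow> dist (g u) (g v) < \<epsilon>"
    using compact_uniformly_continuous[OF assms(2,1)] assms(3)
    unfolding uniformly_continuous_on_def by metis
  define \<delta> where "\<delta> = \<eta> / (2 * real CARD('d))"
  have d: "\<delta> > 0" "real CARD('d) * \<delta> < \<eta>" using \<eta> by (auto simp: \<delta>_def)
  show thesis
  proof (rule that[OF d(1)])
    fix u v :: "real^'d" assume *: "u \<in> S" "v \<in> S" "\<And>i. \<bar>u $ i - v $ i\<bar> \<le> \<delta>"
    then have "dist u v < \<eta>" using dist_le_sup_coordinates[of u v \<delta>] d by simp
    from \<eta>(2)[OF *(1,2) this] show "\<bar>g u - g v\<bar> \<le> \<epsilon>" by (simp add: dist_real_def)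
  qed
qed

lemma continuous_imp_cube_modulus:
  assumes "continuous_on {0..1} g" "0 < \<epsilon>"
  obtains \<delta> where "0 < \<delta>" "cube_modulus g \<delta> \<epsilon>"
proof -
  from uniformly_continuous_on_coordinates[OF compact_cube assms] show thesis
    using that unfolding cube_modulus_def by metis
qed

lemma sup_norm_upper:
  "bounded (h ` {0..1}) \<Longrightarrow> u \<in> {0..1} \<Longrightarrow> \<bar>h u\<bar> \<le> sup_norm h"
  unfolding sup_norm_def
  by (rule cSUP_upper) (auto simp: bounded_iff bdd_above_def)

lemma sup_norm_least:
  "(\<And>u. u \<in> {0..1} \<Longrightarrow> \<bar>h u\<bar> \<le> c) \<Longrightarrow> sup_norm h \<le> c"
  unfolding sup_norm_def by (rule cSUP_least) auto

lemma bounded_cubeI: "(\<And>u. u \<in> {0..1} \<Longrightarrow> \<bar>h u\<bar> \<le> c) \<Longrightarrow> bounded (h ` {0..1::real^'d})" for h :: "_ \<Rightarrow> real"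
  unfolding bounded_iff by fastforce

lemma continuous_bounded_cube: "continuous_on {0..1} h \<Longrightarrow> bounded (h ` {0..1::real^'d})" for h :: "_ \<Rightarrow> real"
  by (rule compact_imp_bounded[OF compact_continuous_image[OF _ compact_cube]])

lemma argmax_set_abs: "argmax_set (\<lambda>u. \<bar>f u\<bar>) = {u \<in> {0..1}. \<bar>f u\<bar> = sup_norm f}"
  by (simp add: argmax_set_def sup_norm_def)

lemma argmax_set_props:
  fixes f :: "real ^ 'd \<Rightarrow> real"
  assumes f: "continuous_on {0..1} f" and nz: "\<exists>u\<in>{0..1}. f u \<noteq> 0"
  shows "0 < sup_norm f" "argmax_set (\<lambda>u. \<bar>f u\<bar>) \<noteq> {}" "compact (argmax_set (\<lambda>u. \<bar>f u\<bar>))"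
    "u \<in> argmax_set (\<lambda>u. \<bar>f u\<bar>) \<Longrightarrow> u \<in> {0..1} \<and> f u = sgn (f u) * sup_norm f \<and> \<bar>sgn (f u)\<bar> = 1"
proof -
  have bd: "bounded (f ` {0..1})" by (rule continuous_bounded_cube[OF f])
  obtain u0 where "u0 \<in> {0..1}" "f u0 \<noteq> 0" using nz by auto
  then show pos: "0 < sup_norm f" using sup_norm_upper[OF bd, of u0] by auto
  have cf: "continuous_on {0..1} (\<lambda>u. \<bar>f u\<bar>)" by (intro continuous_intros f)
  obtain w where w: "w \<in> {0..1}" "\<And>u. u \<in> {0..1} \<Longrightarrow> \<bar>f u\<bar> \<le> \<bar>f w\<bar>"
    using continuous_attains_sup[OF compact_cube _ cf] zero_le_one_vec
    by (metis atLeastatMost_empty_iff)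
  then have "sup_norm f = \<bar>f w\<bar>"
    using sup_norm_least[of f "\<bar>f w\<bar>"] sup_norm_upper[OF bd w(1)] by auto
  then show "argmax_set (\<lambda>u. \<bar>f u\<bar>) \<noteq> {}" unfolding argmax_set_abs using w(1) by auto
  have "closed ({0..1} \<inter> (\<lambda>u. \<bar>f u\<bar>) -` {sup_norm f})"
    by (intro continuous_closed_preimage cf) (auto intro: compact_imp_closed compact_cube)
  then have "compact ({0..1} \<inter> ({0..1} \<inter> (\<lambda>u. \<bar>f u\<bar>) -` {sup_norm f}))"
    by (intro compact_Int_closed compact_cube)
  also have "({0..1} \<inter> ({0..1} \<inter> (\<lambda>u. \<bar>f u\<bar>) -` {sup_norm f})) = argmax_set (\<lambda>u. \<bar>f u\<bar>)"
    unfolding argmax_set_abs by auto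
  finally show "compact (argmax_set (\<lambda>u. \<bar>f u\<bar>))" .
  show "u \<in> {0..1} \<and> f u = sgn (f u) * sup_norm f \<and> \<bar>sgn (f u)\<bar> = 1" if "u \<in> argmax_set (\<lambda>u. \<bar>f u\<bar>)"
    using that pos unfolding argmax_set_abs by (auto simp: sgn_if)
qed

text \<open>At a maximizer the absolute value is the positive supremum. Within a distance over which
  \<open>f\<close> changes by at most half of it, the sign cannot change.\<close>

lemma argmax_sign_constant:
  fixes f :: "real ^ 'd \<Rightarrow> real"
  assumes f: "continuous_on {0..1} f" and nz: "\<exists>u\<in>{0..1}. f u \<noteq> 0"
  obtains \<delta> where "0 < \<delta>"
    "\<And>u w. w \<in> argmax_set (\<lambda>u. \<bar>f u\<bar>) \<Longrightarrow> u \<in> {0..1} \<Longrightarrow> (\<And>i. \<bar>u $ i - w $ i\<bar> \<le> \<delta>) \<Longrightarrow> sgn (f u) = sgn (f w)"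
proof -
  note K = argmax_set_props[OF f nz]
  obtain \<delta> where d: "0 < \<delta>" "cube_modulus f \<delta> (sup_norm f / 2)"
    using continuous_imp_cube_modulus[OF f, of "sup_norm f / 2"] K(1) by auto
  show thesis
  proof (rule that[OF d(1)])
    fix u w assume uw: "w \<in> argmax_set (\<lambda>u. \<bar>f u\<bar>)" "u \<in> {0..1}" "\<And>i. \<bar>u $ i - w $ i\<bar> \<le> \<delta>"
    have "\<bar>f u - f w\<bar> \<le> sup_norm f / 2"
      using K(4)[OF uw(1)] uw by (intro cube_modulusD[OF d(2)]) auto
    moreover have "\<bar>f w\<bar> = sup_norm f" using uw(1) by (simp add: argmax_set_abs)
    ultimately show "sgn (f u) = sgn (f w)" using K(1) by (auto simp: sgn_if abs_if split: if_splits)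
  qed
qed

text \<open>A quantitative form of the directional derivative. The bound \<open>s0\<close> depends
  on \<open>f\<close>, \<open>\<delta>\<close> and \<open>R\<close> but not on \<open>h\<close> or
  \<open>g\<close>, so it can be fixed before a random path is chosen. The perturbation
  \<open>h\<close> may jump; only its approximation \<open>g\<close> has a modulus. One
  \<open>\<epsilon>\<close> pays for replacing \<open>h\<close> by \<open>g\<close>, the other for
  moving to a nearby maximizer.\<close>

lemma sup_norm_expansion:
  fixes f :: "real ^ 'd \<Rightarrow> real"
  assumes f: "continuous_on {0..1} f" and nz: "\<exists>u\<in>{0..1}. f u \<noteq> 0"
    and \<delta>: "0 < \<delta>" and R: "0 \<le> R"
  obtains s0 where "0 < s0"
    "\<And>s h g \<epsilon>. 0 < s \<Longrightarrow> s \<le> s0 \<Longrightarrow> (\<And>u. u \<in> {0..1} \<Longrightarrow> \<bar>h u\<bar> \<le> R) \<Longrightarrow>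
       (\<And>u. u \<in> {0..1} \<Longrightarrow> \<bar>h u - g u\<bar> \<le> \<epsilon>) \<Longrightarrow> cube_modulus g \<delta> \<epsilon> \<Longrightarrow>
       \<bar>(sup_norm (\<lambda>u. f u + s * h u) - sup_norm f) / s -
         (SUP u\<in>argmax_set (\<lambda>u. \<bar>f u\<bar>). g u * sgn (f u))\<bar> \<le> 2 * \<epsilon>"
proof -
  define K where "K = argmax_set (\<lambda>u. \<bar>f u\<bar>)"
  note K = argmax_set_props[OF f nz, folded K_def]
  define m where "m = sup_norm f"
  have bd: "bounded (f ` {0..1})" by (rule continuous_bounded_cube[OF f])
  obtain \<delta>' where \<delta>': "0 < \<delta>'"
    "\<And>u w. w \<in> K \<Longrightarrow> u \<in> {0..1} \<Longrightarrow> (\<And>i. \<bar>u $ i - w $ i\<bar> \<le> \<delta>') \<Longrightarrow> sgn (f u) = sgn (f w)"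
    using argmax_sign_constant[OF f nz] unfolding K_def by metis
  \<comment> \<open>Within \<open>r\<close> of a maximizer both the sign of \<open>f\<close> and, up
    to \<open>\<epsilon>\<close>, the value of \<open>g\<close> are controlled. The rest
    \<open>L\<close> of the cube is compact and misses the maximizers, so
    \<open>\<bar>f\<bar>\<close> stays below its supremum by some \<open>\<kappa>\<close>
    there.\<close>
  define r where "r = min \<delta> \<delta>'"
  have r: "0 < r" "r \<le> \<delta>" "r \<le> \<delta>'" using \<delta> \<delta>' by (auto simp: r_def)
  define L where "L = {0..1} - (\<Union>w\<in>K. ball w r)"
  have cL: "compact L" unfolding L_def by (intro compact_diff compact_cube open_UN) auto
  obtain \<kappa> where \<kappa>: "\<kappa> > 0" "\<And>u. u \<in> L \<Longrightarrow> \<bar>f u\<bar> \<le> m - \<kappa>"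
  proof (cases "L = {}")
    case True
    then show ?thesis using that[of 1] by auto
  next
    case False
    have "continuous_on L (\<lambda>u. \<bar>f u\<bar>)"
      by (intro continuous_intros continuous_on_subset[OF f]) (auto simp: L_def)
    then obtain w where w: "w \<in> L" "\<And>u. u \<in> L \<Longrightarrow> \<bar>f u\<bar> \<le> \<bar>f w\<bar>"
      using continuous_attains_sup[OF cL False] by blast
    have "w \<in> {0..1}" "w \<notin> K" using w(1) r(1) unfolding L_def by auto
    then have "\<bar>f w\<bar> < m"
      using sup_norm_upper[OF bd] unfolding K_def argmax_set_abs m_def by (auto simp: less_le)
    then show ?thesis using that[of "m - \<bar>f w\<bar>"] w(2) by auto
  qed
  \<comment> \<open>Chosen so that \<open>2 * s * R\<close> is at most \<open>\<kappa>\<close> and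
    at most \<open>m\<close>: by the first, points of \<open>L\<close> cannot compete with a
    maximizer; by the second, near a maximizer the perturbed value cannot become large with the
    opposite sign. The summand 1 avoids division by zero.\<close>
  define s0 where "s0 = min m \<kappa> / (2 * (R + 1))"
  have m: "m > 0" using K by (simp add: m_def)
  have s0: "s0 > 0" using m \<kappa> R by (simp add: s0_def)
  show thesis
  proof (rule that[OF s0])
    fix s :: real and h g :: "real^'d \<Rightarrow> real" and \<epsilon> :: real
    assume s: "0 < s" "s \<le> s0" and hR: "\<And>u. u \<in> {0..1} \<Longrightarrow> \<bar>h u\<bar> \<le> R"
      and hg: "\<And>u. u \<in> {0..1} \<Longrightarrow> \<bar>h u - g u\<bar> \<le> \<epsilon>" and mod: "cube_modulus g \<delta> \<epsilon>"
    let ?S = "SUP u\<in>K. g u * sgn (f u)"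
    have sR: "2 * (s * R) \<le> m" "2 * (s * R) \<le> \<kappa>"
    proof -
      have "2 * (s * R) \<le> s * (2 * (R + 1))" using s by (simp add: algebra_simps)
      also have "\<dots> \<le> s0 * (2 * (R + 1))" using s R by (intro mult_right_mono) auto
      also have "\<dots> = min m \<kappa>" using R by (simp add: s0_def)
      finally have "2 * (s * R) \<le> min m \<kappa>" .
      then show "2 * (s * R) \<le> m" "2 * (s * R) \<le> \<kappa>" by linarith+
    qed
    have gK: "\<bar>g u * sgn (f u)\<bar> \<le> R + \<epsilon>" if "u \<in> K" for u
      using hg[of u] hR[of u] K(4)[OF that] by (simp add: abs_mult)
    have bdd: "bdd_above ((\<lambda>u. g u * sgn (f u)) ` K)"
      by (rule bdd_aboveI[of _ "R + \<epsilon>"]) (use gK in \<open>auto simp: abs_le_iff\<close>)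
    have up: "g u * sgn (f u) \<le> ?S" if "u \<in> K" for u
      using that bdd by (rule cSUP_upper)
    have bdh: "bounded ((\<lambda>u. f u + s * h u) ` {0..1})"
    proof (rule bounded_cubeI)
      fix u :: "real^'d" assume u: "u \<in> {0..1}"
      have "\<bar>f u + s * h u\<bar> \<le> \<bar>f u\<bar> + s * \<bar>h u\<bar>" using s by (simp add: abs_mult[of s] abs_triangle_ineq[THEN order_trans])
      also have "\<dots> \<le> m + s * R"
        using sup_norm_upper[OF bd u] hR[OF u] s unfolding m_def by (intro add_mono mult_left_mono) auto
      finally show "\<bar>f u + s * h u\<bar> \<le> m + s * R" .
    qed
    obtain w0 where w0: "w0 \<in> K" using K by auto
    have S_ge: "- (R + \<epsilon>) \<le> ?S" using up[OF w0] gK[OF w0] by linarith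
    have "sup_norm (\<lambda>u. f u + s * h u) \<le> m + s * (?S + 2 * \<epsilon>)"
    proof (rule sup_norm_least)
      fix u :: "real^'d" assume u: "u \<in> {0..1}"
      have e0: "0 \<le> \<epsilon>" using hg[OF u] by linarith
      \<comment> \<open>The value at any one maximizer gives
        \<open>?S >= - (R + \<epsilon>)\<close>, so everything that stays below
        \<open>m - s * R\<close> is harmless.\<close>
      have base: "m - s * R \<le> m + s * (?S + 2 * \<epsilon>)"
        using mult_left_mono[of "-R" "?S + 2 * \<epsilon>" s] S_ge e0 s by simp
      show "\<bar>f u + s * h u\<bar> \<le> m + s * (?S + 2 * \<epsilon>)"
      proof (cases "u \<in> L")
        case True
        have "\<bar>f u + s * h u\<bar> \<le> \<bar>f u\<bar> + s * \<bar>h u\<bar>"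
          using s by (simp add: abs_mult[of s] abs_triangle_ineq[THEN order_trans])
        also have "\<dots> \<le> (m - \<kappa>) + s * R"
          using \<kappa>(2)[OF True] hR[OF u] s by (intro add_mono mult_left_mono) auto
        also have "\<dots> \<le> m - s * R" using sR by linarith
        finally show ?thesis using base by linarith
      next
        case False
        then obtain w where w: "w \<in> K" "dist w u < r" using u unfolding L_def by auto
        have wr: "\<bar>u $ i - w $ i\<bar> \<le> r" for i
          using abs_coordinate_le_dist[of u i w] w(2) by (simp add: dist_commute)
        define \<sigma> where "\<sigma> = sgn (f w)"
        have sg: "sgn (f u) = \<sigma>" unfolding \<sigma>_def using wr r(3) w(1) u by (intro \<delta>'(2)) (auto intro: order_trans)
        have \<sigma>1: "\<bar>\<sigma>\<bar> = 1" and wc: "w \<in> {0..1}" using K(4)[OF w(1)] by (auto simp: \<sigma>_def)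
        have fu: "f u = \<sigma> * \<bar>f u\<bar>" unfolding sg[symmetric] by (simp add: sgn_mult_abs)
        have "\<bar>g u - g w\<bar> \<le> \<epsilon>" using wr r(2) by (intro cube_modulusD[OF mod u wc]) (auto intro: order_trans)
        then have "\<bar>h u - g w\<bar> \<le> 2 * \<epsilon>" using hg[OF u] by linarith
        then have "\<sigma> * h u \<le> g w * \<sigma> + 2 * \<epsilon>" using \<sigma>1 by (auto simp: abs_if split: if_splits)
        also have "\<dots> \<le> ?S + 2 * \<epsilon>" using up[OF w(1)] by (simp add: \<sigma>_def)
        finally have a: "s * (\<sigma> * h u) \<le> s * (?S + 2 * \<epsilon>)" using s by (intro mult_left_mono) auto
        have fm: "\<bar>f u\<bar> \<le> m" using sup_norm_upper[OF bd u] by (simp add: m_def)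
        have sh: "\<bar>s * h u\<bar> \<le> s * R" using hR[OF u] s by (simp add: abs_mult)
        have "\<bar>f u + s * h u\<bar> = \<bar>\<sigma> * (f u + s * h u)\<bar>" using \<sigma>1 by (simp add: abs_mult)
        also have "\<sigma> * (f u + s * h u) = \<bar>f u\<bar> + s * (\<sigma> * h u)"
        proof -
          have "\<sigma> * f u = \<bar>f u\<bar>" using \<sigma>1 by (subst fu) (auto simp: abs_if split: if_splits)
          then show ?thesis by (simp add: distrib_left)
        qed
        also have "\<bar>\<bar>f u\<bar> + s * (\<sigma> * h u)\<bar> \<le> m + s * (?S + 2 * \<epsilon>)"
        proof -
          have "\<bar>s * (\<sigma> * h u)\<bar> \<le> s * R" using sh \<sigma>1 by (simp add: abs_mult)
          then show ?thesis using a fm sR base by (auto simp: abs_le_iff)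
        qed
        finally show ?thesis .
      qed
    qed
    then have up1: "(sup_norm (\<lambda>u. f u + s * h u) - m) / s \<le> ?S + 2 * \<epsilon>"
      using s by (simp add: field_simps)
    have "?S \<le> (sup_norm (\<lambda>u. f u + s * h u) - m) / s + \<epsilon>"
    proof (rule cSUP_least[OF K(2)])
      fix w assume w: "w \<in> K"
      define \<sigma> where "\<sigma> = sgn (f w)"
      have \<sigma>1: "\<bar>\<sigma>\<bar> = 1" and wc: "w \<in> {0..1}" and fw: "f w = \<sigma> * m"
        using K(4)[OF w] by (auto simp: \<sigma>_def m_def)
      have "m + s * (\<sigma> * h w) = \<sigma> * (f w + s * h w)"
        using \<sigma>1 unfolding fw by (auto simp: abs_if algebra_simps split: if_splits)
      also have "\<dots> \<le> \<bar>\<sigma> * (f w + s * h w)\<bar>" by simp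
      also have "\<dots> = \<bar>f w + s * h w\<bar>" using \<sigma>1 by (simp add: abs_mult)
      also have "\<dots> \<le> sup_norm (\<lambda>u. f u + s * h u)"
        using sup_norm_upper[OF bdh wc] by simp
      finally have "\<sigma> * h w \<le> (sup_norm (\<lambda>u. f u + s * h u) - m) / s"
        using s by (simp add: field_simps)
      moreover have "g w * \<sigma> \<le> \<sigma> * h w + \<epsilon>"
        using hg[OF wc] \<sigma>1 by (auto simp: abs_if split: if_splits)
      ultimately show "g w * sgn (f w) \<le> (sup_norm (\<lambda>u. f u + s * h u) - m) / s + \<epsilon>"
        by (simp add: \<sigma>_def)
    qed
    moreover have "0 \<le> \<epsilon>" using hg[of 0] by (auto simp: zero_le_one_vec)
    ultimately show "\<bar>(sup_norm (\<lambda>u. f u + s * h u) - sup_norm f) / s -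
         (SUP u\<in>argmax_set (\<lambda>u. \<bar>f u\<bar>). g u * sgn (f u))\<bar> \<le> 2 * \<epsilon>"
      using up1 unfolding K_def[symmetric] m_def[symmetric] by (auto simp: abs_le_iff)
  qed
qed

text \<open>The directions \<open>h k\<close> may vary and be discontinuous because the expansion is
  uniform in them; the modulus it asks for is that of the fixed continuous \<open>g\<close>.\<close>

lemma sup_norm_hadamard:
  fixes f g :: "real ^ 'd \<Rightarrow> real"
  assumes f: "continuous_on {0..1} f" and g: "continuous_on {0..1} g" and nz: "\<exists>u\<in>{0..1}. f u \<noteq> 0"
  shows "has_hadamard_dir_deriv sup_norm f g (SUP u\<in>argmax_set (\<lambda>u. \<bar>f u\<bar>). g u * sgn (f u))"
  unfolding has_hadamard_dir_deriv_def
proof (intro conjI allI impI)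
  show bf: "bounded (f ` {0..1})" and bg: "bounded (g ` {0..1})"
    using continuous_bounded_cube f g by auto
  fix s :: "nat \<Rightarrow> real" and h :: "nat \<Rightarrow> real^'d \<Rightarrow> real"
  assume s: "\<forall>k. 0 < s k" "s \<longlonglongrightarrow> 0" and bh: "\<forall>k. bounded (h k ` {0..1})"
    and conv: "(\<lambda>k. sup_norm (\<lambda>u. h k u - g u)) \<longlonglongrightarrow> 0"
  let ?S = "SUP u\<in>argmax_set (\<lambda>u. \<bar>f u\<bar>). g u * sgn (f u)"
  \<comment> \<open>Eventually \<open>h k\<close> is within 1 of \<open>g\<close>, hence bounded by
    this number.\<close>
  define R where "R = sup_norm g + 1"
  have R: "0 \<le> R" using sup_norm_upper[OF bg, of 0] by (auto simp: R_def less_eq_vec_def)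
  show "(\<lambda>k. (sup_norm (\<lambda>u. f u + s k * h k u) - sup_norm f) / s k) \<longlonglongrightarrow> ?S"
  proof (rule LIMSEQ_I)
    fix r :: real assume r: "0 < r"
    define \<epsilon> where "\<epsilon> = min 1 (r / 4)"
    have \<epsilon>: "0 < \<epsilon>" "\<epsilon> \<le> 1" "2 * \<epsilon> < r" using r by (auto simp: \<epsilon>_def)
    obtain \<delta> where \<delta>: "0 < \<delta>" "cube_modulus g \<delta> \<epsilon>"
      using continuous_imp_cube_modulus[OF g \<epsilon>(1)] by auto
    obtain s0 where s0: "0 < s0"
      "\<And>s h g \<epsilon>. 0 < s \<Longrightarrow> s \<le> s0 \<Longrightarrow> (\<And>u. u \<in> {0..1} \<Longrightarrow> \<bar>h u\<bar> \<le> R) \<Longrightarrow>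
       (\<And>u. u \<in> {0..1} \<Longrightarrow> \<bar>h u - g u\<bar> \<le> \<epsilon>) \<Longrightarrow> cube_modulus g \<delta> \<epsilon> \<Longrightarrow>
       \<bar>(sup_norm (\<lambda>u. f u + s * h u) - sup_norm f) / s -
         (SUP u\<in>argmax_set (\<lambda>u. \<bar>f u\<bar>). g u * sgn (f u))\<bar> \<le> 2 * \<epsilon>"
    proof (rule sup_norm_expansion[OF f nz \<delta>(1) R], goal_cases)
      case (1 s0)
      show ?case by (rule 1(1)[OF 1(2)]) (rule 1(3))
    qed
    have "\<forall>\<^sub>F k in sequentially. s k < s0" using order_tendstoD(2)[OF s(2) s0(1)] .
    moreover have "\<forall>\<^sub>F k in sequentially. sup_norm (\<lambda>u. h k u - g u) < \<epsilon>"
      using order_tendstoD(2)[OF conv \<epsilon>(1)] .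
    ultimately have "\<forall>\<^sub>F k in sequentially.
      norm ((sup_norm (\<lambda>u. f u + s k * h k u) - sup_norm f) / s k - ?S) < r"
    proof eventually_elim
      case (elim k)
      have hg: "\<bar>h k u - g u\<bar> \<le> \<epsilon>" if "u \<in> {0..1}" for u
      proof -
        have "bounded ((\<lambda>u. h k u - g u) ` {0..1})"
          using bounded_minus_comp[of "h k" _ g] bh bg by auto
        from sup_norm_upper[OF this that] show ?thesis using elim by simp
      qed
      have "\<bar>h k u\<bar> \<le> R" if "u \<in> {0..1}" for u
        using hg[OF that] sup_norm_upper[OF bg that] \<epsilon> unfolding R_def by linarith
      then have "\<bar>(sup_norm (\<lambda>u. f u + s k * h k u) - sup_norm f) / s k - ?S\<bar> \<le> 2 * \<epsilon>"
        using s(1) elim(1) by (intro s0(2) hg \<delta>(2)) auto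
      then show ?case using \<epsilon>(3) by simp
    qed
    then show "\<exists>no. \<forall>n\<ge>no. norm ((sup_norm (\<lambda>u. f u + s n * h n u) - sup_norm f) / s n - ?S) < r"
      unfolding eventually_sequentially .
  qed
qed

lemma finite_net:
  fixes K :: "(real ^ 'd) set"
  assumes "compact K" "K \<noteq> {}" "0 < \<delta>"
  obtains F where "finite F" "F \<subseteq> K" "F \<noteq> {}" "\<And>u. u \<in> K \<Longrightarrow> \<exists>w\<in>F. \<forall>i. \<bar>u $ i - w $ i\<bar> \<le> \<delta>"
proof -
  obtain F where F: "F \<subseteq> K" "finite F" "K \<subseteq> (\<Union>w\<in>F. ball w \<delta>)"
    proof (rule compactE_image[OF assms(1), of K "\<lambda>w. ball w \<delta>"])
    show "K \<subseteq> (\<Union>c\<in>K. ball c \<delta>)" using assms(3) by auto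
  qed auto
  show thesis
  proof (rule that[OF F(2,1)])
    show "F \<noteq> {}" using F assms(2) by auto
    fix u assume "u \<in> K"
    then obtain w where "w \<in> F" "dist w u < \<delta>" using F by auto
    then show "\<exists>w\<in>F. \<forall>i. \<bar>u $ i - w $ i\<bar> \<le> \<delta>"
      using abs_coordinate_le_dist[of u _ w] by (metis dist_commute less_eq_real_def order.strict_trans1)
  qed
qed

text \<open>The product with the sign need not be continuous, but nearby points of \<open>K\<close>
  have equal signs, so it varies on \<open>K\<close> no more than \<open>g\<close> does.\<close>

lemma sup_net_approx:
  fixes f g :: "real ^ 'd \<Rightarrow> real"
  assumes "cube_modulus g \<delta> \<epsilon>" "F \<subseteq> K" "F \<noteq> {}" "finite F" "K \<subseteq> {0..1}"
    and net: "\<And>u. u \<in> K \<Longrightarrow> \<exists>w\<in>F. \<forall>i. \<bar>u $ i - w $ i\<bar> \<le> \<delta>"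
    and sg: "\<And>u w. u \<in> K \<Longrightarrow> w \<in> K \<Longrightarrow> (\<And>i. \<bar>u $ i - w $ i\<bar> \<le> \<delta>) \<Longrightarrow> sgn (f u) = sgn (f w)"
  shows "\<bar>(SUP u\<in>K. g u * sgn (f u)) - (SUP u\<in>F. g u * sgn (f u))\<bar> \<le> \<epsilon>"
proof -
  let ?p = "\<lambda>u. g u * sgn (f u)"
  have bF: "bdd_above (?p ` F)" using assms by auto
  have near: "?p u \<le> (SUP u\<in>F. ?p u) + \<epsilon>" if u: "u \<in> K" for u
  proof -
    obtain w where w: "w \<in> F" "\<And>i. \<bar>u $ i - w $ i\<bar> \<le> \<delta>" using net[OF u] by auto
    have "\<bar>g u - g w\<bar> \<le> \<epsilon>" using u w assms by (intro cube_modulusD[OF assms(1)]) auto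
    moreover have "sgn (f u) = sgn (f w)" using w u assms by (intro sg) auto
    ultimately have "?p u \<le> ?p w + \<epsilon>" by (auto simp: sgn_if abs_if split: if_splits)
    also have "?p w \<le> (SUP u\<in>F. ?p u)" using w bF by (intro cSUP_upper)
    finally show ?thesis by simp
  qed
  have "(SUP u\<in>K. ?p u) \<le> (SUP u\<in>F. ?p u) + \<epsilon>" using assms near by (intro cSUP_least) auto
  moreover have "bdd_above (?p ` K)" by (rule bdd_aboveI2[OF near])
  then have "(SUP u\<in>F. ?p u) \<le> (SUP u\<in>K. ?p u)" using assms by (intro cSUP_subset_mono) auto
  moreover have "0 \<le> \<epsilon>"
  proof -
    obtain w where "w \<in> F" using assms by auto
    then have "w \<in> K" "\<exists>v\<in>F. \<forall>i. \<bar>w $ i - v $ i\<bar> \<le> \<delta>" using assms net by auto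
    then have "0 \<le> \<delta>" by (meson abs_ge_zero order_trans)
    then show ?thesis using cube_modulusD[OF assms(1), of w w] \<open>w \<in> K\<close> assms by auto
  qed
  ultimately show ?thesis by (auto simp: abs_le_iff)
qed

section \<open>Linearization of the empirical copula\<close>

text \<open>Both sides say that no argument strictly below the observation reaches the level
  \<open>p\<close>: the largest value of the empirical margin there is the strict rank divided by
  \<open>n\<close>. Strict ranks make this correct with ties, and at \<open>p = 0\<close>, where the
  quantile is minus infinity and both sides fail.\<close>

lemma le_quantile_emp_marginal:
  assumes "0 < n"
  shows "ereal (x k $ i) \<le> quantile (emp_marginal n x i) p \<longleftrightarrow>
    real (card {j. j < n \<and> x j $ i < x k $ i}) < real n * p"
proof
  assume *: "ereal (x k $ i) \<le> quantile (emp_marginal n x i) p"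
  have lt: "emp_marginal n x i t < p" if "t < x k $ i" for t
  proof (rule ccontr)
    assume "\<not> emp_marginal n x i t < p"
    then have "quantile (emp_marginal n x i) p \<le> ereal t"
      unfolding quantile_def by (intro INF_lower) auto
    with * have "ereal (x k $ i) \<le> ereal t" by (rule order_trans)
    then show False using that by simp
  qed
  let ?A = "{j. j < n \<and> x j $ i < x k $ i}"
  \<comment> \<open>The witness is the largest smaller observation, or any smaller number if there
    is no such observation.\<close>
  have "\<exists>t < x k $ i. {j. j < n \<and> x j $ i \<le> t} = ?A"
  proof (cases "?A = {}")
    case True
    show ?thesis
    proof (intro exI conjI)
      show "x k $ i - 1 < x k $ i" by simp
      show "{j. j < n \<and> x j $ i \<le> x k $ i - 1} = ?A" using True by force
    qed
  next
    case False
    have fin: "finite ?A" by simp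
    let ?t = "Max ((\<lambda>j. x j $ i) ` ?A)"
    have "?t \<in> (\<lambda>j. x j $ i) ` ?A" using False fin by (intro Max_in) auto
    moreover have "x j $ i \<le> ?t" if "j \<in> ?A" for j using that fin by (intro Max_ge) auto
    ultimately show ?thesis by (intro exI[of _ ?t]) fastforce
  qed
  then obtain t where "t < x k $ i" "{j. j < n \<and> x j $ i \<le> t} = ?A" by blast
  with lt[of t] have "real (card ?A) / real n < p" by (simp add: emp_marginal_def)
  then show "real (card ?A) < real n * p" using assms by (simp add: field_simps)
next
  assume *: "real (card {j. j < n \<and> x j $ i < x k $ i}) < real n * p"
  show "ereal (x k $ i) \<le> quantile (emp_marginal n x i) p"
    unfolding quantile_def
  proof (rule INF_greatest)
    fix t assume "t \<in> {t. p \<le> emp_marginal n x i t}"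
    then have t: "real n * p \<le> real (card {j. j < n \<and> x j $ i \<le> t})"
      using assms by (simp add: emp_marginal_def field_simps)
    have "x k $ i \<le> t"
    proof (rule ccontr)
      assume "\<not> x k $ i \<le> t"
      then have "card {j. j < n \<and> x j $ i \<le> t} \<le> card {j. j < n \<and> x j $ i < x k $ i}"
        by (intro card_mono) auto
      with t * show False by linarith
    qed
    then show "ereal (x k $ i) \<le> ereal t" by simp
  qed
qed

text \<open>With the quantiles gone, invariance under increasing maps of the margins, measurability
  in the sample and constancy on cells in \<open>u\<close> can all be read off.\<close>

lemma emp_copula_rank:
  assumes "0 < n"
  shows "emp_copula n x u =
    real (card {k. k < n \<and> (\<forall>i. real (card {j. j < n \<and> x j $ i < x k $ i}) < real n * u $ i)}) / real n"
  unfolding emp_copula_def emp_cdf_def by (simp add: le_quantile_emp_marginal[OF assms])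

lemma emp_copula_order_cong:
  assumes "0 < n" "\<And>i j k. j < n \<Longrightarrow> k < n \<Longrightarrow> x j $ i < x k $ i \<longleftrightarrow> y j $ i < y k $ i"
  shows "emp_copula n x u = emp_copula n y u"
proof -
  have "{j. j < n \<and> x j $ i < x k $ i} = {j. j < n \<and> y j $ i < y k $ i}" if "k < n" for i k
    using assms(2) that by auto
  then have "{k. k < n \<and> (\<forall>i. real (card {j. j < n \<and> x j $ i < x k $ i}) < real n * u $ i)} =
    {k. k < n \<and> (\<forall>i. real (card {j. j < n \<and> y j $ i < y k $ i}) < real n * u $ i)}"
    by (intro Collect_cong conj_cong refl) simp
  then show ?thesis unfolding emp_copula_rank[OF assms(1)] by simp
qed

text \<open>The threshold is the largest observation whose rank is below \<open>n * p\<close>.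
  Without ties the ranks are consecutive integers, so the number of selected observations is
  \<open>n * p\<close> up to rounding. The threshold is kept in \<open>[0, 1]\<close> because it
  will be a coordinate of an argument of the copula.\<close>

lemma rank_threshold:
  fixes x :: "nat \<Rightarrow> real"
  assumes inj: "inj_on x {..<n}" and x: "\<And>k. k < n \<Longrightarrow> 0 < x k \<and> x k \<le> 1"
    and p: "0 \<le> p" "p \<le> 1"
  obtains v where "0 \<le> v" "v \<le> 1"
    "\<And>k. k < n \<Longrightarrow> real (card {j. j < n \<and> x j < x k}) < real n * p \<longleftrightarrow> x k \<le> v"
    "\<bar>real (card {k. k < n \<and> x k \<le> v}) - real n * p\<bar> \<le> 1"
proof -
  define rk where "rk k = card {j. j < n \<and> x j < x k}" for k
  define A where "A = {k. k < n \<and> real (rk k) < real n * p}"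
  have rk_mono: "rk j \<le> rk k" if "x j \<le> x k" for j k
    unfolding rk_def using that by (intro card_mono) auto
  have finA: "finite A" by (simp add: A_def)
  have "\<exists>v. 0 \<le> v \<and> v \<le> 1 \<and> (\<forall>k<n. real (rk k) < real n * p \<longleftrightarrow> x k \<le> v) \<and> real (card A) \<le> real n * p + 1"
  proof (cases "A = {}")
    case True
    \<comment> \<open>All observations are positive, so the threshold 0 selects none.\<close>
    then show ?thesis using x p by (intro exI[of _ 0]) (force simp: A_def)
  next
    case False
    have "Max (x ` A) \<in> x ` A" using False finA by (intro Max_in) auto
    then obtain l where l: "l \<in> A" "x l = Max (x ` A)" by auto
    have up: "x k \<le> x l" if "k \<in> A" for k unfolding l(2) using that finA by (intro Max_ge) auto
    have ln: "l < n" "real (rk l) < real n * p" using l(1) by (auto simp: A_def)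
    have iff: "real (rk k) < real n * p \<longleftrightarrow> x k \<le> x l" if "k < n" for k
      using up[of k] rk_mono[of k l] ln that unfolding A_def by force
    have "A \<subseteq> insert l {j. j < n \<and> x j < x l}"
    proof
      fix k assume k: "k \<in> A"
      then have "x k \<le> x l" "k < n" using up by (auto simp: A_def)
      moreover have "x k = x l \<Longrightarrow> k = l" using inj_onD[OF inj] ln(1) \<open>k < n\<close> by simp
      ultimately show "k \<in> insert l {j. j < n \<and> x j < x l}" by (auto simp: less_le)
    qed
    then have "card A \<le> card (insert l {j. j < n \<and> x j < x l})" by (intro card_mono) auto
    also have "\<dots> = rk l + 1" by (simp add: rk_def)
    finally have "real (card A) \<le> real n * p + 1" using ln by linarith
    then show ?thesis using iff x[OF ln(1)] by (intro exI[of _ "x l"]) auto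
  qed
  then obtain v where v: "0 \<le> v" "v \<le> 1" "\<And>k. k < n \<Longrightarrow> real (rk k) < real n * p \<longleftrightarrow> x k \<le> v"
    "real (card A) \<le> real n * p + 1" by blast
  have A_v: "{k. k < n \<and> x k \<le> v} = A" using v(3) by (auto simp: A_def)
  \<comment> \<open>If some observation is not selected, all observations below the smallest such
    one are selected, and their number, its rank, is at least \<open>n * p\<close>.\<close>
  have "real n * p \<le> real (card A)"
  proof (cases "A = {..<n}")
    case True
    then show ?thesis using p by (simp add: mult_left_le)
  next
    case False
    define Bc where "Bc = {..<n} - A"
    have "Bc \<noteq> {}" "finite Bc" using False by (auto simp: Bc_def A_def)
    then have "Min (x ` Bc) \<in> x ` Bc" by (intro Min_in) auto
    then obtain l where l: "l \<in> Bc" "x l = Min (x ` Bc)" by auto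
    have "{j. j < n \<and> x j < x l} \<subseteq> A"
    proof
      fix j assume j: "j \<in> {j. j < n \<and> x j < x l}"
      show "j \<in> A"
      proof (rule ccontr)
        assume "j \<notin> A"
        then have "j \<in> Bc" using j by (auto simp: Bc_def)
        then have "x l \<le> x j" unfolding l(2) using \<open>finite Bc\<close> by (intro Min_le) auto
        then show False using j by simp
      qed
    qed
    then have "rk l \<le> card A" unfolding rk_def by (intro card_mono finA)
    moreover have "real n * p \<le> real (rk l)" using l(1) by (auto simp: Bc_def A_def)
    ultimately show ?thesis by linarith
  qed
  with v(4) A_v have "\<bar>real (card {k. k < n \<and> x k \<le> v}) - real n * p\<bar> \<le> 1" by auto
  with v show thesis unfolding rk_def by (intro that[of v]) auto
qed

text \<open>An almost sure event for the transformed sample. Positivity makes the empirical process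
  vanish on the lower faces; the absence of ties keeps the rounding error of the marginal counts at
  one.\<close>

definition generic_sample :: "nat \<Rightarrow> (nat \<Rightarrow> real ^ 'd) \<Rightarrow> bool" where
  "generic_sample n x \<longleftrightarrow>
     (\<forall>k<n. \<forall>i. 0 < x k $ i \<and> x k $ i \<le> 1) \<and> (\<forall>i. inj_on (\<lambda>k. x k $ i) {..<n})"

text \<open>The empirical copula at \<open>u\<close> is the empirical distribution function at a
  sample-dependent point \<open>v\<close> of the cube, which takes the place of the vector of
  marginal quantiles. The last claim says how far each margin at \<open>v\<close> is from
  \<open>u\<close>.\<close>

lemma emp_copula_threshold:
  fixes x :: "nat \<Rightarrow> real ^ 'd"
  assumes "0 < n" and gs: "generic_sample n x" and u: "u \<in> {0..1}"
  obtains v where "v \<in> {0..1}" "emp_copula n x u = real (card {k. k < n \<and> x k \<le> v}) / real n"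
    "\<And>i. \<bar>real (card {k. k < n \<and> x k $ i \<le> v $ i}) - real n * u $ i\<bar> \<le> 1"
proof -
  define Pv where "Pv i v \<longleftrightarrow> 0 \<le> v \<and> v \<le> 1 \<and>
    (\<forall>k<n. real (card {j. j < n \<and> x j $ i < x k $ i}) < real n * u $ i \<longleftrightarrow> x k $ i \<le> v) \<and>
    \<bar>real (card {k. k < n \<and> x k $ i \<le> v}) - real n * u $ i\<bar> \<le> 1" for i v
  have "\<exists>v. Pv i v" for i
    by (rule rank_threshold[of "\<lambda>k. x k $ i" n "u $ i"])
      (use gs u in \<open>auto simp: generic_sample_def less_eq_vec_def Pv_def\<close>)
  then obtain v where "\<And>i. Pv i (v i)" by metis
  note v = this[unfolded Pv_def]
  show thesis
  proof (rule that[of "\<chi> i. v i"])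
    show "(\<chi> i. v i) \<in> {0..1}" using v by (auto simp: less_eq_vec_def)
    have "{k. k < n \<and> (\<forall>i. real (card {j. j < n \<and> x j $ i < x k $ i}) < real n * u $ i)} =
      {k. k < n \<and> x k \<le> (\<chi> i. v i)}"
      using v by (auto simp: less_eq_vec_def)
    then show "emp_copula n x u = real (card {k. k < n \<and> x k \<le> (\<chi> i. v i)}) / real n"
      unfolding emp_copula_rank[OF assms(1)] by simp
  qed (use v in simp)
qed

definition emp_process :: "(real ^ 'd \<Rightarrow> real) \<Rightarrow> nat \<Rightarrow> (nat \<Rightarrow> real ^ 'd) \<Rightarrow> real ^ 'd \<Rightarrow> real" where
  "emp_process C n x u = sqrt (real n) * (real (card {k. k < n \<and> x k \<le> u}) / real n - C u)"

definition lin_process :: "(real ^ 'd \<Rightarrow> real) \<Rightarrow> (real ^ 'd \<Rightarrow> real) \<Rightarrow> real ^ 'd \<Rightarrow> real" where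
  "lin_process C a u = a u - (\<Sum>i\<in>UNIV. if 0 < u $ i \<and> u $ i < 1
                         then partial_deriv C i u * a (vec_upd 1 i (u $ i)) else 0)"

lemma limit_process_eq_lin: "limit_process C B u \<omega> = lin_process C (\<lambda>u. B u \<omega>) u"
  by (simp add: limit_process_def lin_process_def)

text \<open>These zeros make the margin terms of \<open>lin_process\<close> small near the faces,
  where nothing is known about the derivatives except that they lie in
  \<open>[0, 1]\<close>.\<close>

lemma emp_process_boundary:
  fixes x :: "nat \<Rightarrow> real ^ 'd"
  assumes C: "copula C" and gs: "generic_sample n x"
  shows "u \<in> {0..1} \<Longrightarrow> u $ i = 0 \<Longrightarrow> emp_process C n x u = 0" and "emp_process C n x 1 = 0"
proof -
  assume u: "u \<in> {0..1}" "u $ i = 0"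
  have "{k. k < n \<and> x k \<le> u} = {}"
    using gs u(2) unfolding generic_sample_def less_eq_vec_def by (metis (mono_tags, lifting) empty_Collect_eq not_le)
  then show "emp_process C n x u = 0"
    using copula_zero[OF C u] by (simp add: emp_process_def)
next
  have "{k. k < n \<and> x k \<le> 1} = {..<n}"
    using gs unfolding generic_sample_def less_eq_vec_def by auto
  then show "emp_process C n x 1 = 0"
    using copula_one[OF C] by (simp add: emp_process_def)
qed

lemma vec_upd_one_one [simp]: "vec_upd 1 i 1 = (1 :: real ^ 'd)"
  by (simp add: vec_eq_iff)

lemma vec_upd_one_mem [simp]: "vec_upd 1 i t \<in> {0..1::real^'d} \<longleftrightarrow> 0 \<le> t \<and> t \<le> 1"
  unfolding mem_cube_iff by (auto split: if_splits)

text \<open>The segment from 0 to \<open>u\<close> is cut into \<open>m\<close> pieces of coordinate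
  length at most \<open>1 / m <= \<delta>\<close>, and the increments along it are added. This turns
  equicontinuity into boundedness of the paths.\<close>

lemma cube_modulus_bound:
  assumes mod: "cube_modulus a \<delta> \<epsilon>" and a0: "a 0 = 0" and m: "1 \<le> real m * \<delta>" and u: "u \<in> {0..1::real^'d}"
  shows "\<bar>a u\<bar> \<le> real m * \<epsilon>"
proof -
  have m0: "m > 0" using m by (cases m) auto
  have "\<bar>a ((real j / real m) *\<^sub>R u)\<bar> \<le> real j * \<epsilon>" if "j \<le> m" for j
    using that
  proof (induction j)
    case 0
    then show ?case by (simp add: a0)
  next
    case (Suc j)
    have cube: "(real l / real m) *\<^sub>R u \<in> {0..1}" if "l \<le> m" for l
    proof -
      have "real l / real m \<le> 1" "0 \<le> real l / real m" using that m0 by auto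
      then have "0 \<le> real l / real m * u $ i \<and> real l / real m * u $ i \<le> 1" for i
        using u unfolding mem_cube_iff by (intro conjI mult_nonneg_nonneg mult_le_one) auto
      then show ?thesis unfolding mem_cube_iff by simp
    qed
    have "\<bar>a ((real (Suc j) / real m) *\<^sub>R u) - a ((real j / real m) *\<^sub>R u)\<bar> \<le> \<epsilon>"
    proof (rule cube_modulusD[OF mod cube cube])
      fix i
      have "0 \<le> u $ i" "u $ i \<le> 1" using u unfolding mem_cube_iff by auto
      have "((real (Suc j) / real m) *\<^sub>R u) $ i - ((real j / real m) *\<^sub>R u) $ i = u $ i / real m"
        by (simp add: field_simps add_divide_distrib)
      also have "\<bar>u $ i / real m\<bar> \<le> 1 / real m"
        using \<open>0 \<le> u $ i\<close> \<open>u $ i \<le> 1\<close> by (simp add: divide_right_mono)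
      also have "\<dots> \<le> \<delta>" using m m0 by (simp add: field_simps)
      finally show "\<bar>((real (Suc j) / real m) *\<^sub>R u) $ i - ((real j / real m) *\<^sub>R u) $ i\<bar> \<le> \<delta>" .
    qed (use Suc in auto)
    moreover have "\<bar>a ((real j / real m) *\<^sub>R u)\<bar> \<le> real j * \<epsilon>" using Suc by simp
    moreover have "real (Suc j) * \<epsilon> = real j * \<epsilon> + \<epsilon>" by (simp add: algebra_simps)
    ultimately show ?case by linarith
  qed
  from this[of m] show ?thesis using m0 by simp
qed

text \<open>Continuity on the open slab becomes uniform on the compact part at distance
  \<open>\<tau>\<close> from its two faces. Taking the minimum over the coordinates makes
  \<open>\<eta>\<close> independent of \<open>i\<close>.\<close>

lemma partial_deriv_uniformly_continuous:
  fixes C :: "real ^ 'd \<Rightarrow> real"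
  assumes cp: "\<And>i. continuous_partial C i" and "0 < \<tau>" "0 < \<rho>"
  obtains \<eta> where "0 < \<eta>"
    "\<And>i u v. u \<in> {0..1} \<Longrightarrow> v \<in> {0..1} \<Longrightarrow> \<tau> \<le> u $ i \<Longrightarrow> u $ i \<le> 1 - \<tau> \<Longrightarrow> \<tau> \<le> v $ i \<Longrightarrow> v $ i \<le> 1 - \<tau> \<Longrightarrow>
       (\<And>j. \<bar>u $ j - v $ j\<bar> \<le> \<eta>) \<Longrightarrow> \<bar>partial_deriv C i u - partial_deriv C i v\<bar> \<le> \<rho>"
proof -
  have "\<exists>\<eta>>0. \<forall>u v. u \<in> {0..1} \<longrightarrow> v \<in> {0..1} \<longrightarrow> \<tau> \<le> u $ i \<longrightarrow> u $ i \<le> 1 - \<tau> \<longrightarrow> \<tau> \<le> v $ i \<longrightarrow> v $ i \<le> 1 - \<tau> \<longrightarrow>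
       (\<forall>j. \<bar>u $ j - v $ j\<bar> \<le> \<eta>) \<longrightarrow> \<bar>partial_deriv C i u - partial_deriv C i v\<bar> \<le> \<rho>" for i
  proof -
    let ?S = "{0..1} \<inter> {u::real^'d. \<tau> \<le> u $ i \<and> u $ i \<le> 1 - \<tau>}"
    have "closed {u::real^'d. \<tau> \<le> u $ i \<and> u $ i \<le> 1 - \<tau>}"
      by (intro closed_Collect_conj closed_Collect_le continuous_intros)
    then have cS: "compact ?S" by (intro compact_Int_closed compact_cube)
    have "?S \<subseteq> open_slab i" using assms(2) by (auto simp: open_slab_def)
    then have "continuous_on ?S (partial_deriv C i)"
      using cp[of i] unfolding continuous_partial_def by (auto intro: continuous_on_subset)
    from uniformly_continuous_on_coordinates[OF cS this assms(3)]
    obtain \<eta> where "0 < \<eta>" "\<And>u v. u \<in> ?S \<Longrightarrow> v \<in> ?S \<Longrightarrow> (\<And>i. \<bar>u $ i - v $ i\<bar> \<le> \<eta>) \<Longrightarrow>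
       \<bar>partial_deriv C i u - partial_deriv C i v\<bar> \<le> \<rho>" by blast
    then show ?thesis by (intro exI[of _ \<eta>]) auto
  qed
  then obtain \<eta> where \<eta>: "\<And>i. 0 < \<eta> i" "\<And>i u v. u \<in> {0..1} \<Longrightarrow> v \<in> {0..1} \<Longrightarrow> \<tau> \<le> u $ i \<Longrightarrow> u $ i \<le> 1 - \<tau> \<Longrightarrow>
       \<tau> \<le> v $ i \<Longrightarrow> v $ i \<le> 1 - \<tau> \<Longrightarrow>
       (\<forall>j. \<bar>u $ j - v $ j\<bar> \<le> \<eta> i) \<Longrightarrow> \<bar>partial_deriv C i u - partial_deriv C i v\<bar> \<le> \<rho>"
    by metis
  show thesis
  proof (rule that[of "Min (range \<eta>)"])
    show "0 < Min (range \<eta>)" using \<eta>(1) by (subst Min_gr_iff) auto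
    fix i and u v :: "real^'d"
    assume *: "u \<in> {0..1}" "v \<in> {0..1}" "\<tau> \<le> u $ i" "u $ i \<le> 1 - \<tau>" "\<tau> \<le> v $ i" "v $ i \<le> 1 - \<tau>"
      and d: "\<And>j. \<bar>u $ j - v $ j\<bar> \<le> Min (range \<eta>)"
    have "Min (range \<eta>) \<le> \<eta> i" by (rule Min_le) auto
    then show "\<bar>partial_deriv C i u - partial_deriv C i v\<bar> \<le> \<rho>"
      using d by (intro \<eta>(2)[OF *]) (auto intro: order_trans)
  qed
qed

lemma margin_process_small:
  assumes mod: "cube_modulus a \<delta> \<epsilon>" and bdry: "a (vec_upd 1 i 0) = 0" "a 1 = 0"
    and t: "0 \<le> t" "t \<le> 1" "t \<le> \<delta> \<or> 1 - \<delta> \<le> t" and \<delta>: "0 \<le> \<delta>"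
  shows "\<bar>a (vec_upd 1 i t :: real ^ 'd)\<bar> \<le> \<epsilon>"
proof -
  have "\<exists>s\<in>{0, 1}. \<bar>t - s\<bar> \<le> \<delta>" using t by auto
  then obtain s where s: "s \<in> {0, 1}" "\<bar>t - s\<bar> \<le> \<delta>" by blast
  then have "\<bar>a (vec_upd 1 i t) - a (vec_upd 1 i s)\<bar> \<le> \<epsilon>"
    using t \<delta> by (intro cube_modulusD[OF mod]) (auto simp del: atLeastAtMost_iff)
  moreover have "a (vec_upd 1 i s) = 0" using s bdry by auto
  ultimately show ?thesis by simp
qed

text \<open>In coordinate \<open>i\<close>, either both points stay \<open>\<delta> / 2\<close> away
  from the two faces, where the derivative is uniformly continuous, or both lie within
  \<open>\<delta>\<close> of the faces, where each margin term is at most \<open>\<epsilon>\<close>.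
  Either way a coordinate costs \<open>2 * \<epsilon>\<close>. The same \<open>\<delta>'\<close>
  serves all paths \<open>a\<close>.\<close>

lemma lin_process_modulus:
  fixes C :: "real ^ 'd \<Rightarrow> real"
  assumes C: "copula C" and cp: "\<And>i. continuous_partial C i" and pos: "0 < \<delta>" "0 < \<epsilon>" "0 \<le> R"
  obtains \<delta>' where "0 < \<delta>'"
    "\<And>a. cube_modulus a \<delta> \<epsilon> \<Longrightarrow> (\<And>u. u \<in> {0..1} \<Longrightarrow> \<bar>a u\<bar> \<le> R) \<Longrightarrow>
       (\<And>i. a (vec_upd 1 i 0) = 0) \<Longrightarrow> a 1 = 0 \<Longrightarrow>
       cube_modulus (lin_process C a) \<delta>' ((1 + 2 * real CARD('d)) * \<epsilon>)"
proof -
  \<comment> \<open>With a variation of at most \<open>\<epsilon> / (R + 1)\<close> in the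
    derivative, its product with a path bounded by \<open>R\<close> changes by at most
    \<open>\<epsilon>\<close>.\<close>
  have \<tau>: "0 < \<delta> / 2" and \<rho>: "0 < \<epsilon> / (R + 1)" using pos by auto
  obtain \<eta> where \<eta>: "0 < \<eta>"
    "\<And>i u v. u \<in> {0..1} \<Longrightarrow> v \<in> {0..1} \<Longrightarrow> \<delta> / 2 \<le> u $ i \<Longrightarrow> u $ i \<le> 1 - \<delta> / 2 \<Longrightarrow> \<delta> / 2 \<le> v $ i \<Longrightarrow> v $ i \<le> 1 - \<delta> / 2 \<Longrightarrow>
       (\<And>j. \<bar>u $ j - v $ j\<bar> \<le> \<eta>) \<Longrightarrow> \<bar>partial_deriv C i u - partial_deriv C i v\<bar> \<le> \<epsilon> / (R + 1)"
    using partial_deriv_uniformly_continuous[OF cp \<tau> \<rho>] by blast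
  show thesis
  proof (rule that[of "min (\<delta> / 2) \<eta>"])
    show "0 < min (\<delta> / 2) \<eta>" using pos \<eta> by simp
    fix a :: "real ^ 'd \<Rightarrow> real" assume mod: "cube_modulus a \<delta> \<epsilon>" and R: "\<And>u. u \<in> {0..1} \<Longrightarrow> \<bar>a u\<bar> \<le> R"
      and bdry: "\<And>i. a (vec_upd 1 i 0) = 0" "a 1 = 0"
    show "cube_modulus (lin_process C a) (min (\<delta> / 2) \<eta>) ((1 + 2 * real CARD('d)) * \<epsilon>)"
      unfolding cube_modulus_def
    proof (intro ballI impI)
      fix u v :: "real^'d"
      assume uv: "u \<in> {0..1}" "v \<in> {0..1}" and d: "\<forall>i. \<bar>u $ i - v $ i\<bar> \<le> min (\<delta> / 2) \<eta>"
      have d': "\<bar>u $ i - v $ i\<bar> \<le> \<delta> / 2" "\<bar>u $ i - v $ i\<bar> \<le> \<eta>" for i using d by auto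
      have u01: "0 \<le> u $ i" "u $ i \<le> 1" "0 \<le> v $ i" "v $ i \<le> 1" for i
        using uv unfolding mem_cube_iff by auto
      let ?t = "\<lambda>w i. if 0 < w $ i \<and> w $ i < 1 then partial_deriv C i w * a (vec_upd 1 i (w $ i)) else 0"
      have term_le: "\<bar>?t w i\<bar> \<le> \<bar>a (vec_upd 1 i (w $ i))\<bar>" if "w \<in> {0..1}" for w i
        using partial_deriv_bounds[OF C cp, of w i] that
        by (auto simp: open_slab_def abs_mult intro!: mult_left_le_one_le)
      have "\<bar>?t u i - ?t v i\<bar> \<le> 2 * \<epsilon>" for i
      proof (cases "\<delta> / 2 \<le> u $ i \<and> u $ i \<le> 1 - \<delta> / 2 \<and> \<delta> / 2 \<le> v $ i \<and> v $ i \<le> 1 - \<delta> / 2")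
        case True
        then have int: "0 < u $ i" "u $ i < 1" "0 < v $ i" "v $ i < 1" using pos by auto
        let ?pu = "partial_deriv C i u" and ?pv = "partial_deriv C i v"
        let ?au = "a (vec_upd 1 i (u $ i))" and ?av = "a (vec_upd 1 i (v $ i))"
        have pv: "\<bar>?pv\<bar> \<le> 1" using partial_deriv_bounds[OF C cp, of v i] uv int by (simp add: open_slab_def)
        have "\<bar>?pu - ?pv\<bar> \<le> \<epsilon> / (R + 1)" using True uv d' by (intro \<eta>(2)) auto
        moreover have "\<bar>?au\<bar> \<le> R" using u01 by (intro R) (simp del: atLeastAtMost_iff)
        ultimately have "\<bar>?pu - ?pv\<bar> * \<bar>?au\<bar> \<le> \<epsilon> / (R + 1) * R" using pos by (intro mult_mono) auto
        also have "\<dots> \<le> \<epsilon>" using pos by (simp add: field_simps)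
        finally have 1: "\<bar>(?pu - ?pv) * ?au\<bar> \<le> \<epsilon>" by (simp add: abs_mult)
        have "\<bar>?au - ?av\<bar> \<le> \<epsilon>"
        proof (rule cube_modulusD[OF mod])
          show "\<bar>vec_upd 1 i (u $ i) $ j - vec_upd 1 i (v $ i) $ j\<bar> \<le> \<delta>" for j
            using d'(1)[of i] pos by simp
        qed (use u01 in \<open>simp_all del: atLeastAtMost_iff\<close>)
        then have "\<bar>?pv\<bar> * \<bar>?au - ?av\<bar> \<le> 1 * \<epsilon>" using pv by (intro mult_mono) auto
        then have 2: "\<bar>?pv * (?au - ?av)\<bar> \<le> \<epsilon>" by (simp add: abs_mult)
        have "?pu * ?au - ?pv * ?av = (?pu - ?pv) * ?au + ?pv * (?au - ?av)" by (simp add: algebra_simps)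
        with 1 2 have "\<bar>?pu * ?au - ?pv * ?av\<bar> \<le> 2 * \<epsilon>" by linarith
        then show ?thesis using int by simp
      next
        case False
        \<comment> \<open>One of the points is within \<open>\<delta> / 2\<close> of a face, and the
          other is at most \<open>\<delta> / 2\<close> away from it.\<close>
        have "(u $ i \<le> \<delta> \<or> 1 - \<delta> \<le> u $ i) \<and> (v $ i \<le> \<delta> \<or> 1 - \<delta> \<le> v $ i)"
          using False abs_le_D1[OF d'(1)[of i]] abs_le_D2[OF d'(1)[of i]] pos(1)
          by (smt (verit) field_sum_of_halves)
        then have "\<bar>a (vec_upd 1 i (u $ i))\<bar> \<le> \<epsilon>" "\<bar>a (vec_upd 1 i (v $ i))\<bar> \<le> \<epsilon>"
          using u01 pos by (auto intro!: margin_process_small[OF mod bdry])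
        then show ?thesis using term_le[OF uv(1), of i] term_le[OF uv(2), of i] by linarith
      qed
      then have "\<bar>\<Sum>i\<in>UNIV. ?t u i - ?t v i\<bar> \<le> (\<Sum>i\<in>(UNIV::'d set). 2 * \<epsilon>)"
        by (intro order_trans[OF sum_abs] sum_mono)
      moreover have "\<bar>a u - a v\<bar> \<le> \<epsilon>"
      proof (rule cube_modulusD[OF mod uv])
        show "\<bar>u $ i - v $ i\<bar> \<le> \<delta>" for i using d'(1)[of i] pos by linarith
      qed
      moreover have "lin_process C a u - lin_process C a v = (a u - a v) - (\<Sum>i\<in>UNIV. ?t u i - ?t v i)"
        unfolding lin_process_def by (simp add: sum_subtractf)
      ultimately show "\<bar>lin_process C a u - lin_process C a v\<bar> \<le> (1 + 2 * real CARD('d)) * \<epsilon>"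
        by (simp add: algebra_simps)
    qed
  qed
qed

text \<open>With \<open>v\<close> from \<open>emp_copula_threshold\<close>, the scaled error is the
  empirical process at \<open>v\<close> plus \<open>sqrt n * (C v - C u)\<close>. The first part is
  within \<open>\<epsilon>\<close> of its value at \<open>u\<close>. The second is telescoped one
  coordinate at a time, using that \<open>sqrt n * (v $ i - u $ i)\<close> is minus the margin
  process up to \<open>1 / sqrt n\<close>; this costs \<open>4 * \<epsilon>\<close> per coordinate.
  The threshold \<open>n0\<close> is the same for all samples.\<close>

lemma emp_copula_linearization:
  fixes C :: "real ^ 'd \<Rightarrow> real"
  assumes C: "copula C" and cp: "\<And>i. continuous_partial C i" and pos: "0 < \<delta>" "0 < \<epsilon>"
  obtains n0 where
    "\<And>n x u. n0 \<le> n \<Longrightarrow> generic_sample n x \<Longrightarrow> cube_modulus (emp_process C n x) \<delta> \<epsilon> \<Longrightarrow> u \<in> {0..1} \<Longrightarrow>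
       \<bar>sqrt (real n) * (emp_copula n x u - C u) - lin_process C (emp_process C n x) u\<bar>
         \<le> (1 + 4 * real CARD('d)) * \<epsilon>"
proof -
  define m where "m = nat \<lceil>1 / \<delta>\<rceil>"
  have m: "1 \<le> real m * \<delta>"
  proof -
    have "1 / \<delta> \<le> real m" unfolding m_def by linarith
    then show ?thesis using pos by (simp add: field_simps)
  qed
  define R where "R = real m * \<epsilon>"
  have R0: "0 \<le> R" using pos by (simp add: R_def)
  have \<tau>: "0 < \<delta> / 2" and \<rho>: "0 < \<epsilon> / (R + 1)" using pos R0 by auto
  obtain \<eta> where \<eta>: "0 < \<eta>"
    "\<And>i u v. u \<in> {0..1} \<Longrightarrow> v \<in> {0..1} \<Longrightarrow> \<delta> / 2 \<le> u $ i \<Longrightarrow> u $ i \<le> 1 - \<delta> / 2 \<Longrightarrow> \<delta> / 2 \<le> v $ i \<Longrightarrow> v $ i \<le> 1 - \<delta> / 2 \<Longrightarrow>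
       (\<And>j. \<bar>u $ j - v $ j\<bar> \<le> \<eta>) \<Longrightarrow> \<bar>partial_deriv C i u - partial_deriv C i v\<bar> \<le> \<epsilon> / (R + 1)"
    using partial_deriv_uniformly_continuous[OF cp \<tau> \<rho>] by blast
  define r where "r = min (\<delta> / 2) \<eta>"
  have r: "0 < r" "r \<le> \<delta> / 2" "r \<le> \<eta>" using pos \<eta> by (auto simp: r_def)
  have "(\<lambda>n. (R + 1) / sqrt (real n)) \<longlonglongrightarrow> 0" "(\<lambda>n. 1 / sqrt (real n)) \<longlonglongrightarrow> 0"
    by (auto intro!: tendsto_divide_0[OF tendsto_const] filterlim_compose[OF filterlim_at_top_imp_at_infinity]
       filterlim_compose[OF sqrt_at_top] filterlim_real_sequentially
       filterlim_at_top_imp_at_infinity)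
  \<comment> \<open>The first condition brings \<open>v\<close> within \<open>r\<close> of
    \<open>u\<close>, since the scaled shift is at most \<open>R + 1\<close>; the second makes the
    rounding error of the ranks negligible.\<close>
  then have "\<forall>\<^sub>F n in sequentially. (R + 1) / sqrt (real n) < r \<and> 1 / sqrt (real n) < \<epsilon> \<and> 0 < n"
    using r(1) pos(2) by (intro eventually_conj order_tendstoD(2)[where y=0] eventually_gt_at_top) auto
  then obtain n0 where n0: "\<And>n. n0 \<le> n \<Longrightarrow> (R + 1) / sqrt (real n) < r \<and> 1 / sqrt (real n) < \<epsilon> \<and> 0 < n"
    unfolding eventually_sequentially by blast
  show thesis
  proof (rule that[of n0])
    fix n :: nat and x :: "nat \<Rightarrow> real^'d" and u :: "real^'d"
    assume n: "n0 \<le> n" and gs: "generic_sample n x" and mod: "cube_modulus (emp_process C n x) \<delta> \<epsilon>"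
      and u: "u \<in> {0..1}"
    define a where "a = emp_process C n x"
    have mod: "cube_modulus a \<delta> \<epsilon>" using mod by (simp add: a_def)
    have bdry: "a (vec_upd 1 i 0) = 0" "a 1 = 0" "a 0 = 0" for i
      unfolding a_def using emp_process_boundary(2)[OF C gs]
        emp_process_boundary(1)[OF C gs, of "vec_upd 1 i 0" i] emp_process_boundary(1)[OF C gs, of 0 i]
      by (auto simp del: atLeastAtMost_iff simp: mem_cube_iff)
    have aR: "\<bar>a w\<bar> \<le> R" if "w \<in> {0..1}" for w
      unfolding R_def by (rule cube_modulus_bound[OF mod bdry(3) m that])
    define q where "q = sqrt (real n)"
    have n': "0 < n" "(R + 1) / q < r" "1 / q < \<epsilon>" using n0[OF n] by (auto simp: q_def)
    have q: "0 < q" "q * q = real n" using n' by (auto simp: q_def)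
    obtain v where v: "v \<in> {0..1}" "emp_copula n x u = real (card {k. k < n \<and> x k \<le> v}) / real n"
      "\<And>i. \<bar>real (card {k. k < n \<and> x k $ i \<le> v $ i}) - real n * u $ i\<bar> \<le> 1"
      using emp_copula_threshold[OF n'(1) gs u] by blast
    have u01: "0 \<le> u $ i" "u $ i \<le> 1" "0 \<le> v $ i" "v $ i \<le> 1" for i
      using u v(1) unfolding mem_cube_iff by auto
    define D where "D i = q * (v $ i - u $ i)" for i
    let ?a = "\<lambda>i t. a (vec_upd 1 i t)"
    \<comment> \<open>For a generic sample the empirical distribution function at
      \<open>vec_upd 1 i (v $ i)\<close> is the \<open>i\<close>-th marginal count at
      \<open>v $ i\<close>, which differs from \<open>n * u $ i\<close> by at most one.\<close>
    have Dav: "\<bar>D i + ?a i (v $ i)\<bar> \<le> 1 / q" for i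
    proof -
      have "{k. k < n \<and> x k \<le> vec_upd 1 i (v $ i)} = {k. k < n \<and> x k $ i \<le> v $ i}"
        using gs unfolding generic_sample_def less_eq_vec_def by (auto split: if_splits)
      then have "?a i (v $ i) = q * (real (card {k. k < n \<and> x k $ i \<le> v $ i}) / real n - v $ i)"
        using copula_margin[OF C, of "v $ i" i] u01 by (simp add: a_def emp_process_def q_def)
      then have "D i + ?a i (v $ i) = q * (real (card {k. k < n \<and> x k $ i \<le> v $ i}) / real n - u $ i)"
        by (simp add: D_def algebra_simps)
      also have "\<dots> = (real (card {k. k < n \<and> x k $ i \<le> v $ i}) - real n * u $ i) / q"
        using q by (simp add: q(2)[symmetric] field_simps)
      finally show ?thesis using v(3)[of i] q by (simp add: divide_right_mono)
    qed
    have a01: "\<bar>?a i (v $ i)\<bar> \<le> R" "\<bar>?a i (u $ i)\<bar> \<le> R" for i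
      using u01 by (auto intro!: aR simp del: atLeastAtMost_iff)
    have q1: "1 / q \<le> 1"
    proof -
      have "real n \<ge> 1" using n' by simp
      then have "q \<ge> 1" unfolding q_def by simp
      then show ?thesis by simp
    qed
    have DR: "\<bar>D i\<bar> \<le> R + 1" for i using Dav[of i] a01(1)[of i] q1 by linarith
    have vu: "\<bar>u $ i - v $ i\<bar> \<le> r" for i
    proof -
      have "\<bar>u $ i - v $ i\<bar> = \<bar>D i\<bar> / q" using q by (simp add: D_def abs_mult abs_minus_commute)
      also have "\<dots> \<le> (R + 1) / q" using DR[of i] q by (simp add: divide_right_mono)
      finally show ?thesis using n' by linarith
    qed
    have avu: "\<bar>?a i (v $ i) - ?a i (u $ i)\<bar> \<le> \<epsilon>" for i
      using u01 vu[of i] r pos by (intro cube_modulusD[OF mod]) (auto simp del: atLeastAtMost_iff simp: abs_minus_commute)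
    have Dau: "\<bar>D i + ?a i (u $ i)\<bar> \<le> 2 * \<epsilon>" for i
      using Dav[of i] avu[of i] n'(3) by linarith
    let ?t = "\<lambda>i. if 0 < u $ i \<and> u $ i < 1 then partial_deriv C i u * ?a i (u $ i) else 0"
    \<comment> \<open>The points \<open>w\<close> mix coordinates of \<open>u\<close> and
      \<open>v\<close>, as the intermediate points of the telescoping sum do; hence they are close
      to \<open>u\<close>. Away from the faces the mean value theorem gives
      \<open>3 * \<epsilon>\<close>. Near a face the Lipschitz bound gives
      \<open>3 * \<epsilon>\<close> for the shift, and the margin term adds
      \<open>\<epsilon>\<close>.\<close>
    have step: "\<bar>q * (C (vec_upd w i (v $ i)) - C (vec_upd w i (u $ i))) + ?t i\<bar> \<le> 4 * \<epsilon>"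
      if w: "w \<in> {0..1}" "\<And>j. w $ j \<in> {u $ j, v $ j}" for w i
    proof (cases "\<delta> / 2 \<le> u $ i \<and> u $ i \<le> 1 - \<delta> / 2 \<and> \<delta> / 2 \<le> v $ i \<and> v $ i \<le> 1 - \<delta> / 2")
      case True
      have der: "(partial_slice C i w has_field_derivative partial_deriv C i (vec_upd w i t)) (at t)"
        if "\<delta> / 2 \<le> t" "t \<le> 1 - \<delta> / 2" for t
      proof -
        have "vec_upd w i t \<in> open_slab i"
          using that pos vec_upd_mem_cube[OF w(1), of t i] by (simp add: open_slab_def del: atLeastAtMost_iff) simp
        from partial_deriv_bounds(3)[OF C cp this]
        show ?thesis by (simp add: partial_slice_def[abs_def] vec_upd_def cong: if_cong)
      qed
      have "\<exists>\<xi>. \<delta> / 2 \<le> \<xi> \<and> \<xi> \<le> 1 - \<delta> / 2 \<and> \<bar>u $ i - \<xi>\<bar> \<le> r \<and>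
        partial_slice C i w (v $ i) - partial_slice C i w (u $ i) = (v $ i - u $ i) * partial_deriv C i (vec_upd w i \<xi>)"
      proof (cases "u $ i" "v $ i" rule: linorder_cases)
        case less
        obtain \<xi> where "u $ i < \<xi>" "\<xi> < v $ i"
          "partial_slice C i w (v $ i) - partial_slice C i w (u $ i) = (v $ i - u $ i) * partial_deriv C i (vec_upd w i \<xi>)"
          using MVT2[OF less, of "partial_slice C i w" "\<lambda>\<xi>. partial_deriv C i (vec_upd w i \<xi>)"] der True by force
        then show ?thesis using True vu[of i] by (intro exI[of _ \<xi>]) auto
      next
        case equal
        then show ?thesis using True r by (intro exI[of _ "u $ i"]) auto
      next
        case greater
        obtain \<xi> where "v $ i < \<xi>" "\<xi> < u $ i"
          "partial_slice C i w (u $ i) - partial_slice C i w (v $ i) = (u $ i - v $ i) * partial_deriv C i (vec_upd w i \<xi>)"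
          using MVT2[OF greater, of "partial_slice C i w" "\<lambda>\<xi>. partial_deriv C i (vec_upd w i \<xi>)"] der True by force
        then show ?thesis using True vu[of i] by (intro exI[of _ \<xi>]) (auto simp: algebra_simps)
      qed
      then obtain \<xi> where \<xi>: "\<delta> / 2 \<le> \<xi>" "\<xi> \<le> 1 - \<delta> / 2" "\<bar>u $ i - \<xi>\<bar> \<le> r"
        "partial_slice C i w (v $ i) - partial_slice C i w (u $ i) = (v $ i - u $ i) * partial_deriv C i (vec_upd w i \<xi>)"
        by blast
      let ?p = "partial_deriv C i (vec_upd w i \<xi>)" and ?pu = "partial_deriv C i u"
      have eq: "q * (C (vec_upd w i (v $ i)) - C (vec_upd w i (u $ i))) = ?p * D i"
        using \<xi>(4) by (simp add: partial_slice_def D_def)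
      have int: "0 < u $ i" "u $ i < 1" using True pos by auto
      have pu: "\<bar>?pu\<bar> \<le> 1" using partial_deriv_bounds[OF C cp, of u i] u int by (simp add: open_slab_def)
      have "\<bar>?p - ?pu\<bar> \<le> \<epsilon> / (R + 1)"
      proof (rule \<eta>(2))
        show "vec_upd w i \<xi> \<in> {0..1}" using \<xi> pos by (intro vec_upd_mem_cube w) auto
        show "\<bar>vec_upd w i \<xi> $ j - u $ j\<bar> \<le> \<eta>" for j
          using \<xi>(3) r vu[of j] w(2)[of j] by (auto simp: abs_minus_commute)
      qed (use True \<xi> u in auto)
      then have "\<bar>?p - ?pu\<bar> * \<bar>D i\<bar> \<le> \<epsilon> / (R + 1) * (R + 1)" using DR[of i] pos R0 by (intro mult_mono) auto
      then have 1: "\<bar>(?p - ?pu) * D i\<bar> \<le> \<epsilon>" using R0 by (simp add: abs_mult)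
      have "\<bar>?pu\<bar> * \<bar>D i + ?a i (u $ i)\<bar> \<le> 1 * (2 * \<epsilon>)" using pu Dau[of i] by (intro mult_mono) auto
      then have 2: "\<bar>?pu * (D i + ?a i (u $ i))\<bar> \<le> 2 * \<epsilon>" by (simp add: abs_mult)
      have "?p * D i + ?pu * ?a i (u $ i) = (?p - ?pu) * D i + ?pu * (D i + ?a i (u $ i))"
        by (simp add: algebra_simps)
      with 1 2 have "\<bar>?p * D i + ?pu * ?a i (u $ i)\<bar> \<le> 4 * \<epsilon>" using pos by linarith
      then show ?thesis using int eq by simp
    next
      case False
      then have "u $ i \<le> \<delta> \<or> 1 - \<delta> \<le> u $ i" using vu[of i] r by (auto simp: abs_le_iff)
      then have au: "\<bar>?a i (u $ i)\<bar> \<le> \<epsilon>"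
        using u01 pos by (intro margin_process_small[OF mod bdry(1,2)]) auto
      then have D3: "\<bar>D i\<bar> \<le> 3 * \<epsilon>" using Dau[of i] by linarith
      have "\<bar>C (vec_upd w i (v $ i)) - C (vec_upd w i (u $ i))\<bar> \<le> \<bar>v $ i - u $ i\<bar>"
        using partial_slice_lipschitz[OF C w(1), of "u $ i" "v $ i" i]
          partial_slice_lipschitz[OF C w(1), of "v $ i" "u $ i" i] u01
        unfolding partial_slice_def by (cases "u $ i \<le> v $ i") (auto simp: abs_le_iff)
      then have "\<bar>q * (C (vec_upd w i (v $ i)) - C (vec_upd w i (u $ i)))\<bar> \<le> \<bar>D i\<bar>"
        using q by (simp add: D_def abs_mult)
      moreover have "\<bar>?t i\<bar> \<le> \<bar>?a i (u $ i)\<bar>"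
        using partial_deriv_bounds[OF C cp, of u i] u
        by (auto simp: open_slab_def abs_mult intro!: mult_left_le_one_le)
      ultimately show ?thesis using D3 au by linarith
    qed
    \<comment> \<open>The coordinates in \<open>S\<close> have already been moved from
      \<open>u\<close> to \<open>v\<close>.\<close>
    define w where "w S = (\<chi> j. if j \<in> S then v $ j else u $ j)" for S
    have wc: "w S \<in> {0..1}" for S
      using u01 unfolding mem_cube_iff w_def by auto
    have tele: "\<bar>q * (C (w S) - C u) + (\<Sum>i\<in>S. ?t i)\<bar> \<le> real (card S) * (4 * \<epsilon>)" if "finite S" for S
      using that
    proof induction
      case empty
      have "w {} = u" by (simp add: w_def vec_eq_iff)
      then show ?case by simp
    next
      case (insert i S)
      have "w (insert i S) = vec_upd (w S) i (v $ i)" "w S = vec_upd (w S) i (u $ i)"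
        using insert.hyps by (auto simp: w_def vec_eq_iff)
      then have "\<bar>q * (C (w (insert i S)) - C (w S)) + ?t i\<bar> \<le> 4 * \<epsilon>"
        using step[OF wc, of S i] by (simp add: w_def)
      moreover have "q * (C (w (insert i S)) - C u) = q * (C (w (insert i S)) - C (w S)) + q * (C (w S) - C u)"
        by (simp add: algebra_simps)
      moreover have "real (card (insert i S)) * (4 * \<epsilon>) = real (card S) * (4 * \<epsilon>) + 4 * \<epsilon>"
        using insert.hyps by (simp add: algebra_simps)
      ultimately show ?case using insert by simp
    qed
    have "w UNIV = v" by (simp add: w_def vec_eq_iff)
    then have "\<bar>q * (C v - C u) + (\<Sum>i\<in>UNIV. ?t i)\<bar> \<le> real CARD('d) * (4 * \<epsilon>)"
      using tele[of UNIV] by simp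
    moreover have "\<bar>a u - a v\<bar> \<le> \<epsilon>"
    proof (rule cube_modulusD[OF mod u v(1)])
      show "\<bar>u $ i - v $ i\<bar> \<le> \<delta>" for i using vu[of i] r(2) pos by linarith
    qed
    moreover have "q * (emp_copula n x u - C u) = a v + q * (C v - C u)"
      unfolding v(2) by (simp add: a_def emp_process_def q_def algebra_simps)
    ultimately show "\<bar>sqrt (real n) * (emp_copula n x u - C u) - lin_process C (emp_process C n x) u\<bar>
         \<le> (1 + 4 * real CARD('d)) * \<epsilon>"
      unfolding q_def[symmetric] a_def[symmetric] lin_process_def by (simp add: algebra_simps)
  qed
qed

section \<open>Uniform margins and measurability\<close>

lemma copula_of_cdf:
  fixes Q :: "(real ^ 'd) measure"
  assumes "prob_space Q" "sets Q = sets borel" "\<And>i t. t \<in> {0..1} \<Longrightarrow> measure Q {x. x $ i \<le> t} = t"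
  shows "copula (\<lambda>u. measure Q {..u})"
proof -
  have meas: "(\<lambda>x. x $ i) \<in> borel_measurable Q" for i
    using measurable_vec_nth_borel measurable_cong_sets[OF assms(2) refl] by blast
  have "marginal_cdf Q i t = measure Q {x. x $ i \<le> t}" for i t
    unfolding marginal_cdf_def cdf_def using sets_eq_imp_space_eq[OF assms(2)]
    by (subst measure_distr[OF meas]) (auto simp: vimage_def)
  then show ?thesis
    unfolding copula_def joint_cdf_def using assms by (intro exI[of _ Q]) simp
qed

text \<open>Here \<open>s\<close> is the right end point of the level set, so the equivalence also
  holds where \<open>F\<close> is flat.\<close>

lemma continuous_cdf_quantile:
  fixes F :: "real \<Rightarrow> real"
  assumes F: "mono F" "continuous_on UNIV F" "(F \<longlongrightarrow> 0) at_bot" "(F \<longlongrightarrow> 1) at_top" and p: "0 < p" "p < 1"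
  obtains s where "F s = p" "\<And>y. F y \<le> p \<longleftrightarrow> y \<le> s"
proof -
  obtain l where l: "F l < p"
    using order_tendstoD(2)[OF F(3) p(1)] by (auto simp: eventually_at_bot_linorder)
  obtain h where h: "p < F h"
    using order_tendstoD(1)[OF F(4) p(2)] by (auto simp: eventually_at_top_linorder)
  have lh: "l < h" using monoD[OF F(1), of h l] l h by (metis less_le_trans not_le order.asym)
  define A where "A = {y. F y \<le> p}"
  have cl: "closed A" unfolding A_def by (intro closed_Collect_le F(2) continuous_intros)
  have ub: "y \<le> h" if "y \<in> A" for y
    using monoD[OF F(1), of h y] that h unfolding A_def by force
  have ne: "l \<in> A" using l by (simp add: A_def)
  define s where "s = Sup A"
  have bdd: "bdd_above A" using ub by (auto simp: bdd_above_def)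
  have sA: "s \<in> A" unfolding s_def using closed_contains_Sup[OF _ bdd cl] ne by auto
  have iff: "F y \<le> p \<longleftrightarrow> y \<le> s" for y
  proof
    assume "F y \<le> p" then show "y \<le> s" unfolding s_def by (intro cSup_upper bdd) (simp add: A_def)
  next
    assume "y \<le> s" then show "F y \<le> p" using monoD[OF F(1), of y s] sA by (simp add: A_def)
  qed
  obtain z where z: "l \<le> z" "z \<le> h" "F z = p"
    using IVT'[of F l p h] l h lh continuous_on_subset[OF F(2)] by auto
  have "F s = p" using iff[of z] z(3) monoD[OF F(1), of z s] sA by (simp add: A_def)
  then show thesis using that iff by blast
qed

lemma marginal_cdf_props:
  fixes P :: "(real ^ 'd) measure"
  assumes "prob_space P" "sets P = sets borel"
  shows "mono (marginal_cdf P i)" "(marginal_cdf P i \<longlongrightarrow> 0) at_bot" "(marginal_cdf P i \<longlongrightarrow> 1) at_top"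
    "0 \<le> marginal_cdf P i t" "marginal_cdf P i t \<le> 1"
    "marginal_cdf P i t = measure P {x. x $ i \<le> t}"
proof -
  interpret P: prob_space P by fact
  have meas: "(\<lambda>x. x $ i) \<in> borel_measurable P" for i
    using measurable_vec_nth_borel measurable_cong_sets[OF assms(2) refl] by blast
  interpret D: real_distribution "distr P borel (\<lambda>x. x $ i)"
    by (rule P.real_distribution_distr[OF meas])
  show "mono (marginal_cdf P i)" unfolding marginal_cdf_def by (simp add: mono_def D.cdf_nondecreasing)
  show "(marginal_cdf P i \<longlongrightarrow> 0) at_bot" unfolding marginal_cdf_def by (rule D.cdf_lim_at_bot)
  show "(marginal_cdf P i \<longlongrightarrow> 1) at_top" unfolding marginal_cdf_def by (rule D.cdf_lim_at_top_prob)
  show "0 \<le> marginal_cdf P i t" unfolding marginal_cdf_def by (rule D.cdf_nonneg)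
  show "marginal_cdf P i t \<le> 1" unfolding marginal_cdf_def by (rule D.cdf_bounded_prob)
  show "marginal_cdf P i t = measure P {x. x $ i \<le> t}"
    unfolding marginal_cdf_def cdf_def using sets_eq_imp_space_eq[OF assms(2)]
    by (subst measure_distr[OF meas]) (auto simp: vimage_def)
qed

text \<open>For \<open>u\<close> in the open cube, \<open>G x <= u\<close> means
  \<open>x <= s\<close> for a vector \<open>s\<close> of quantiles, and \<open>copula_of\<close>
  evaluates the probability. On the boundary finite quantiles may not exist. There the distribution
  function of \<open>G\<close> is first seen to be a copula itself, and two Lipschitz functions that
  agree in the interior agree on the cube.\<close>

lemma probability_integral_transform:
  fixes P :: "(real ^ 'd) measure" and C :: "real ^ 'd \<Rightarrow> real"
  defines "G \<equiv> \<lambda>x. \<chi> i. marginal_cdf P i (x $ i)"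
  assumes P: "prob_space P" "sets P = sets borel" and C: "copula C" "copula_of C P"
    and cont: "\<And>i. continuous_on UNIV (marginal_cdf P i)"
  shows "G \<in> borel_measurable borel" and "u \<in> {0..1} \<Longrightarrow> measure (distr P borel G) {..u} = C u"
proof -
  interpret P: prob_space P by fact
  note F = marginal_cdf_props[OF P]
  have "continuous_on UNIV G"
    unfolding G_def
    by (intro continuous_on_vec_lambda continuous_on_compose2[OF cont]) (auto intro: continuous_intros)
  then show G[measurable]: "G \<in> borel_measurable borel" by (rule borel_measurable_continuous_onI)
  have GP[measurable]: "G \<in> borel_measurable P" using G measurable_cong_sets[OF P(2) refl] by blast
  have sp: "space P = UNIV" using sets_eq_imp_space_eq[OF P(2)] by simp
  let ?Q = "distr P borel G"
  have Q: "prob_space ?Q" by (rule P.prob_space_distr[OF GP])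
  have mQ: "measure ?Q A = measure P {x. G x \<in> A}" if "A \<in> sets borel" for A
    using that by (subst measure_distr[OF GP]) (auto simp: vimage_def sp)
  have iset: "{x::real^'d. x $ i \<le> t} \<in> sets borel" for i t
    using measurable_sets[OF measurable_vec_nth_borel, of "{..t}" i] by (simp add: vimage_def)
  have m_int: "measure ?Q {x. x $ i \<le> t} = t" if t: "0 < t" "t < 1" for i t
  proof -
    obtain s where s: "marginal_cdf P i s = t" "\<And>y. marginal_cdf P i y \<le> t \<longleftrightarrow> y \<le> s"
      using continuous_cdf_quantile[OF F(1) cont F(2,3) t] by blast
    have "measure ?Q {x. x $ i \<le> t} = measure P {x. x $ i \<le> s}"
      by (subst mQ[OF iset]) (simp add: G_def s(2))
    then show ?thesis using F(6)[of i s] s(1) by simp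
  qed
  have marg: "measure ?Q {x. x $ i \<le> t} = t" if t: "t \<in> {0..1}" for i t
  proof -
    consider "t = 0" | "t = 1" | "0 < t" "t < 1" using t by force
    then show ?thesis
    proof cases
      case 1
      interpret Q: prob_space ?Q by fact
      have "measure ?Q {x. x $ i \<le> 0} \<le> 0"
      proof (rule field_le_epsilon)
        fix e :: real assume e: "0 < e"
        define e' where "e' = min e (1/2)"
        have e': "0 < e'" "e' < 1" "e' \<le> e" using e by (auto simp: e'_def)
        have "measure ?Q {x. x $ i \<le> 0} \<le> measure ?Q {x. x $ i \<le> e'}"
          using e' by (intro Q.finite_measure_mono) (auto simp: iset)
        then show "measure ?Q {x. x $ i \<le> 0} \<le> 0 + e" using m_int[OF e'(1,2), of i] e'(3) by simp
      qed
      then show ?thesis using 1 measure_nonneg[of ?Q "{x. x $ i \<le> 0}"] by simp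
    next
      case 2
      have "{x. G x \<in> {x. x $ i \<le> 1}} = space P" using F(5) by (auto simp: G_def sp)
      then show ?thesis using 2 by (subst mQ[OF iset]) (simp add: P.prob_space)
    qed (rule m_int)
  qed
  define H where "H = (\<lambda>u. measure ?Q {..u})"
  have H: "copula H" unfolding H_def by (rule copula_of_cdf[OF Q _ marg]) simp
  have inner: "H u = C u" if u: "\<And>i. 0 < u $ i" "\<And>i. u $ i < 1" for u
  proof -
    have "\<exists>s. marginal_cdf P i s = u $ i \<and> (\<forall>y. marginal_cdf P i y \<le> u $ i \<longleftrightarrow> y \<le> s)" for i
      using continuous_cdf_quantile[OF F(1) cont F(2,3) u(1)[of i] u(2)[of i]] by metis
    then obtain s where s: "\<And>i. marginal_cdf P i (s i) = u $ i" "\<And>i y. marginal_cdf P i y \<le> u $ i \<longleftrightarrow> y \<le> s i"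
      by metis
    have "H u = measure P {..\<chi> i. s i}"
      unfolding H_def by (subst mQ) (auto simp: G_def less_eq_vec_def s(2) intro!: arg_cong[where f="measure P"])
    also have "\<dots> = C (\<chi> i. marginal_cdf P i (s i))"
      using C(2)[unfolded copula_of_def, rule_format, of "\<chi> i. s i"] by (simp add: joint_cdf_def)
    also have "(\<chi> i. marginal_cdf P i (s i)) = u" by (simp add: s(1) vec_eq_iff)
    finally show ?thesis .
  qed
  show "measure ?Q {..u} = C u" if u: "u \<in> {0..1}"
  proof -
    have "\<bar>H u - C u\<bar> \<le> 0"
    proof (rule field_le_epsilon)
      fix e :: real assume e: "0 < e"
      \<comment> \<open>Clipping \<open>u\<close> to \<open>[e', 1 - e']\<close> moves each
        coordinate by at most \<open>e'\<close>, so it costs \<open>CARD('d) * e'\<close> for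
        \<open>H\<close> and as much for \<open>C\<close>.\<close>
      define e' where "e' = min (1/4) (e / (2 * real CARD('d)))"
      have e': "0 < e'" "e' < 1/2" "2 * real CARD('d) * e' \<le> e"
      proof -
        show "0 < e'" "e' < 1/2" using e by (auto simp: e'_def)
        have "e' \<le> e / (2 * real CARD('d))" by (simp add: e'_def)
        then show "2 * real CARD('d) * e' \<le> e" by (simp add: field_simps)
      qed
      define v where "v = (\<chi> i. max e' (min (1 - e') (u $ i)))"
      have u01: "0 \<le> u $ i" "u $ i \<le> 1" for i using u unfolding mem_cube_iff by auto
      have v01: "0 < v $ i" "v $ i < 1" for i using e' by (auto simp: v_def)
      have vc: "v \<in> {0..1}" unfolding mem_cube_iff using v01 less_imp_le by blast
      have "\<bar>u $ i - v $ i\<bar> \<le> e'" for i using u01[of i] e' by (auto simp: v_def)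
      then have "(\<Sum>i\<in>UNIV. \<bar>u $ i - v $ i\<bar>) \<le> (\<Sum>i\<in>(UNIV::'d set). e')" by (intro sum_mono)
      then have D: "(\<Sum>i\<in>UNIV. \<bar>u $ i - v $ i\<bar>) \<le> real CARD('d) * e'" by simp
      have "\<bar>H u - C u\<bar> \<le> 2 * real CARD('d) * e'"
        using copula_lipschitz[OF H u vc] copula_lipschitz[OF C(1) u vc] D inner[OF v01] by linarith
      then show "\<bar>H u - C u\<bar> \<le> 0 + e" using e' by simp
    qed
    then show ?thesis by (simp add: H_def)
  qed
qed

section \<open>The empirical copula as a function of the sample: measurability and
  invariance\<close>

lemma emp_copula_range: "0 \<le> emp_copula n x u" "emp_copula n x u \<le> 1"
proof -
  have "card {k. k < n \<and> Q k} \<le> n" for Q using card_mono[of "{..<n}" "{k. k < n \<and> Q k}"] by auto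
  then show "0 \<le> emp_copula n x u" "emp_copula n x u \<le> 1"
    by (auto simp: emp_copula_def emp_cdf_def divide_le_eq_1)
qed

lemma real_card_lessThan: "real (card {k. k < (n::nat) \<and> Q k}) = (\<Sum>k<n. if Q k then 1 else 0)"
  using sum.inter_filter[of "{..<n}" "\<lambda>_. 1 :: real" Q] by simp

lemma emp_copula_measurable:
  fixes X :: "nat \<Rightarrow> 'a \<Rightarrow> real ^ 'd"
  assumes n: "0 < n" and [measurable]: "\<And>k. X k \<in> borel_measurable M"
  shows "(\<lambda>\<omega>. emp_copula n (\<lambda>k. X k \<omega>) u) \<in> borel_measurable M"
  unfolding emp_copula_rank[OF n] real_card_lessThan by measurable

text \<open>The empirical copula is constant on half-open cells \<open>(a, b]\<close>, so points with rational
  coordinates approximate it exactly from below.\<close>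

definition rational_cube :: "(real ^ 'd) set" where
  "rational_cube = {0..1} \<inter> {u. \<forall>i. u $ i \<in> \<rat>}"

lemma countable_rational_cube: "countable (rational_cube :: (real ^ 'd) set)"
proof -
  have "countable ((\<lambda>f. \<chi> i. f i) ` (UNIV \<rightarrow>\<^sub>E \<rat>) :: (real ^ 'd) set)"
    by (intro countable_image countable_PiE) (auto simp: countable_rat)
  moreover have "rational_cube \<subseteq> ((\<lambda>f. \<chi> i. f i) ` (UNIV \<rightarrow>\<^sub>E \<rat>) :: (real ^ 'd) set)"
  proof
    fix u :: "real^'d" assume "u \<in> rational_cube"
    then show "u \<in> (\<lambda>f. \<chi> i. f i) ` (UNIV \<rightarrow>\<^sub>E \<rat>)"
      by (intro image_eqI[of _ _ "\<lambda>i. u $ i"]) (auto simp: rational_cube_def vec_eq_iff)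
  qed
  ultimately show ?thesis by (rule countable_subset[rotated])
qed

lemma emp_copula_rational_approx:
  fixes D :: "real ^ 'd \<Rightarrow> real"
  assumes n: "0 < n" and D: "copula D" and u: "u \<in> {0..1}" and e: "0 < e"
  obtains v where "v \<in> rational_cube" "emp_copula n x v = emp_copula n x u" "\<bar>D u - D v\<bar> \<le> e"
proof -
  define e' where "e' = e / real CARD('d)"
  have e': "0 < e'" "real CARD('d) * e' = e" using e by (auto simp: e'_def)
  have u01: "0 \<le> u $ i" "u $ i \<le> 1" for i using u unfolding mem_cube_iff by auto
  have "\<exists>q\<in>\<rat>. 0 \<le> q \<and> q \<le> u $ i \<and> u $ i - e' \<le> q \<and> (\<forall>r::nat. real r < real n * q \<longleftrightarrow> real r < real n * u $ i)" for i
  proof (cases "u $ i = 0")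
    case True
    \<comment> \<open>Here the rational point cannot lie strictly below \<open>u $ i\<close>; it is
      0 itself.\<close>
    then show ?thesis using e' by (intro bexI[of _ 0]) auto
  next
    case False
    then have pos: "0 < u $ i" using u01[of i] by simp
    \<comment> \<open>The largest multiple of \<open>1 / n\<close> strictly below
      \<open>u $ i\<close>. On \<open>(c, u $ i]\<close> the same ranks are below \<open>n\<close>
      times the argument.\<close>
    define c where "c = (of_int \<lceil>real n * u $ i\<rceil> - 1) / real n"
    have c: "c < u $ i"
    proof -
      have "of_int \<lceil>real n * u $ i\<rceil> - 1 < real n * u $ i" by linarith
      then show ?thesis using n by (simp add: c_def field_simps)
    qed
    obtain q where q: "q \<in> \<rat>" "max (max 0 c) (u $ i - e') < q" "q < u $ i"
      using Rats_dense_in_real[of "max (max 0 c) (u $ i - e')" "u $ i"] pos c e' by auto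
    have "real r < real n * q" if r: "real r < real n * u $ i" for r :: nat
    proof -
      have "of_int (int r) < real n * u $ i" using r by simp
      then have "int r < \<lceil>real n * u $ i\<rceil>" by (simp only: less_ceiling_iff)
      then have "real r \<le> of_int \<lceil>real n * u $ i\<rceil> - 1" by linarith
      also have "\<dots> = real n * c" using n by (simp add: c_def)
      also have "\<dots> < real n * q" using q n by simp
      finally show ?thesis .
    qed
    moreover have "real n * q \<le> real n * u $ i" using q n by simp
    ultimately have "\<forall>r::nat. real r < real n * q \<longleftrightarrow> real r < real n * u $ i" by force
    then show ?thesis using q by (intro bexI[of _ q]) auto
  qed
  then obtain q where q: "\<And>i. q i \<in> \<rat> \<and> 0 \<le> q i \<and> q i \<le> u $ i \<and> u $ i - e' \<le> q i \<and>
     (\<forall>r::nat. real r < real n * q i \<longleftrightarrow> real r < real n * u $ i)" by metis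
  define v where "v = (\<chi> i. q i)"
  have vc: "v \<in> {0..1}" unfolding mem_cube_iff v_def vec_lambda_beta using q u01(2) by (meson order_trans)
  show thesis
  proof (rule that[of v])
    show "v \<in> rational_cube" using vc q by (simp add: rational_cube_def v_def del: atLeastAtMost_iff)
    show "emp_copula n x v = emp_copula n x u" unfolding emp_copula_rank[OF n] v_def using q by simp
    have "\<bar>D u - D v\<bar> \<le> (\<Sum>i\<in>UNIV. \<bar>u $ i - v $ i\<bar>)" by (rule copula_lipschitz[OF D u vc])
    also have "\<dots> \<le> (\<Sum>i\<in>(UNIV::'d set). e')"
    proof (rule sum_mono)
      fix i
      have "q i \<le> u $ i" "u $ i - e' \<le> q i" using q by blast+
      then show "\<bar>u $ i - v $ i\<bar> \<le> e'" by (simp add: v_def)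
    qed
    finally show "\<bar>D u - D v\<bar> \<le> e" using e' by simp
  qed
qed

lemma sup_norm_emp_copula_measurable:
  fixes X :: "nat \<Rightarrow> 'a \<Rightarrow> real ^ 'd"
  assumes n: "0 < n" and X[measurable]: "\<And>k. X k \<in> borel_measurable M" and D: "copula D"
  shows "(\<lambda>\<omega>. sup_norm (\<lambda>u. emp_copula n (\<lambda>k. X k \<omega>) u - D u)) \<in> borel_measurable M"
proof -
  have h1: "\<bar>emp_copula n x u - D u\<bar> \<le> 1" if "u \<in> {0..1}" for u and x :: "nat \<Rightarrow> real^'d"
    using emp_copula_range[of n x u] copula_range[OF D that] by (auto simp: abs_le_iff)
  have ne: "(0::real^'d) \<in> rational_cube" by (simp add: rational_cube_def)
  have sub: "u \<in> {0..1}" if "u \<in> rational_cube" for u :: "real^'d" using that by (simp add: rational_cube_def)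
  have bdd: "bdd_above ((\<lambda>u. \<bar>emp_copula n x u - D u\<bar>) ` rational_cube)" for x :: "nat \<Rightarrow> real^'d"
    by (rule bdd_aboveI2[of _ _ 1]) (use h1 sub in blast)
  have bddc: "bdd_above ((\<lambda>u. \<bar>emp_copula n x u - D u\<bar>) ` {0..1})" for x :: "nat \<Rightarrow> real^'d"
    by (rule bdd_aboveI2[of _ _ 1]) (use h1 in blast)
  have eq: "sup_norm (\<lambda>u. emp_copula n x u - D u) = (SUP u\<in>rational_cube. \<bar>emp_copula n x u - D u\<bar>)"
    for x :: "nat \<Rightarrow> real^'d"
  proof (rule antisym)
    show "sup_norm (\<lambda>u. emp_copula n x u - D u) \<le> (SUP u\<in>rational_cube. \<bar>emp_copula n x u - D u\<bar>)"
    proof (rule sup_norm_least, rule field_le_epsilon)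
      fix u :: "real^'d" and e :: real assume u: "u \<in> {0..1}" and e: "0 < e"
      obtain v where v: "v \<in> rational_cube" "emp_copula n x v = emp_copula n x u" "\<bar>D u - D v\<bar> \<le> e"
        using emp_copula_rational_approx[OF n D u e] by blast
      have "\<bar>emp_copula n x v - D v\<bar> \<le> (SUP u\<in>rational_cube. \<bar>emp_copula n x u - D u\<bar>)"
        by (rule cSUP_upper[OF v(1) bdd])
      then show "\<bar>emp_copula n x u - D u\<bar> \<le> (SUP u\<in>rational_cube. \<bar>emp_copula n x u - D u\<bar>) + e"
        using v(2,3) by linarith
    qed
    show "(SUP u\<in>rational_cube. \<bar>emp_copula n x u - D u\<bar>) \<le> sup_norm (\<lambda>u. emp_copula n x u - D u)"
      unfolding sup_norm_def using ne sub by (intro cSUP_subset_mono bddc) auto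
  qed
  show ?thesis
    unfolding eq
  proof (rule borel_measurable_cSUP[OF countable_rational_cube _ bdd])
    fix u :: "real^'d"
    have [measurable]: "(\<lambda>\<omega>. emp_copula n (\<lambda>k. X k \<omega>) u) \<in> borel_measurable M"
      by (rule emp_copula_measurable[OF n X])
    show "(\<lambda>\<omega>. \<bar>emp_copula n (\<lambda>k. X k \<omega>) u - D u\<bar>) \<in> borel_measurable M" by measurable
  qed
qed

text \<open>A marginal distribution function may be constant on intervals, so it preserves only the
  weak order in general. Since the transformed sample has no ties, the strict order is preserved as
  well.\<close>

lemma emp_copula_transform:
  assumes n: "0 < n" and F: "\<And>i. mono (F i)" and gs: "generic_sample n (\<lambda>k. \<chi> i. F i (x k $ i))"
  shows "emp_copula n x u = emp_copula n (\<lambda>k. \<chi> i. F i (x k $ i)) u"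
proof (rule emp_copula_order_cong[OF n])
  fix i j k assume jk: "j < n" "k < n"
  show "x j $ i < x k $ i \<longleftrightarrow> (\<chi> i. F i (x j $ i)) $ i < (\<chi> i. F i (x k $ i)) $ i"
  proof
    assume lt: "x j $ i < x k $ i"
    then have "j \<noteq> k" by auto
    have "inj_on (\<lambda>k. F i (x k $ i)) {..<n}" using gs by (simp add: generic_sample_def)
    then have "F i (x j $ i) \<noteq> F i (x k $ i)" using \<open>j \<noteq> k\<close> jk unfolding inj_on_def by auto
    moreover have "F i (x j $ i) \<le> F i (x k $ i)" using monoD[OF F] lt by simp
    ultimately show "(\<chi> i. F i (x j $ i)) $ i < (\<chi> i. F i (x k $ i)) $ i" by simp
  next
    assume "(\<chi> i. F i (x j $ i)) $ i < (\<chi> i. F i (x k $ i)) $ i"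
    then show "x j $ i < x k $ i" using monoD[OF F, of "x k $ i" "x j $ i" i] by (simp add: not_le[symmetric]) auto
  qed
qed

section \<open>The linear map and the limit functional: bounds, continuity, measurability\<close>

lemma lin_process_bound:
  fixes C :: "real ^ 'd \<Rightarrow> real"
  assumes C: "copula C" and cp: "\<And>i. continuous_partial C i"
    and R: "\<And>u. u \<in> {0..1} \<Longrightarrow> \<bar>a u\<bar> \<le> R" and u: "u \<in> {0..1}"
  shows "\<bar>lin_process C a u\<bar> \<le> (1 + real CARD('d)) * R"
proof -
  let ?t = "\<lambda>i. if 0 < u $ i \<and> u $ i < 1 then partial_deriv C i u * a (vec_upd 1 i (u $ i)) else 0"
  have R0: "0 \<le> R" using R[OF u] by linarith
  have "\<bar>?t i\<bar> \<le> R" for i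
  proof (cases "0 < u $ i \<and> u $ i < 1")
    case True
    then have "\<bar>partial_deriv C i u\<bar> * \<bar>a (vec_upd 1 i (u $ i))\<bar> \<le> 1 * R"
      using partial_deriv_bounds[OF C cp, of u i] u
      by (intro mult_mono R) (auto simp: open_slab_def mem_cube_iff simp del: atLeastAtMost_iff)
    then show ?thesis using True by (simp add: abs_mult)
  next
    case False
    then show ?thesis using R0 by (simp only: if_False abs_zero)
  qed
  then have "\<bar>\<Sum>i\<in>UNIV. ?t i\<bar> \<le> (\<Sum>i\<in>(UNIV::'d set). R)"
    by (intro order_trans[OF sum_abs] sum_mono)
  then show ?thesis
    unfolding lin_process_def using R[OF u] by (simp add: algebra_simps)
qed

text \<open>The summand for \<open>i\<close> is set to 0 on the faces \<open>u $ i = 0\<close> and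
  \<open>u $ i = 1\<close>. This makes no jump, because the path vanishes at the corresponding
  points and the derivative is bounded.\<close>

lemma lin_process_continuous:
  fixes C :: "real ^ 'd \<Rightarrow> real"
  assumes C: "copula C" and cp: "\<And>i. continuous_partial C i"
    and a: "continuous_on {0..1} a" "\<And>i. a (vec_upd 1 i 0) = 0" "a 1 = 0"
  shows "continuous_on {0..1} (lin_process C a)"
  unfolding continuous_on_iff
proof (intro ballI allI impI)
  fix u :: "real^'d" and e :: real assume u: "u \<in> {0..1}" and e: "0 < e"
  define R where "R = sup_norm a"
  have R: "\<bar>a u\<bar> \<le> R" if "u \<in> {0..1}" for u
    unfolding R_def by (rule sup_norm_upper[OF continuous_bounded_cube[OF a(1)] that])
  have R0: "0 \<le> R" using R[OF u] by linarith
  define \<epsilon> where "\<epsilon> = e / (2 * (1 + 2 * real CARD('d)))"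
  define c where "c = 1 + 2 * real CARD('d)"
  have c: "0 < c" by (simp add: c_def)
  have \<epsilon>: "0 < \<epsilon>" "(1 + 2 * real CARD('d)) * \<epsilon> < e"
    unfolding \<epsilon>_def c_def[symmetric] using e c by auto
  obtain \<delta> where \<delta>: "0 < \<delta>" "cube_modulus a \<delta> \<epsilon>" using continuous_imp_cube_modulus[OF a(1) \<epsilon>(1)] .
  obtain \<delta>' where \<delta>': "0 < \<delta>'"
    "\<And>a. cube_modulus a \<delta> \<epsilon> \<Longrightarrow> (\<And>u. u \<in> {0..1} \<Longrightarrow> \<bar>a u\<bar> \<le> R) \<Longrightarrow>
       (\<And>i. a (vec_upd 1 i 0) = 0) \<Longrightarrow> a 1 = 0 \<Longrightarrow>
       cube_modulus (lin_process C a) \<delta>' ((1 + 2 * real CARD('d)) * \<epsilon>)"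
    by (rule lin_process_modulus[OF C cp \<delta>(1) \<epsilon>(1) R0]) blast
  note mod = \<delta>'(2)[OF \<delta>(2) R a(2,3)]
  show "\<exists>d>0. \<forall>v\<in>{0..1}. dist v u < d \<longrightarrow> dist (lin_process C a v) (lin_process C a u) < e"
  proof (intro exI[of _ \<delta>'] conjI ballI impI)
    fix v :: "real^'d" assume v: "v \<in> {0..1}" "dist v u < \<delta>'"
    have "\<bar>lin_process C a v - lin_process C a u\<bar> \<le> (1 + 2 * real CARD('d)) * \<epsilon>"
    proof (rule cube_modulusD[OF mod v(1) u])
      show "\<bar>v $ i - u $ i\<bar> \<le> \<delta>'" for i using abs_coordinate_le_dist[of v i u] v(2) by linarith
    qed
    then show "dist (lin_process C a v) (lin_process C a u) < e" using \<epsilon> by (simp add: dist_real_def)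
  qed (rule \<delta>'(1))
qed

text \<open>On a stratum the case distinction always selects the same summands, and each of them is
  continuous.\<close>

lemma continuous_on_stratum_lin_process:
  fixes C :: "real ^ 'd \<Rightarrow> real"
  assumes C: "copula C" and cp: "\<And>i. continuous_partial C i" and a: "continuous_on {0..1} a"
  shows "continuous_on ({0..1} \<inter> {u. {i. 0 < u $ i \<and> u $ i < 1} = J}) (lin_process C a)"
proof -
  let ?S = "{0..1} \<inter> {u::real^'d. {i. 0 < u $ i \<and> u $ i < 1} = J}"
  have "continuous_on ?S (\<lambda>u. a u - (\<Sum>i\<in>J. partial_deriv C i u * a (vec_upd 1 i (u $ i))))"
  proof (intro continuous_intros)
    show "continuous_on ?S a" by (rule continuous_on_subset[OF a]) blast
    fix i assume "i \<in> J"
    then have "?S \<subseteq> open_slab i" by (auto simp: open_slab_def)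
    then show "continuous_on ?S (partial_deriv C i)"
      using cp[of i] unfolding continuous_partial_def by (meson continuous_on_subset)
    show "continuous_on ?S (\<lambda>u. a (vec_upd 1 i (u $ i)))"
    proof (rule continuous_on_compose2[OF a])
      have "continuous_on ?S (\<lambda>u. (\<chi> j. if j = i then u $ i else 1) :: real^'d)"
      proof (rule continuous_on_vec_lambda)
        show "continuous_on ?S (\<lambda>u. if j = i then u $ i else 1)" for j
          by (cases "j = i") (simp_all add: continuous_on_component)
      qed
      then show "continuous_on ?S (\<lambda>u. vec_upd 1 i (u $ i))"
        by (simp add: vec_upd_def cong: if_cong)
      show "(\<lambda>u. vec_upd 1 i (u $ i)) ` ?S \<subseteq> {0..1}"
        unfolding image_subset_iff vec_upd_one_mem by (simp add: mem_cube_iff del: atLeastAtMost_iff)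
    qed
  qed
  then show ?thesis
  proof (rule continuous_on_eq)
    fix u assume "u \<in> ?S"
    then have "J = {i. 0 < u $ i \<and> u $ i < 1}" by auto
    then show "a u - (\<Sum>i\<in>J. partial_deriv C i u * a (vec_upd 1 i (u $ i))) = lin_process C a u"
      unfolding lin_process_def by (simp add: sum.If_cases Int_def)
  qed
qed

lemma lin_process_measurable:
  fixes C :: "real ^ 'd \<Rightarrow> real"
  assumes B: "\<And>u. u \<in> {0..1} \<Longrightarrow> B u \<in> borel_measurable N" and u: "u \<in> {0..1}"
  shows "(\<lambda>\<omega>. lin_process C (\<lambda>u. B u \<omega>) u) \<in> borel_measurable N"
proof -
  have "B (vec_upd 1 i (u $ i)) \<in> borel_measurable N" for i
    using u by (intro B) (simp add: mem_cube_iff del: atLeastAtMost_iff)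
  then have "(\<lambda>\<omega>. if 0 < u $ i \<and> u $ i < 1 then partial_deriv C i u * B (vec_upd 1 i (u $ i)) \<omega> else 0) \<in> borel_measurable N" for i
    by (cases "0 < u $ i \<and> u $ i < 1") auto
  then show ?thesis
    unfolding lin_process_def by (intro borel_measurable_diff borel_measurable_sum B u)
qed

text \<open>Measurability concerns every \<open>\<omega>\<close>, including those where \<open>B\<close> does not vanish on the boundary
  and the limit process jumps there. It is always continuous on each of the finitely many strata on
  which the set of coordinates in \<open>(0, 1)\<close> is fixed.\<close>

lemma limit_functional_measurable:
  fixes C f :: "real ^ 'd \<Rightarrow> real" and B :: "real ^ 'd \<Rightarrow> 'b \<Rightarrow> real"
  assumes C: "copula C" and cp: "\<And>i. continuous_partial C i"
    and f: "continuous_on {0..1} f" and nz: "\<exists>u\<in>{0..1}. f u \<noteq> 0"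
    and Bm: "\<And>u. u \<in> {0..1} \<Longrightarrow> B u \<in> borel_measurable N"
    and Bc: "\<And>\<omega>. \<omega> \<in> space N \<Longrightarrow> continuous_on {0..1} (\<lambda>u. B u \<omega>)"
  shows "(\<lambda>\<omega>. SUP u\<in>argmax_set (\<lambda>u. \<bar>f u\<bar>). lin_process C (\<lambda>u. B u \<omega>) u * sgn (f u)) \<in> borel_measurable N"
proof -
  define K where "K = argmax_set (\<lambda>u. \<bar>f u\<bar>)"
  note K = argmax_set_props[OF f nz, folded K_def]
  define S where "S J = K \<inter> {u. {i. 0 < u $ i \<and> u $ i < 1} = J}" for J
  \<comment> \<open>A countable dense subset of the maximizers is chosen stratum by stratum, so that
    every maximizer is approximated from within its own stratum.\<close>
  have "\<exists>T. countable T \<and> T \<subseteq> S J \<and> S J \<subseteq> closure T" for J using separable[of "S J"] by metis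
  then obtain T where T: "\<And>J. countable (T J)" "\<And>J. T J \<subseteq> S J" "\<And>J. S J \<subseteq> closure (T J)" by metis
  define TT where "TT = (\<Union>J. T J)"
  have ct: "countable TT" unfolding TT_def using T(1) by simp
  have TK: "TT \<subseteq> K" unfolding TT_def using T(2) by (auto simp: S_def)
  let ?g = "\<lambda>\<omega> u. lin_process C (\<lambda>u. B u \<omega>) u * sgn (f u)"
  have bdd: "bdd_above (?g \<omega> ` K)" if "\<omega> \<in> space N" for \<omega>
  proof (rule bdd_aboveI2)
    fix u assume u: "u \<in> K"
    let ?a = "\<lambda>u. B u \<omega>"
    have "\<bar>?a v\<bar> \<le> sup_norm ?a" if "v \<in> {0..1}" for v
      by (rule sup_norm_upper[OF continuous_bounded_cube[OF Bc[OF \<open>\<omega> \<in> space N\<close>]] that])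
    then have "\<bar>lin_process C ?a u\<bar> \<le> (1 + real CARD('d)) * sup_norm ?a"
      using K(4)[OF u] by (intro lin_process_bound[OF C cp]) auto
    then have "\<bar>?g \<omega> u\<bar> \<le> (1 + real CARD('d)) * sup_norm ?a"
      using K(4)[OF u] by (simp add: abs_mult)
    then show "?g \<omega> u \<le> (1 + real CARD('d)) * sup_norm ?a" by (rule abs_le_D1)
  qed
  have dense: "?g \<omega> u \<le> c" if w: "\<omega> \<in> space N" and u: "u \<in> K" and c: "\<And>t. t \<in> TT \<Longrightarrow> ?g \<omega> t \<le> c" for \<omega> u c
  proof -
    define J where "J = {i. 0 < u $ i \<and> u $ i < 1}"
    have uS: "u \<in> S J" using u by (simp add: S_def J_def)
    then obtain t where t: "\<And>n. t n \<in> T J" "t \<longlonglongrightarrow> u" using T(3)[of J] closure_sequential by blast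
    have tS: "t n \<in> S J" for n using t(1) T(2) by blast
    have SK: "S J \<subseteq> {0..1} \<inter> {u. {i. 0 < u $ i \<and> u $ i < 1} = J}" using K(4) by (auto simp: S_def)
    have c1: "continuous_on (S J) (\<lambda>u. lin_process C (\<lambda>u. B u \<omega>) u * (f u / sup_norm f))"
    proof (intro continuous_on_mult continuous_on_divide continuous_on_const)
      show "continuous_on (S J) (lin_process C (\<lambda>u. B u \<omega>))"
        by (rule continuous_on_subset[OF continuous_on_stratum_lin_process[OF C cp Bc[OF w]] SK])
      show "continuous_on (S J) f" by (rule continuous_on_subset[OF f]) (use SK in blast)
    qed (use K(1) in simp)
    \<comment> \<open>On the maximizers the sign is \<open>f\<close> divided by the supremum, hence
      continuous there.\<close>
    have c2: "f v / sup_norm f = sgn (f v)" if "v \<in> S J" for v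
    proof -
      have E: "f v = sgn (f v) * sup_norm f" using K(4)[of v] that by (simp add: S_def)
      show ?thesis by (subst (1) E) (use K(1) in simp)
    qed
    have cont: "continuous_on (S J) (?g \<omega>)"
      by (rule continuous_on_eq[OF c1]) (simp only: c2)
    have "(\<lambda>n. ?g \<omega> (t n)) \<longlonglongrightarrow> ?g \<omega> u"
      by (rule continuous_on_tendsto_compose[OF cont t(2) uS]) (use tS in simp)
    moreover have "?g \<omega> (t n) \<le> c" for n using t(1) by (intro c) (auto simp: TT_def)
    ultimately show ?thesis by (intro LIMSEQ_le_const2) auto
  qed
  have ne: "TT \<noteq> {}"
  proof -
    obtain u where "u \<in> K" using K(2) by blast
    then have "u \<in> S {i. 0 < u $ i \<and> u $ i < 1}" by (simp add: S_def)
    then have "T {i. 0 < u $ i \<and> u $ i < 1} \<noteq> {}" using T(3) by force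
    then show ?thesis by (auto simp: TT_def)
  qed
  have eq: "(SUP u\<in>K. ?g \<omega> u) = (SUP u\<in>TT. ?g \<omega> u)" if w: "\<omega> \<in> space N" for \<omega>
  proof (rule antisym)
    have bT: "bdd_above (?g \<omega> ` TT)" using bdd[OF w] TK by (meson bdd_above_mono image_mono)
    show "(SUP u\<in>K. ?g \<omega> u) \<le> (SUP u\<in>TT. ?g \<omega> u)"
    proof (rule cSUP_least[OF K(2)])
      fix u assume u: "u \<in> K"
      show "?g \<omega> u \<le> (SUP u\<in>TT. ?g \<omega> u)"
        by (rule dense[OF w u]) (rule cSUP_upper[OF _ bT])
    qed
    show "(SUP u\<in>TT. ?g \<omega> u) \<le> (SUP u\<in>K. ?g \<omega> u)"
      by (rule cSUP_subset_mono[OF ne bdd[OF w] TK]) simp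
  qed
  have "(\<lambda>\<omega>. SUP u\<in>TT. ?g \<omega> u) \<in> borel_measurable N"
  proof (rule borel_measurable_cSUP[OF ct])
    fix u assume "u \<in> TT"
    then have u: "u \<in> {0..1}" using TK K(4) by blast
    then show "(\<lambda>\<omega>. ?g \<omega> u) \<in> borel_measurable N"
      by (intro borel_measurable_times lin_process_measurable[OF Bm]) simp_all
  next
    fix \<omega> assume "\<omega> \<in> space N"
    then show "bdd_above (?g \<omega> ` TT)" using bdd TK by (meson bdd_above_mono image_mono)
  qed
  then show ?thesis
    unfolding K_def[symmetric] using eq by (subst measurable_cong) auto
qed

text \<open>The variance of \<open>B u\<close> is \<open>C u - C u * C u\<close>, so
  \<open>B u\<close> vanishes almost surely where \<open>C\<close> is 0 or 1. Finitely many such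
  points, one on each axis and the corner 1, suffice for
  \<open>lin_process_continuous\<close>.\<close>

lemma AE_limit_process_continuous:
  fixes C :: "real ^ 'd \<Rightarrow> real" and B :: "real ^ 'd \<Rightarrow> 'b \<Rightarrow> real"
  assumes C: "copula C" and cp: "\<And>i. continuous_partial C i"
    and B2: "\<And>u. u \<in> {0..1} \<Longrightarrow> integrable N (\<lambda>\<omega>. (B u \<omega>)\<^sup>2)"
      "\<And>u. u \<in> {0..1} \<Longrightarrow> integral\<^sup>L N (\<lambda>\<omega>. (B u \<omega>)\<^sup>2) = C u - C u * C u"
    and Bc: "\<And>\<omega>. \<omega> \<in> space N \<Longrightarrow> continuous_on {0..1} (\<lambda>u. B u \<omega>)"
  shows "AE \<omega> in N. continuous_on {0..1} (lin_process C (\<lambda>u. B u \<omega>))"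
proof -
  have zero: "AE \<omega> in N. B u \<omega> = 0" if u: "u \<in> {0..1}" "C u = 0 \<or> C u = 1" for u
  proof -
    have "AE \<omega> in N. (B u \<omega>)\<^sup>2 = 0"
      using integral_nonneg_eq_0_iff_AE[OF B2(1)[OF u(1)]] B2(2)[OF u(1)] u(2) by auto
    then show ?thesis by simp
  qed
  have "AE \<omega> in N. B (vec_upd 1 i 0) \<omega> = 0" for i
    using copula_margin[OF C, of 0 i] by (intro zero) (simp_all del: atLeastAtMost_iff add: atLeastAtMost_iff[of 0])
  then have "AE \<omega> in N. \<forall>i. B (vec_upd 1 i 0) \<omega> = 0" by (simp add: AE_all_countable)
  moreover have "AE \<omega> in N. B 1 \<omega> = 0" using copula_one[OF C] by (intro zero) simp_all
  ultimately show ?thesis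
    using AE_space
  proof eventually_elim
    case (elim \<omega>)
    then show ?case by (intro lin_process_continuous[OF C cp Bc]) auto
  qed
qed

section \<open>The uniform empirical process\<close>

lemma inf_vec_nth_real [simp]: "inf u v $ i = min (u $ i) (v $ i :: real)"
  by (simp add: inf_vec_def inf_real_def)

lemma emp_process_sum:
  "emp_process C n x u = (\<Sum>k<n. indicator {..u} (x k) - C u) / sqrt (real n)"
proof (cases "n = 0")
  case False
  have "real (card {k. k < n \<and> x k \<le> u}) = (\<Sum>k<n. indicator {..u} (x k))"
    by (simp add: indicator_def sum.If_cases Int_def)
  moreover have "sqrt (real n) * (S / real n - c) = (S - real n * c) / sqrt (real n)" for S c
    using False by (simp add: field_simps real_sqrt_mult[symmetric] flip: power2_eq_square)
  ultimately show ?thesis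
    unfolding emp_process_def by (simp add: sum_subtractf)
qed (simp add: emp_process_def)

text \<open>For \<open>x = - y\<close> with \<open>y > 0\<close> the claim reads
  \<open>1 <= exp y * (1 - y + y^2)\<close>, and the quadratic Taylor polynomial already suffices as
  a lower bound for \<open>exp y\<close>.\<close>

lemma exp_le_quadratic:
  fixes x :: real
  assumes "\<bar>x\<bar> \<le> 1"
  shows "exp x \<le> 1 + x + x\<^sup>2"
proof (cases "0 \<le> x")
  case True
  then show ?thesis using exp_bound[of x] assms by simp
next
  case False
  define y where "y = - x"
  have y: "0 \<le> y" "x = - y" using False by (auto simp: y_def)
  have "1 + y + y\<^sup>2 / 2 \<le> exp y" by (rule exp_lower_Taylor_quadratic[OF y(1)])
  moreover have "0 \<le> 1 - y + y\<^sup>2" using sum_squares_bound[of 1 y] y(1) by (simp add: power2_eq_square)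
  ultimately have "(1 + y + y\<^sup>2 / 2) * (1 - y + y\<^sup>2) \<le> exp y * (1 - y + y\<^sup>2)" by (intro mult_right_mono)
  moreover have "(1 + y + y\<^sup>2 / 2) * (1 - y + y\<^sup>2) = 1 + y\<^sup>2 / 2 + y^3 / 2 + y^4 / 2"
    by (simp add: field_simps power2_eq_square power3_eq_cube power4_eq_xxxx)
  moreover have "0 \<le> y\<^sup>2 / 2 + y^3 / 2 + y^4 / 2" using y by simp
  ultimately have "1 \<le> exp y * (1 - y + y\<^sup>2)" by linarith
  then show ?thesis unfolding y(2) exp_minus by (simp add: field_simps)
qed

text \<open>The sample after the marginal transform. \<open>U_range\<close> holds at every point of
  the space because the coordinates are values of distribution functions.\<close>

locale copula_sample = prob_space M for M :: "'a measure" +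
  fixes U :: "nat \<Rightarrow> 'a \<Rightarrow> real ^ 'd" and C :: "real ^ 'd \<Rightarrow> real" and \<nu> :: "(real ^ 'd) measure"
  assumes indep: "indep_vars (\<lambda>_. borel) U UNIV"
    and law: "\<And>k. distr M borel (U k) = \<nu>"
    and U_range: "\<And>k \<omega> i. 0 \<le> U k \<omega> $ i \<and> U k \<omega> $ i \<le> 1"
    and cdf: "\<And>u. u \<in> {0..1} \<Longrightarrow> measure \<nu> {..u} = C u"
    and copula: "copula C"
begin

lemma U_measurable [measurable]: "U k \<in> borel_measurable M"
  using indep unfolding indep_vars_def by auto

lemma prob_U_le: "u \<in> {0..1} \<Longrightarrow> prob {\<omega>\<in>space M. U k \<omega> \<le> u} = C u"
proof -
  assume u: "u \<in> {0..1}"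
  have "C u = measure (distr M borel (U k)) {..u}" using cdf[OF u] law by simp
  also have "\<dots> = prob (U k -` {..u} \<inter> space M)" by (rule measure_distr) auto
  also have "U k -` {..u} \<inter> space M = {\<omega>\<in>space M. U k \<omega> \<le> u}" by auto
  finally show ?thesis by simp
qed

definition \<xi> :: "nat \<Rightarrow> real ^ 'd \<Rightarrow> 'a \<Rightarrow> real" where
  "\<xi> k u \<omega> = indicator {..u} (U k \<omega>) - C u"

lemma \<xi>_measurable [measurable]: "\<xi> k u \<in> borel_measurable M"
  unfolding \<xi>_def by measurable

lemma \<xi>_bound: "u \<in> {0..1} \<Longrightarrow> \<bar>\<xi> k u \<omega>\<bar> \<le> 1"
  using copula_range[OF copula, of u] by (auto simp: \<xi>_def indicator_def)

lemma integrable_indicator_U: "integrable M (\<lambda>\<omega>. indicator {..u} (U k \<omega>) :: real)"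
  by (rule integrable_const_bound[where B=1]) (auto simp: indicator_def)

lemma expectation_indicator_U:
  assumes "u \<in> {0..1}"
  shows "expectation (\<lambda>\<omega>. indicator {..u} (U k \<omega>)) = C u"
proof -
  have "expectation (\<lambda>\<omega>. indicator {..u} (U k \<omega>)) = expectation (indicator {\<omega>\<in>space M. U k \<omega> \<le> u} :: 'a \<Rightarrow> real)"
    by (intro Bochner_Integration.integral_cong) (auto simp: indicator_def)
  also have "\<dots> = prob {\<omega>\<in>space M. U k \<omega> \<le> u}" by simp
  finally show ?thesis using prob_U_le[OF assms] by simp
qed

lemma \<xi>_integrable: "integrable M (\<xi> k u)"
  unfolding \<xi>_def[abs_def] using integrable_indicator_U by simp

lemma \<xi>_mean: "u \<in> {0..1} \<Longrightarrow> expectation (\<xi> k u) = 0"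
  unfolding \<xi>_def[abs_def] using integrable_indicator_U expectation_indicator_U
  by (simp add: prob_space)

lemma \<xi>_mult_integrable:
  assumes "u \<in> {0..1}" "w \<in> {0..1}"
  shows "integrable M (\<lambda>\<omega>. \<xi> k u \<omega> * \<xi> k w \<omega>)"
proof (rule integrable_const_bound[where B=1])
  show "AE \<omega> in M. norm (\<xi> k u \<omega> * \<xi> k w \<omega>) \<le> 1"
    using \<xi>_bound[OF assms(1)] \<xi>_bound[OF assms(2)] by (auto simp: abs_mult intro!: mult_le_one)
qed measurable

lemma inf_mem_cube: "u \<in> {0..1} \<Longrightarrow> w \<in> {0..1} \<Longrightarrow> inf u w \<in> {0..1::real^'d}"
  unfolding mem_cube_iff by (auto simp: min_le_iff_disj)

lemma \<xi>_covariance: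
  assumes u: "u \<in> {0..1}" and w: "w \<in> {0..1}"
  shows "expectation (\<lambda>\<omega>. \<xi> k u \<omega> * \<xi> k w \<omega>) = C (inf u w) - C u * C w"
proof -
  let ?I = "\<lambda>u \<omega>. indicator {..u} (U k \<omega>) :: real"
  have "\<xi> k u \<omega> * \<xi> k w \<omega> = ?I (inf u w) \<omega> - C u * ?I w \<omega> - C w * ?I u \<omega> + C u * C w" for \<omega>
    by (auto simp: \<xi>_def indicator_def algebra_simps)
  then have "expectation (\<lambda>\<omega>. \<xi> k u \<omega> * \<xi> k w \<omega>) =
    expectation (?I (inf u w)) - C u * expectation (?I w) - C w * expectation (?I u) + C u * C w"
    using integrable_indicator_U by (simp add: prob_space)
  also have "\<dots> = C (inf u w) - C u * C w"
    using expectation_indicator_U u w inf_mem_cube[OF u w] by (simp add: algebra_simps del: atLeastAtMost_iff)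
  finally show ?thesis .
qed

definition \<alpha> :: "nat \<Rightarrow> real ^ 'd \<Rightarrow> 'a \<Rightarrow> real" where
  "\<alpha> n u \<omega> = emp_process C n (\<lambda>k. U k \<omega>) u"

lemma \<alpha>_eq: "\<alpha> n u \<omega> = (\<Sum>k<n. \<xi> k u \<omega>) / sqrt (real n)"
  unfolding \<alpha>_def emp_process_sum \<xi>_def by simp

lemma \<alpha>_measurable [measurable]: "\<alpha> n u \<in> borel_measurable M"
  unfolding \<alpha>_eq[abs_def] by measurable

text \<open>The second moment is at most the probability of the symmetric difference of the two
  orthants, whose two halves are bounded by the positive parts of the coordinate
  differences.\<close>

lemma increment_variance:
  assumes u: "u \<in> {0..1}" and v: "v \<in> {0..1}"
  shows "expectation (\<lambda>\<omega>. (\<xi> k u \<omega> - \<xi> k v \<omega>)\<^sup>2) \<le> (\<Sum>i\<in>UNIV. \<bar>u $ i - v $ i\<bar>)"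
proof -
  have "(\<xi> k u \<omega> - \<xi> k v \<omega>)\<^sup>2 = \<xi> k u \<omega> * \<xi> k u \<omega> - 2 * (\<xi> k u \<omega> * \<xi> k v \<omega>) + \<xi> k v \<omega> * \<xi> k v \<omega>" for \<omega>
    by (simp add: power2_eq_square algebra_simps)
  then have "expectation (\<lambda>\<omega>. (\<xi> k u \<omega> - \<xi> k v \<omega>)\<^sup>2) =
    (C (inf u u) - C u * C u) - 2 * (C (inf u v) - C u * C v) + (C (inf v v) - C v * C v)"
    using \<xi>_mult_integrable[OF u u] \<xi>_mult_integrable[OF u v] \<xi>_mult_integrable[OF v v]
    by (simp add: \<xi>_covariance[OF u u] \<xi>_covariance[OF u v] \<xi>_covariance[OF v v])
  also have "\<dots> = (C u - C (inf u v)) + (C v - C (inf u v)) - (C u - C v)\<^sup>2"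
    by (simp add: power2_eq_square algebra_simps)
  also have "\<dots> \<le> (C u - C (inf u v)) + (C v - C (inf u v))" by simp
  also have "\<dots> \<le> (\<Sum>i\<in>UNIV. max 0 (u $ i - inf u v $ i)) + (\<Sum>i\<in>UNIV. max 0 (v $ i - inf u v $ i))"
    by (intro add_mono copula_diff_le[OF copula] u v inf_mem_cube)
  also have "\<dots> = (\<Sum>i\<in>UNIV. \<bar>u $ i - v $ i\<bar>)"
    unfolding sum.distrib[symmetric] by (intro sum.cong) auto
  finally show ?thesis .
qed

lemma indep_functional:
  assumes [measurable]: "f \<in> borel_measurable borel"
  shows "indep_vars (\<lambda>_. borel) (\<lambda>k \<omega>. f (U k \<omega>) :: real) UNIV"
  by (rule indep_vars_compose2[OF indep]) auto

text \<open>The increment is at most 2 in absolute value, so \<open>l <= 1 / 2\<close> keeps the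
  exponent in \<open>[-1, 1]\<close>, where the quadratic bound for the exponential applies. The
  linear term has mean zero.\<close>

lemma increment_mgf:
  assumes u: "u \<in> {0..1}" and v: "v \<in> {0..1}" and l: "0 \<le> l" "l \<le> 1 / 2"
  shows "integrable M (\<lambda>\<omega>. exp (l * (\<xi> k u \<omega> - \<xi> k v \<omega>)))"
    and "expectation (\<lambda>\<omega>. exp (l * (\<xi> k u \<omega> - \<xi> k v \<omega>))) \<le> exp (l\<^sup>2 * (\<Sum>i\<in>UNIV. \<bar>u $ i - v $ i\<bar>))"
proof -
  let ?Y = "\<lambda>\<omega>. \<xi> k u \<omega> - \<xi> k v \<omega>" and ?p = "\<Sum>i\<in>UNIV. \<bar>u $ i - v $ i\<bar>"
  have Y2: "\<bar>?Y \<omega>\<bar> \<le> 2" for \<omega> using \<xi>_bound[OF u, of k \<omega>] \<xi>_bound[OF v, of k \<omega>] by linarith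
  have lY: "\<bar>l * ?Y \<omega>\<bar> \<le> 1" for \<omega>
  proof -
    have "l * \<bar>?Y \<omega>\<bar> \<le> 1/2 * 2" using l Y2 by (intro mult_mono) auto
    then show ?thesis using l by (simp add: abs_mult)
  qed
  show int: "integrable M (\<lambda>\<omega>. exp (l * ?Y \<omega>))"
    by (rule integrable_const_bound[where B="exp 1"]) (use lY in \<open>auto simp: abs_le_iff\<close>)
  have sq: "integrable M (\<lambda>\<omega>. (?Y \<omega>)\<^sup>2)"
    by (rule integrable_const_bound[where B=4]) (use Y2 abs_le_square_iff[of _ 2] in auto)
  have Yi: "integrable M ?Y" using \<xi>_integrable by simp
  have "expectation (\<lambda>\<omega>. exp (l * ?Y \<omega>)) \<le> expectation (\<lambda>\<omega>. 1 + l * ?Y \<omega> + l\<^sup>2 * (?Y \<omega>)\<^sup>2)"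
    using int sq Yi exp_le_quadratic[OF lY] by (intro integral_mono) (auto simp: power_mult_distrib)
  also have "\<dots> = 1 + l * expectation ?Y + l\<^sup>2 * expectation (\<lambda>\<omega>. (?Y \<omega>)\<^sup>2)"
    using sq Yi by (simp add: prob_space)
  also have "expectation ?Y = 0" using \<xi>_integrable \<xi>_mean u v by simp
  also have "1 + l * 0 + l\<^sup>2 * expectation (\<lambda>\<omega>. (?Y \<omega>)\<^sup>2) \<le> 1 + l\<^sup>2 * ?p"
    using increment_variance[OF u v] by (simp add: mult_left_mono)
  also have "\<dots> \<le> exp (l\<^sup>2 * ?p)" by (rule exp_ge_add_one_self)
  finally show "expectation (\<lambda>\<omega>. exp (l * ?Y \<omega>)) \<le> exp (l\<^sup>2 * ?p)" .
qed

text \<open>Chernoff's bound with \<open>l = s / sqrt n\<close>; the condition on \<open>s\<close>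
  is \<open>l <= 1 / 2\<close>. The parameter \<open>s\<close> is left free because each level of
  the chaining needs its own.\<close>

lemma increment_upper_tail:
  assumes u: "u \<in> {0..1}" and v: "v \<in> {0..1}" and s: "0 < s" "s \<le> sqrt (real n) / 2"
  shows "prob {\<omega>\<in>space M. \<alpha> n u \<omega> - \<alpha> n v \<omega> \<ge> x} \<le> exp (s\<^sup>2 * (\<Sum>i\<in>UNIV. \<bar>u $ i - v $ i\<bar>) - s * x)"
proof -
  let ?p = "\<Sum>i\<in>UNIV. \<bar>u $ i - v $ i\<bar>"
  have n: "0 < n" using s by (cases n) auto
  define l where "l = s / sqrt (real n)"
  have l: "0 \<le> l" "l \<le> 1 / 2" "l\<^sup>2 * real n = s\<^sup>2" using s n by (auto simp: l_def field_simps power_divide)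
  let ?E = "\<lambda>k \<omega>. exp (l * (\<xi> k u \<omega> - \<xi> k v \<omega>))"
  have iv: "indep_vars (\<lambda>_. borel) ?E {..<n}"
    unfolding \<xi>_def
    by (rule indep_vars_subset[OF indep_functional[of "\<lambda>y. exp (l * (indicator {..u} y - C u - (indicator {..v} y - C v)))"]])
       (auto intro: borel_measurable_continuous_onI)
  have "s * (\<alpha> n u \<omega> - \<alpha> n v \<omega>) = (\<Sum>k<n. l * (\<xi> k u \<omega> - \<xi> k v \<omega>))" for \<omega>
    unfolding sum_distrib_left[symmetric] sum_subtractf by (simp add: \<alpha>_eq l_def diff_divide_distrib right_diff_distrib)
  then have prod: "exp (s * (\<alpha> n u \<omega> - \<alpha> n v \<omega>)) = (\<Prod>k<n. ?E k \<omega>)" for \<omega>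
    by (simp add: exp_sum)
  have int: "integrable M (\<lambda>\<omega>. \<Prod>k<n. ?E k \<omega>)"
    by (rule indep_vars_integrable[OF _ iv]) (auto intro: increment_mgf[OF u v l(1,2)])
  have "expectation (\<lambda>\<omega>. \<Prod>k<n. ?E k \<omega>) = (\<Prod>k<n. expectation (?E k))"
    by (rule indep_vars_lebesgue_integral[OF _ iv]) (auto intro: increment_mgf[OF u v l(1,2)])
  also have "\<dots> \<le> (\<Prod>k<n. exp (l\<^sup>2 * ?p))"
    by (intro prod_mono conjI integral_nonneg_AE increment_mgf[OF u v l(1,2)]) auto
  also have "\<dots> = exp (s\<^sup>2 * ?p)"
    by (simp add: exp_of_nat_mult[symmetric] l(3)[symmetric] algebra_simps)
  finally have E: "expectation (\<lambda>\<omega>. \<Prod>k<n. ?E k \<omega>) \<le> exp (s\<^sup>2 * ?p)" .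
  have "{\<omega>\<in>space M. \<alpha> n u \<omega> - \<alpha> n v \<omega> \<ge> x} = {\<omega>\<in>space M. (\<Prod>k<n. ?E k \<omega>) \<ge> exp (s * x)}"
    unfolding prod[symmetric] using s by simp
  also have "prob \<dots> \<le> expectation (\<lambda>\<omega>. \<Prod>k<n. ?E k \<omega>) / exp (s * x)"
    by (rule integral_Markov_inequality_measure[OF int, of "{}"]) (auto intro!: prod_nonneg)
  also have "\<dots> \<le> exp (s\<^sup>2 * ?p) / exp (s * x)" using E by (intro divide_right_mono) auto
  finally show ?thesis by (simp add: exp_diff)
qed

lemma increment_tail:
  assumes u: "u \<in> {0..1}" and v: "v \<in> {0..1}" and s: "0 < s" "s \<le> sqrt (real n) / 2"
  shows "prob {\<omega>\<in>space M. \<bar>\<alpha> n u \<omega> - \<alpha> n v \<omega>\<bar> > x} \<le> 2 * exp (s\<^sup>2 * (\<Sum>i\<in>UNIV. \<bar>u $ i - v $ i\<bar>) - s * x)"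
proof -
  have "prob {\<omega>\<in>space M. \<bar>\<alpha> n u \<omega> - \<alpha> n v \<omega>\<bar> > x} \<le>
    prob ({\<omega>\<in>space M. \<alpha> n u \<omega> - \<alpha> n v \<omega> \<ge> x} \<union> {\<omega>\<in>space M. \<alpha> n v \<omega> - \<alpha> n u \<omega> \<ge> x})"
    by (intro finite_measure_mono) (auto simp: abs_if split: if_splits)
  also have "\<dots> \<le> prob {\<omega>\<in>space M. \<alpha> n u \<omega> - \<alpha> n v \<omega> \<ge> x} + prob {\<omega>\<in>space M. \<alpha> n v \<omega> - \<alpha> n u \<omega> \<ge> x}"
    by (intro measure_Un_le) measurable
  finally show ?thesis
    using increment_upper_tail[OF u v s, of x] increment_upper_tail[OF v u s, of x]
    by (simp add: abs_minus_commute)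
qed

text \<open>Uniform margins have no atoms, so by Fubini two independent coordinates coincide with
  probability 0. Countably many null sets are collected.\<close>

lemma AE_generic: "AE \<omega> in M. \<forall>n. generic_sample n (\<lambda>k. U k \<omega>)"
proof -
  have le: "prob {\<omega>\<in>space M. U k \<omega> $ i \<le> t} = t" if "0 \<le> t" "t \<le> 1" for k i t
  proof -
    have "{\<omega>\<in>space M. U k \<omega> $ i \<le> t} = {\<omega>\<in>space M. U k \<omega> \<le> vec_upd 1 i t}"
      using U_range by (auto simp: less_eq_vec_def split: if_splits)
    then show ?thesis using prob_U_le[of "vec_upd 1 i t" k] copula_margin[OF copula, of t i] that
      by (simp del: atLeastAtMost_iff add: atLeastAtMost_iff[of t])
  qed
  have zero: "AE \<omega> in M. 0 < U k \<omega> $ i" for k i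
  proof (rule AE_I[where N="{\<omega>\<in>space M. U k \<omega> $ i \<le> 0}"])
    show "emeasure M {\<omega>\<in>space M. U k \<omega> $ i \<le> 0} = 0"
      using le[of 0 k i] by (simp add: emeasure_eq_measure)
  qed (auto simp: not_less)
  have point: "prob {\<omega>\<in>space M. U k \<omega> $ i = t} = 0" for k i t
  proof (cases "0 < t \<and> t \<le> 1")
    case True
    show ?thesis
    proof (rule antisym[OF _ measure_nonneg], rule field_le_epsilon)
      fix e :: real assume e: "0 < e"
      define s where "s = max 0 (t - e)"
      have s: "0 \<le> s" "s < t" "t - s \<le> e" using True e by (auto simp: s_def)
      have "prob {\<omega>\<in>space M. U k \<omega> $ i = t} \<le> prob ({\<omega>\<in>space M. U k \<omega> $ i \<le> t} - {\<omega>\<in>space M. U k \<omega> $ i \<le> s})"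
        using s by (intro finite_measure_mono) auto
      also have "\<dots> = t - s"
        using s True by (subst finite_measure_Diff) (auto simp: le)
      finally show "prob {\<omega>\<in>space M. U k \<omega> $ i = t} \<le> 0 + e" using s by simp
    qed
  next
    case False
    have "prob {\<omega>\<in>space M. U k \<omega> $ i = t} \<le> prob {\<omega>\<in>space M. U k \<omega> $ i \<le> 0}"
    proof (cases "t \<le> 0")
      case True
      then show ?thesis by (intro finite_measure_mono) auto
    next
      case False
      with \<open>\<not> (0 < t \<and> t \<le> 1)\<close> have E: "{\<omega>\<in>space M. U k \<omega> $ i = t} = {}"
        using U_range[of k _ i] by force
      show ?thesis unfolding E by simp
    qed
    then show ?thesis using le[of 0 k i] measure_nonneg[of M "{\<omega>\<in>space M. U k \<omega> $ i = t}"] by simp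
  qed
  have tie: "AE \<omega> in M. U j \<omega> $ i \<noteq> U k \<omega> $ i" if "j \<noteq> k" for j k i
  proof -
    let ?V = "\<lambda>k \<omega>. U k \<omega> $ i"
    have V[measurable]: "?V k \<in> borel_measurable M" for k by measurable
    have "indep_vars (\<lambda>_. borel) ?V UNIV" by (rule indep_functional) measurable
    then have "indep_vars (\<lambda>_. borel) ?V (insert j {k})" by (rule indep_vars_subset) auto
    \<comment> \<open>A sum over a singleton serves to extract the independence of a pair from that
      of a family.\<close>
    then have "indep_var borel (?V j) borel (\<lambda>\<omega>. \<Sum>l\<in>{k}. ?V l \<omega>)"
      using that by (intro indep_vars_sum) auto
    then have eq: "distr M borel (?V j) \<Otimes>\<^sub>M distr M borel (?V k) = distr M (borel \<Otimes>\<^sub>M borel) (\<lambda>\<omega>. (?V j \<omega>, ?V k \<omega>))"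
      unfolding indep_var_distribution_eq by simp
    interpret D1: prob_space "distr M borel (?V j)" by (rule prob_space_distr) measurable
    interpret D2: prob_space "distr M borel (?V k)" by (rule prob_space_distr) measurable
    interpret P: pair_sigma_finite "distr M borel (?V j)" "distr M borel (?V k)" ..
    have "AE z in distr M borel (?V j) \<Otimes>\<^sub>M distr M borel (?V k). fst z \<noteq> snd z"
    proof (rule P.AE_pair_measure)
      show "AE x in distr M borel (?V j). AE y in distr M borel (?V k). fst (x, y) \<noteq> snd (x, y)"
      proof (rule AE_I2)
        fix x
        have "AE \<omega> in M. x \<noteq> ?V k \<omega>"
        proof (rule AE_I[where N="{\<omega>\<in>space M. U k \<omega> $ i = x}"])
          show "emeasure M {\<omega>\<in>space M. U k \<omega> $ i = x} = 0"
            using point by (simp add: emeasure_eq_measure)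
        qed auto
        then show "AE y in distr M borel (?V k). fst (x, y) \<noteq> snd (x, y)"
          by (subst AE_distr_iff) auto
      qed
    qed measurable
    moreover have "{z::real \<times> real. fst z \<noteq> snd z} \<in> sets (borel \<Otimes>\<^sub>M borel)"
      unfolding borel_prod by (intro borel_open open_Collect_neq continuous_intros)
    ultimately show ?thesis unfolding eq by (subst (asm) AE_distr_iff) (auto simp: space_pair_measure)
  qed
  have "AE \<omega> in M. \<forall>k i. 0 < U k \<omega> $ i" using zero by (simp add: AE_all_countable)
  moreover have "AE \<omega> in M. \<forall>j k i. j \<noteq> k \<longrightarrow> U j \<omega> $ i \<noteq> U k \<omega> $ i"
    using tie by (auto simp: AE_all_countable)
  ultimately show ?thesis
    by eventually_elim (use U_range in \<open>simp add: generic_sample_def inj_on_def; metis\<close>)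
qed

end

section \<open>Chaining\<close>

text \<open>With mesh \<open>4 ^ (- k)\<close> the inverse square root of the mesh, which is the
  scale of the parameter \<open>s\<close> in the tail bound, is the power
  \<open>2 ^ k\<close>.\<close>

definition grid :: "nat \<Rightarrow> (real ^ 'd) set" where
  "grid k = (\<lambda>f. \<chi> i. real (f i) / 4 ^ k) ` (UNIV \<rightarrow>\<^sub>E {..4 ^ k})"

lemma gridI: "(\<And>i. \<exists>l::nat. l \<le> 4 ^ k \<and> a $ i = real l / 4 ^ k) \<Longrightarrow> a \<in> grid k"
proof -
  assume "\<And>i. \<exists>l::nat. l \<le> 4 ^ k \<and> a $ i = real l / 4 ^ k"
  then obtain f :: "'a \<Rightarrow> nat" where "\<And>i. f i \<le> 4 ^ k \<and> a $ i = real (f i) / 4 ^ k" by metis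
  then show ?thesis unfolding grid_def by (intro image_eqI[of _ _ f]) (auto simp: vec_eq_iff)
qed

lemma gridD: "a \<in> grid k \<Longrightarrow> \<exists>l::nat. l \<le> 4 ^ k \<and> a $ i = real l / 4 ^ k"
  unfolding grid_def by auto

lemma finite_grid [simp]: "finite (grid k)"
  unfolding grid_def by (intro finite_imageI finite_PiE) auto

lemma card_grid: "card (grid k :: (real ^ 'd) set) \<le> (4 ^ k + 1) ^ CARD('d)"
proof -
  have "card (grid k :: (real ^ 'd) set) \<le> card (UNIV \<rightarrow>\<^sub>E {..4 ^ k} :: ('d \<Rightarrow> nat) set)"
    unfolding grid_def by (intro card_image_le finite_PiE) auto
  also have "\<dots> = (4 ^ k + 1) ^ CARD('d)" by (simp add: card_PiE)
  finally show ?thesis .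
qed

lemma grid_subset_cube: "a \<in> grid k \<Longrightarrow> a \<in> {0..1}"
proof -
  assume a: "a \<in> grid k"
  have "0 \<le> a $ i \<and> a $ i \<le> 1" for i
  proof -
    obtain l :: nat where l: "l \<le> 4 ^ k" "a $ i = real l / 4 ^ k" using gridD[OF a] by blast
    have "real l \<le> 4 ^ k" using l(1) by (metis of_nat_le_iff of_nat_numeral of_nat_power)
    then show ?thesis using l(2) by simp
  qed
  then show ?thesis unfolding mem_cube_iff by blast
qed

lemma grid_Suc: "a \<in> grid k \<Longrightarrow> a \<in> grid (Suc k)"
proof (rule gridI)
  fix i assume "a \<in> grid k"
  then obtain l :: nat where "l \<le> 4 ^ k" "a $ i = real l / 4 ^ k" using gridD by blast
  then show "\<exists>l::nat. l \<le> 4 ^ Suc k \<and> a $ i = real l / 4 ^ Suc k"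
    by (intro exI[of _ "4 * l"]) (auto simp: field_simps)
qed

definition grid_floor :: "nat \<Rightarrow> real ^ 'd \<Rightarrow> real ^ 'd" where
  "grid_floor k u = (\<chi> i. real (nat \<lfloor>4 ^ k * u $ i\<rfloor>) / 4 ^ k)"

lemma grid_floor_bounds:
  assumes "u \<in> {0..1::real^'d}"
  shows "grid_floor k u $ i \<le> u $ i" "u $ i \<le> grid_floor k u $ i + (1 / 4) ^ k"
    "grid_floor k u \<in> grid k"
proof -
  have u: "0 \<le> u $ i" "u $ i \<le> 1" for i using assms unfolding mem_cube_iff by auto
  have nn: "0 \<le> 4 ^ k * u $ i" for i using u by simp
  have e: "real (nat \<lfloor>4 ^ k * u $ i\<rfloor>) = of_int \<lfloor>4 ^ k * u $ i\<rfloor>" for i using nn[of i] by simp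
  show "grid_floor k u $ i \<le> u $ i"
    unfolding grid_floor_def vec_lambda_beta e using of_int_floor_le[of "4 ^ k * u $ i"]
    by (simp add: divide_le_eq mult.commute)
  have "4 ^ k * u $ i \<le> real (nat \<lfloor>4 ^ k * u $ i\<rfloor>) + 1" unfolding e by linarith
  then show "u $ i \<le> grid_floor k u $ i + (1 / 4) ^ k"
    unfolding grid_floor_def vec_lambda_beta by (simp add: field_simps power_divide)
  show "grid_floor k u \<in> grid k"
  proof (rule gridI)
    fix i
    have "4 ^ k * u $ i \<le> 4 ^ k" using u[of i] by simp
    then have "\<lfloor>4 ^ k * u $ i\<rfloor> \<le> 4 ^ k" by (metis floor_mono floor_of_int of_int_numeral of_int_power)
    then have "nat \<lfloor>4 ^ k * u $ i\<rfloor> \<le> 4 ^ k" by (simp add: nat_le_iff)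
    then show "\<exists>l::nat. l \<le> 4 ^ k \<and> grid_floor k u $ i = real l / 4 ^ k"
      unfolding grid_floor_def by auto
  qed
qed

lemma grid_floor_close:
  assumes "u \<in> {0..1::real^'d}" "v \<in> {0..1}" "\<bar>u $ i - v $ i\<bar> \<le> (1 / 4) ^ k"
  shows "\<bar>grid_floor k u $ i - grid_floor k v $ i\<bar> \<le> (1 / 4) ^ k"
proof -
  have u: "0 \<le> 4 ^ k * u $ i" "0 \<le> 4 ^ k * v $ i" using assms(1,2) unfolding mem_cube_iff by auto
  have "\<bar>4 ^ k * u $ i - 4 ^ k * v $ i\<bar> = 4 ^ k * \<bar>u $ i - v $ i\<bar>"
    by (simp add: abs_mult flip: right_diff_distrib)
  also have "\<dots> \<le> 4 ^ k * (1 / 4) ^ k" using assms(3) by (intro mult_left_mono) auto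
  also have "\<dots> = 1" by (simp add: power_divide)
  finally have "4 ^ k * u $ i \<le> 4 ^ k * v $ i + 1" "4 ^ k * v $ i \<le> 4 ^ k * u $ i + 1" by linarith+
  then have "\<lfloor>4 ^ k * u $ i\<rfloor> \<le> \<lfloor>4 ^ k * v $ i\<rfloor> + 1" "\<lfloor>4 ^ k * v $ i\<rfloor> \<le> \<lfloor>4 ^ k * u $ i\<rfloor> + 1"
    by linarith+
  then have "\<bar>of_int \<lfloor>4 ^ k * u $ i\<rfloor> - of_int \<lfloor>4 ^ k * v $ i\<rfloor> :: real\<bar> \<le> 1"
    by linarith
  then have "\<bar>real (nat \<lfloor>4 ^ k * u $ i\<rfloor>) - real (nat \<lfloor>4 ^ k * v $ i\<rfloor>)\<bar> \<le> 1"
    using u by simp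
  then show ?thesis
    by (simp add: grid_floor_def divide_right_mono power_divide flip: diff_divide_distrib)
qed

text \<open>Each point is joined to its roundings on the levels from \<open>k0\<close> to
  \<open>K\<close>; roundings on consecutive levels both lie in \<open>grid (Suc k)\<close>. Since
  the path may jump, the chain ends at level \<open>K\<close>, and \<open>u\<close> is compared with
  the corners \<open>p <= u <= q\<close> of its cell. Two such chains and one step between the
  roundings on level \<open>k0\<close> give \<open>3 * \<eta>\<close>; the two sandwiches give the
  remaining term.\<close>

lemma chaining:
  fixes a :: "real ^ 'd \<Rightarrow> real"
  assumes pairs: "\<And>k p q. k0 \<le> k \<Longrightarrow> k \<le> K \<Longrightarrow> p \<in> grid (Suc k) \<Longrightarrow> q \<in> grid (Suc k) \<Longrightarrow>
       (\<And>i. \<bar>p $ i - q $ i\<bar> \<le> (1 / 4) ^ k) \<Longrightarrow> \<bar>a p - a q\<bar> \<le> x k"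
    and sandwich: "\<And>p u q. p \<in> {0..1} \<Longrightarrow> q \<in> {0..1} \<Longrightarrow> p \<le> u \<Longrightarrow> u \<le> q \<Longrightarrow>
       \<bar>a u - a p\<bar> \<le> \<bar>a q - a p\<bar> + r * (\<Sum>i\<in>UNIV. q $ i - p $ i)"
    and r: "0 \<le> r" and k0: "k0 \<le> K" and x: "(\<Sum>k=k0..K. x k) \<le> \<eta>" "\<And>k. 0 \<le> x k"
  shows "cube_modulus a ((1 / 4) ^ k0) (3 * \<eta> + 2 * r * real CARD('d) * (1 / 4) ^ K)"
  unfolding cube_modulus_def
proof (intro ballI impI)
  have single: "\<bar>a u - a (grid_floor k0 u)\<bar> \<le> \<eta> + r * real CARD('d) * (1 / 4) ^ K" if u: "u \<in> {0..1}" for u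
  proof -
    have chain: "\<bar>a (grid_floor (k0 + m) u) - a (grid_floor k0 u)\<bar> \<le> (\<Sum>k=k0..<k0 + m. x k)" if "k0 + m \<le> K" for m
      using that
    proof (induction m)
      case (Suc m)
      have "\<bar>a (grid_floor (Suc (k0 + m)) u) - a (grid_floor (k0 + m) u)\<bar> \<le> x (k0 + m)"
      proof (rule pairs)
        show "grid_floor (Suc (k0 + m)) u \<in> grid (Suc (k0 + m))"
          "grid_floor (k0 + m) u \<in> grid (Suc (k0 + m))"
          by (auto intro: grid_floor_bounds[OF u] grid_Suc)
        fix i
        have "(1 / 4 :: real) ^ Suc (k0 + m) \<le> (1 / 4) ^ (k0 + m)" by simp
        then show "\<bar>grid_floor (Suc (k0 + m)) u $ i - grid_floor (k0 + m) u $ i\<bar> \<le> (1 / 4) ^ (k0 + m)"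
          using grid_floor_bounds(1,2)[OF u, where i=i and k="Suc (k0 + m)"]
            grid_floor_bounds(1,2)[OF u, where i=i and k="k0 + m"]
          by linarith
      qed (use Suc in auto)
      moreover have "\<bar>a (grid_floor (k0 + m) u) - a (grid_floor k0 u)\<bar> \<le> (\<Sum>k=k0..<k0 + m. x k)"
        using Suc by simp
      ultimately show ?case by simp
    qed simp
    from chain[of "K - k0"] k0
    have 1: "\<bar>a (grid_floor K u) - a (grid_floor k0 u)\<bar> \<le> (\<Sum>k=k0..<K. x k)" by simp
    define p where "p = grid_floor K u"
    \<comment> \<open>The upper corner of the cell, cut off at 1 to stay in the cube; the result is
      still a grid point because 1 is one.\<close>
    define q where "q = (\<chi> i. min 1 (p $ i + (1 / 4) ^ K))"
    have p: "p \<in> grid K" and pu: "p \<le> u" unfolding p_def less_eq_vec_def by (auto intro: grid_floor_bounds[OF u])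
    have p01: "p $ i \<le> 1" for i using grid_subset_cube[OF p] unfolding mem_cube_iff by auto
    have q: "q \<in> grid K"
    proof (rule gridI)
      fix i
      obtain l :: nat where l: "l \<le> 4 ^ K" "p $ i = real l / 4 ^ K" using gridD[OF p] by blast
      show "\<exists>l::nat. l \<le> 4 ^ K \<and> q $ i = real l / 4 ^ K"
      proof (cases "l = 4 ^ K")
        case True
        then show ?thesis using l by (intro exI[of _ "4 ^ K"]) (auto simp: q_def)
      next
        case False
        then have "l + 1 \<le> 4 ^ K" using l by simp
        then have "real (l + 1) \<le> real (4 ^ K)" by (rule of_nat_mono)
        then have "q $ i = real (l + 1) / 4 ^ K"
          using l by (simp add: q_def power_divide field_simps min_def)
        then show ?thesis using \<open>l + 1 \<le> 4 ^ K\<close> by blast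
      qed
    qed
    have uq: "u \<le> q"
      using grid_floor_bounds(2)[OF u, where k=K] u unfolding less_eq_vec_def q_def p_def by (auto simp: less_eq_vec_def)
    have qp: "0 \<le> q $ i - p $ i" "q $ i - p $ i \<le> (1 / 4) ^ K" for i using p01[of i] by (auto simp: q_def)
    have "\<bar>a u - a p\<bar> \<le> \<bar>a q - a p\<bar> + r * (\<Sum>i\<in>UNIV. q $ i - p $ i)"
      using grid_subset_cube[OF p] grid_subset_cube[OF q] pu uq by (rule sandwich)
    moreover have "\<bar>a q - a p\<bar> \<le> x K"
    proof (rule pairs)
      show "\<bar>q $ i - p $ i\<bar> \<le> (1 / 4) ^ K" for i using qp[of i] by simp
    qed (use k0 in \<open>auto intro: grid_Suc p q\<close>)
    moreover have "r * (\<Sum>i\<in>UNIV. q $ i - p $ i) \<le> r * (\<Sum>i\<in>(UNIV::'d set). (1 / 4) ^ K)"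
      using qp r by (intro mult_left_mono sum_mono) auto
    moreover have "(\<Sum>k=k0..K. x k) = (\<Sum>k=k0..<K. x k) + x K"
      using k0 by (simp add: atLeastLessThanSuc_atLeastAtMost[symmetric])
    ultimately show ?thesis using 1 x unfolding p_def by (simp add: mult.assoc)
  qed
  fix u v :: "real^'d" assume uv: "u \<in> {0..1}" "v \<in> {0..1}" and d: "\<forall>i. \<bar>u $ i - v $ i\<bar> \<le> (1 / 4) ^ k0"
  have "\<bar>a (grid_floor k0 u) - a (grid_floor k0 v)\<bar> \<le> x k0"
    using d k0 by (intro pairs) (auto intro: grid_Suc grid_floor_bounds uv grid_floor_close simp del: atLeastAtMost_iff)
  also have "\<dots> \<le> (\<Sum>k=k0..K. x k)" using x k0 by (intro member_le_sum) auto
  finally have "\<bar>a (grid_floor k0 u) - a (grid_floor k0 v)\<bar> \<le> \<eta>" using x by simp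
  then show "\<bar>a u - a v\<bar> \<le> 3 * \<eta> + 2 * r * real CARD('d) * (1 / 4) ^ K"
    using single[OF uv(1)] single[OF uv(2)] by linarith
qed

text \<open>The number of pairs grows exponentially in \<open>k\<close> while the probabilities
  decay doubly exponentially. On the logarithmic scale the terms are eventually below those of a
  geometric series.\<close>

lemma chaining_bound_summable:
  fixes \<eta> D :: real and m :: nat
  assumes "0 < \<eta>"
  shows "summable (\<lambda>k. (4 ^ Suc k + 1) ^ m * (2 * exp (D - \<eta> * (3 / 2) ^ k)))"
proof (rule summable_comparison_test_ev)
  have "\<forall>\<^sub>F k::nat in sequentially. real m * ln (4 ^ Suc k + 1) + (ln 2 + (D - \<eta> * (3 / 2) ^ k)) \<le> real k * ln (1/2)"
    using assms by real_asymp
  then show "\<forall>\<^sub>F k in sequentially. norm ((4 ^ Suc k + 1) ^ m * (2 * exp (D - \<eta> * (3 / 2) ^ k))) \<le> (1 / 2) ^ k"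
  proof eventually_elim
    case (elim k)
    have pos: "(0::real) < 4 ^ Suc k + 1" by (smt (verit) zero_less_power)
    have "(4 ^ Suc k + 1) ^ m * (2 * exp (D - \<eta> * (3 / 2) ^ k)) =
      exp (real m * ln (4 ^ Suc k + 1) + (ln 2 + (D - \<eta> * (3 / 2) ^ k)))"
      using pos by (simp add: exp_add exp_of_nat_mult)
    also have "\<dots> \<le> exp (real k * ln (1/2))" using elim by simp
    also have "\<dots> = (1 / 2) ^ k" by (simp add: exp_of_nat_mult)
    finally show ?case using pos by simp
  qed
qed simp

text \<open>The process is \<open>sqrt n\<close> times a difference of two increasing functions.
  Between \<open>p\<close> and \<open>q\<close> it can leave the range of the endpoint increment
  only by the increase of \<open>C\<close>, which is Lipschitz.\<close>

lemma emp_process_sandwich: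
  fixes C :: "real ^ 'd \<Rightarrow> real"
  assumes C: "copula C" and pq: "p \<in> {0..1}" "q \<in> {0..1}" "p \<le> u" "u \<le> q"
  shows "\<bar>emp_process C n x u - emp_process C n x p\<bar> \<le>
    \<bar>emp_process C n x q - emp_process C n x p\<bar> + sqrt (real n) * (\<Sum>i\<in>UNIV. q $ i - p $ i)"
proof -
  have u: "u \<in> {0..1}" using pq by (auto intro: order_trans)
  have "p \<le> q" using pq by (auto intro: order_trans)
  let ?G = "\<lambda>u. real (card {k. k < n \<and> x k \<le> u}) / real n"
  have G: "?G v \<le> ?G w" if "v \<le> w" for v w
    by (intro divide_right_mono of_nat_mono card_mono) (use that in \<open>auto intro: order_trans\<close>)
  have "C q - C p \<le> (\<Sum>i\<in>UNIV. max 0 (q $ i - p $ i))" by (rule copula_diff_le[OF C pq(2,1)])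
  also have "\<dots> = (\<Sum>i\<in>UNIV. q $ i - p $ i)" using \<open>p \<le> q\<close> by (intro sum.cong) (auto simp: less_eq_vec_def max_def)
  finally have "sqrt (real n) * (C q - C p) \<le> sqrt (real n) * (\<Sum>i\<in>UNIV. q $ i - p $ i)"
    by (intro mult_left_mono) auto
  moreover have "sqrt (real n) * (?G u - C u - (?G p - C p)) \<le> sqrt (real n) * ((?G q - C q - (?G p - C p)) + (C q - C p))"
    using G[OF pq(4)] copula_mono[OF C pq(1) u pq(3)] by (intro mult_left_mono) auto
  moreover have "sqrt (real n) * (- (C q - C p)) \<le> sqrt (real n) * (?G u - C u - (?G p - C p))"
    using G[OF pq(3)] copula_mono[OF C u pq(2) pq(4)] by (intro mult_left_mono) auto
  moreover have D: "emp_process C n x v - emp_process C n x p = sqrt (real n) * (?G v - C v - (?G p - C p))" for v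
    by (simp add: emp_process_def right_diff_distrib)
  moreover have "sqrt (real n) * (?G q - C q - (?G p - C p) + (C q - C p)) =
      sqrt (real n) * (?G q - C q - (?G p - C p)) + sqrt (real n) * (C q - C p)"
    by (rule distrib_left)
  moreover have "sqrt (real n) * (- (C q - C p)) = - (sqrt (real n) * (C q - C p))" by (rule mult_minus_right)
  ultimately show ?thesis unfolding D[of u] D[of q] by linarith
qed

context copula_sample
begin

text \<open>Here \<open>s = 2 ^ k\<close> in the tail bound: the variance term \<open>s\<^sup>2 * 4\<^sup>-\<^sup>k\<close> stays bounded, while
  \<open>s * (3 / 4) ^ k\<close> still grows geometrically.\<close>

lemma grid_increments_prob:
  assumes n: "4 ^ Suc k \<le> n" and \<eta>: "0 < \<eta>"
  shows "prob (\<Union>p\<in>grid (Suc k). \<Union>q\<in>{q\<in>grid (Suc k). \<forall>i. \<bar>p $ i - q $ i\<bar> \<le> (1 / 4) ^ k}.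
      {\<omega>\<in>space M. \<bar>\<alpha> n p \<omega> - \<alpha> n q \<omega>\<bar> > \<eta> * (3 / 4) ^ k})
    \<le> (4 ^ Suc k + 1) ^ (2 * CARD('d)) * (2 * exp (real CARD('d) - \<eta> * (3 / 2) ^ k))"
proof -
  let ?N = "\<lambda>p::real^'d. {q\<in>grid (Suc k). \<forall>i. \<bar>p $ i - q $ i\<bar> \<le> (1 / 4) ^ k}"
  let ?E = "\<lambda>p q. {\<omega>\<in>space M. \<bar>\<alpha> n p \<omega> - \<alpha> n q \<omega>\<bar> > \<eta> * (3 / 4) ^ k}"
  let ?b = "2 * exp (real CARD('d) - \<eta> * (3 / 2) ^ k)"
  let ?c = "card (grid (Suc k) :: (real^'d) set)"
  have s: "0 < (2::real) ^ k" "2 ^ k \<le> sqrt (real n) / 2"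
  proof -
    have "((2::real) ^ Suc k)\<^sup>2 = 4 ^ Suc k" by (simp add: power2_eq_square power_mult_distrib[symmetric])
    also have "\<dots> \<le> real n" using n by (metis of_nat_le_iff of_nat_numeral of_nat_power)
    finally have "(2::real) ^ Suc k \<le> sqrt (real n)" by (rule real_le_rsqrt)
    then show "(2::real) ^ k \<le> sqrt (real n) / 2" by simp
  qed simp
  have E: "prob (?E p q) \<le> ?b" if p: "p \<in> grid (Suc k)" and q: "q \<in> ?N p" for p q
  proof -
    have "(2 ^ k)\<^sup>2 * (\<Sum>i\<in>UNIV. \<bar>p $ i - q $ i\<bar>) \<le> (2 ^ k)\<^sup>2 * (\<Sum>i\<in>(UNIV::'d set). (1 / 4) ^ k)"
      using q by (intro mult_left_mono sum_mono) auto
    also have "\<dots> = real CARD('d)"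
    proof -
      have "((2::real) ^ k)\<^sup>2 = 4 ^ k" by (simp add: power2_eq_square power_mult_distrib[symmetric])
      then show ?thesis by (simp add: power_divide)
    qed
    finally have 1: "(2 ^ k)\<^sup>2 * (\<Sum>i\<in>UNIV. \<bar>p $ i - q $ i\<bar>) \<le> real CARD('d)" .
    have 2: "2 ^ k * (\<eta> * (3 / 4) ^ k) = \<eta> * (3 / 2) ^ k"
      by (simp add: power_mult_distrib[symmetric] mult.left_commute)
    have "prob (?E p q) \<le> 2 * exp ((2 ^ k)\<^sup>2 * (\<Sum>i\<in>UNIV. \<bar>p $ i - q $ i\<bar>) - 2 ^ k * (\<eta> * (3 / 4) ^ k))"
      using q by (intro increment_tail s) (auto intro: grid_subset_cube p simp del: atLeastAtMost_iff)
    also have "\<dots> \<le> ?b" unfolding 2 using 1 by simp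
    finally show ?thesis .
  qed
  have fin: "finite (?N p)" for p by simp
  have meas: "?E p q \<in> sets M" for p q by measurable
  have cN: "card (?N p) \<le> ?c" for p by (intro card_mono) auto
  have "prob (\<Union>p\<in>grid (Suc k). \<Union>q\<in>?N p. ?E p q) \<le> (\<Sum>p\<in>grid (Suc k). prob (\<Union>q\<in>?N p. ?E p q))"
    by (intro measure_UNION_le finite_grid sets.finite_UN fin meas)
  also have "\<dots> \<le> (\<Sum>p\<in>(grid (Suc k) :: (real^'d) set). real ?c * ?b)"
  proof (rule sum_mono)
    fix p :: "real^'d" assume p: "p \<in> grid (Suc k)"
    have "prob (\<Union>q\<in>?N p. ?E p q) \<le> (\<Sum>q\<in>?N p. prob (?E p q))"
      by (intro measure_UNION_le fin meas)
    also have "\<dots> \<le> (\<Sum>q\<in>?N p. ?b)" using E[OF p] by (intro sum_mono) auto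
    also have "\<dots> = real (card (?N p)) * ?b" by simp
    also have "\<dots> \<le> real ?c * ?b" using cN[of p] by (intro mult_right_mono) auto
    finally show "prob (\<Union>q\<in>?N p. ?E p q) \<le> real ?c * ?b" .
  qed
  also have "\<dots> = (real ?c)\<^sup>2 * ?b" by (simp add: power2_eq_square)
  also have "\<dots> \<le> ((4 ^ Suc k + 1) ^ CARD('d))\<^sup>2 * ?b"
  proof (intro mult_right_mono power_mono)
    have "real ?c \<le> real ((4 ^ Suc k + 1) ^ CARD('d))" by (rule of_nat_mono[OF card_grid])
    then show "real ?c \<le> (4 ^ Suc k + 1) ^ CARD('d)" by (simp add: add.commute)
  qed auto
  also have "((4 ^ Suc k + 1) ^ CARD('d))\<^sup>2 = (4 ^ Suc k + 1 :: real) ^ (2 * CARD('d))"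
    by (simp add: power_even_eq)
  finally show ?thesis .
qed

text \<open>The starting level \<open>k0\<close>, and with it \<open>\<delta>\<close>, comes from
  the tail of a series that does not depend on \<open>n\<close>; only the last level
  \<open>K\<close> depends on \<open>n\<close>.\<close>

lemma asymptotic_equicontinuity:
  assumes \<epsilon>: "0 < \<epsilon>" and \<rho>: "0 < \<rho>"
  obtains \<delta> n0 where "0 < \<delta>"
    "\<And>n. n0 \<le> n \<Longrightarrow> \<exists>A\<in>events. 1 - \<rho> \<le> prob A \<and>
       (\<forall>\<omega>\<in>A. generic_sample n (\<lambda>k. U k \<omega>) \<and> cube_modulus (emp_process C n (\<lambda>k. U k \<omega>)) \<delta> \<epsilon>)"
proof -
  \<comment> \<open>Three parts go to the chaining sums and one to the sandwich on the last
    level.\<close>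
  define \<eta> where "\<eta> = \<epsilon> / 4"
  have \<eta>: "0 < \<eta>" "0 < \<eta> / 4" using \<epsilon> by (auto simp: \<eta>_def)
  define d where "d = real CARD('d)"
  have d: "0 < d" by (simp add: d_def)
  \<comment> \<open>The series of powers of 3/4 has sum 4, so the allowances add up to at most
    \<open>\<eta>\<close>.\<close>
  define x where "x k = \<eta> / 4 * (3 / 4) ^ k" for k :: nat
  define b where "b k = (4 ^ Suc k + 1) ^ (2 * CARD('d)) * (2 * exp (d - \<eta> / 4 * (3 / 2) ^ k))" for k
  have b0: "0 \<le> b k" for k by (simp add: b_def)
  have "summable b" unfolding b_def by (rule chaining_bound_summable[OF \<eta>(2)])
  then obtain k0 where k0: "\<And>m n. k0 \<le> m \<Longrightarrow> norm (sum b {m..<n}) < \<rho>"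
    using \<rho> unfolding summable_Cauchy by metis
  \<comment> \<open>Ensures \<open>32 * d / sqrt n <= \<eta>\<close>, the bound for the sandwich
    error obtained below from \<open>(1 / 4) ^ K <= 16 / n\<close>.\<close>
  obtain N :: nat where N: "(32 * d / \<eta>)\<^sup>2 \<le> real N" using real_arch_simple by blast
  obtain Z where Z: "Z \<in> null_sets M" "{\<omega>\<in>space M. \<not> (\<forall>n. generic_sample n (\<lambda>k. U k \<omega>))} \<subseteq> Z"
    using AE_generic unfolding eventually_ae_filter by auto
  show thesis
  proof (rule that[of "(1 / 4) ^ k0" "max N (4 ^ Suc k0)"])
    show "0 < (1 / 4 :: real) ^ k0" by simp
    fix n assume n: "max N (4 ^ Suc k0) \<le> n"
    have n1: "1 \<le> n" using n one_le_power[of "4::nat" "Suc k0"] by linarith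
    obtain j where j: "4 ^ j \<le> n" "n < 4 ^ (j + 1)" using ex_power_ivl1[of 4 n] n1 by auto
    have "(4::nat) ^ Suc k0 < 4 ^ (j + 1)" using n j by linarith
    then have kj: "Suc k0 < j + 1" using power_less_imp_less_exp[of "4::nat" "Suc k0" "j + 1"] by auto
    \<comment> \<open>The finest level with \<open>4 ^ Suc K <= n\<close>, as the tail bound with
      \<open>s = 2 ^ K\<close> requires. Since it is the finest one, \<open>n < 4 ^ (K + 2)\<close>,
      and the mesh is of order \<open>1 / n\<close>.\<close>
    define K where "K = j - 1"
    have K: "k0 \<le> K" "4 ^ Suc K \<le> n" "n < 4 ^ (K + 2)" using kj j by (auto simp: K_def)
    define E where "E k = (\<Union>p\<in>grid (Suc k). \<Union>q\<in>{q\<in>grid (Suc k). \<forall>i. \<bar>p $ i - q $ i\<bar> \<le> (1 / 4) ^ k}.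
      {\<omega>\<in>space M. \<bar>\<alpha> n p \<omega> - \<alpha> n q \<omega>\<bar> > x k})" for k
    have Em: "E k \<in> events" for k
      unfolding E_def by (intro sets.finite_UN finite_grid finite_subset[OF _ finite_grid[of "Suc k"]]) auto
    have PE: "prob (E k) \<le> b k" if "k \<in> {k0..<Suc K}" for k
    proof -
      have "(4::nat) ^ Suc k \<le> 4 ^ Suc K" using that by (intro power_increasing) auto
      then have "4 ^ Suc k \<le> n" using K by linarith
      from grid_increments_prob[OF this \<eta>(2)] show ?thesis unfolding E_def x_def b_def d_def .
    qed
    define Bad where "Bad = (\<Union>k\<in>{k0..<Suc K}. E k) \<union> Z"
    have Bm: "Bad \<in> events" unfolding Bad_def using Em Z by auto
    have "prob Bad \<le> prob (\<Union>k\<in>{k0..<Suc K}. E k) + prob Z"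
      unfolding Bad_def using Em Z by (intro measure_Un_le) auto
    also have "prob Z = 0" using Z by (simp add: measure_eq_0_null_sets)
    also have "prob (\<Union>k\<in>{k0..<Suc K}. E k) \<le> (\<Sum>k\<in>{k0..<Suc K}. prob (E k))"
      using Em by (intro measure_UNION_le) auto
    also have "\<dots> \<le> sum b {k0..<Suc K}" using PE by (rule sum_mono)
    also have "\<dots> \<le> \<rho>" using k0[of k0 "Suc K"] sum_nonneg[of _ b] b0 by (simp add: abs_if split: if_splits)
    finally have PB: "prob Bad \<le> \<rho>" by simp
    show "\<exists>A\<in>events. 1 - \<rho> \<le> prob A \<and>
       (\<forall>\<omega>\<in>A. generic_sample n (\<lambda>k. U k \<omega>) \<and> cube_modulus (emp_process C n (\<lambda>k. U k \<omega>)) ((1 / 4) ^ k0) \<epsilon>)"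
    proof (intro bexI[of _ "space M - Bad"] conjI ballI)
      show "space M - Bad \<in> events" using Bm by auto
      show "1 - \<rho> \<le> prob (space M - Bad)" using prob_compl[OF Bm] PB by simp
      fix \<omega> assume w: "\<omega> \<in> space M - Bad"
      then show "generic_sample n (\<lambda>k. U k \<omega>)" using Z by (auto simp: Bad_def)
      have nE: "\<omega> \<notin> E k" if "k0 \<le> k" "k \<le> K" for k using w that by (auto simp: Bad_def)
      have "cube_modulus (emp_process C n (\<lambda>k. U k \<omega>)) ((1 / 4) ^ k0) (3 * \<eta> + 2 * sqrt (real n) * real CARD('d) * (1 / 4) ^ K)"
      proof (rule chaining[where x=x])
        fix k and p q :: "real^'d" assume k: "k0 \<le> k" "k \<le> K" and pq: "p \<in> grid (Suc k)" "q \<in> grid (Suc k)"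
          "\<And>i. \<bar>p $ i - q $ i\<bar> \<le> (1 / 4) ^ k"
        show "\<bar>emp_process C n (\<lambda>k. U k \<omega>) p - emp_process C n (\<lambda>k. U k \<omega>) q\<bar> \<le> x k"
          using nE[OF k] w pq unfolding E_def \<alpha>_def by (auto simp: not_less)
      next
        have "(\<Sum>k=k0..K. x k) \<le> (\<Sum>k<Suc K. x k)"
          using \<eta> by (intro sum_mono2) (auto simp: x_def)
        also have "\<dots> = \<eta> / 4 * (\<Sum>k<Suc K. (3 / 4) ^ k)" unfolding x_def sum_distrib_left ..
        also have "(\<Sum>k<Suc K. (3 / 4 :: real) ^ k) = 4 * (1 - (3 / 4) ^ Suc K)"
          by (subst sum_gp_strict) (auto simp: field_simps)
        also have "\<eta> / 4 * (4 * (1 - (3 / 4) ^ Suc K)) \<le> \<eta> / 4 * 4" using \<eta> by (intro mult_left_mono) auto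
        finally show "(\<Sum>k=k0..K. x k) \<le> \<eta>" by simp
      qed (use \<eta> K(1) emp_process_sandwich[OF copula] in \<open>auto simp: x_def\<close>)
      moreover have "2 * sqrt (real n) * real CARD('d) * (1 / 4) ^ K \<le> \<eta>"
      proof -
        have q: "sqrt (real n) > 0" using n1 by simp
        have "real n < 4 ^ (K + 2)" using K(3) by (metis of_nat_less_iff of_nat_numeral of_nat_power)
        then have "(1 / 4) ^ K \<le> 16 / real n" using n1 by (simp add: power_divide field_simps)
        then have "2 * sqrt (real n) * d * (1 / 4) ^ K \<le> 2 * sqrt (real n) * d * (16 / real n)"
          using d by (intro mult_left_mono) auto
        also have "\<dots> = 32 * d * (sqrt (real n) / real n)" by simp
        also have "\<dots> = 32 * d / sqrt (real n)" by (simp add: sqrt_divide_self_eq inverse_eq_divide)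
        also have "\<dots> \<le> \<eta>"
        proof -
          have "(32 * d / \<eta>)\<^sup>2 \<le> real n" using N n by linarith
          then have "32 * d / \<eta> \<le> sqrt (real n)" by (rule real_le_rsqrt)
          then show ?thesis using q \<eta> by (simp add: field_simps)
        qed
        finally show ?thesis by (simp add: d_def)
      qed
      ultimately show "cube_modulus (emp_process C n (\<lambda>k. U k \<omega>)) ((1 / 4) ^ k0) \<epsilon>"
        using \<eta>_def unfolding cube_modulus_def by fastforce
    qed
  qed
qed

end

section \<open>Gaussian limits\<close>

text \<open>The case \<open>\<sigma> = 0\<close> does occur: a bridge is degenerate at points where
  \<open>C\<close> is 0 or 1.\<close>

lemma normal_law_props:
  assumes "prob_space N" and X[measurable]: "X \<in> borel_measurable N"
    and d: "distr N borel X = normal_law m \<sigma>" and \<sigma>: "0 \<le> \<sigma>"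
  shows "integrable N X" "integral\<^sup>L N X = m"
    "m = 0 \<Longrightarrow> integrable N (\<lambda>\<omega>. (X \<omega>)\<^sup>2)" "m = 0 \<Longrightarrow> integral\<^sup>L N (\<lambda>\<omega>. (X \<omega>)\<^sup>2) = \<sigma>\<^sup>2"
    "m = 0 \<Longrightarrow> char (distr N borel X) 1 = exp (- \<sigma>\<^sup>2 / 2)"
proof -
  have tr: "integrable N (\<lambda>\<omega>. g (X \<omega>)) = integrable (normal_law m \<sigma>) g"
    "integral\<^sup>L N (\<lambda>\<omega>. g (X \<omega>)) = integral\<^sup>L (normal_law m \<sigma>) g"
    if "g \<in> borel_measurable borel" for g :: "real \<Rightarrow> real"
    using that by (simp_all add: integrable_distr_eq integral_distr flip: d)
  have "integrable N X \<and> integral\<^sup>L N X = m \<and> (m = 0 \<longrightarrow> integrable N (\<lambda>\<omega>. (X \<omega>)\<^sup>2)) \<and>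
      (m = 0 \<longrightarrow> integral\<^sup>L N (\<lambda>\<omega>. (X \<omega>)\<^sup>2) = \<sigma>\<^sup>2) \<and> (m = 0 \<longrightarrow> char (distr N borel X) 1 = exp (- \<sigma>\<^sup>2 / 2))"
  proof (cases "\<sigma> = 0")
    case True
    then have L: "normal_law m \<sigma> = return borel m" by (simp add: normal_law_def)
    have i: "integrable (return borel m) g" "integral\<^sup>L (return borel m) g = g m"
      if "g \<in> borel_measurable borel" for g :: "real \<Rightarrow> real"
      using that by (auto simp: integral_return integrable_iff_bounded nn_integral_return)
    have "char (return borel m) 1 = iexp m" by (simp add: char_def integral_return)
    then show ?thesis
      using tr(1,2)[of "\<lambda>x. x", unfolded L] tr(1,2)[of "\<lambda>x. x\<^sup>2", unfolded L] d[unfolded L]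
      by (auto simp add: i True)
  next
    case False
    then have s: "0 < \<sigma>" using \<sigma> by simp
    have L: "normal_law m \<sigma> = density lborel (normal_density m \<sigma>)" using False by (simp add: normal_law_def)
    have i: "integrable (density lborel (normal_density m \<sigma>)) g \<longleftrightarrow> integrable lborel (\<lambda>x. normal_density m \<sigma> x * g x)"
      "integral\<^sup>L (density lborel (normal_density m \<sigma>)) g = integral\<^sup>L lborel (\<lambda>x. normal_density m \<sigma> x * g x)"
      if "g \<in> borel_measurable borel" for g :: "real \<Rightarrow> real"
      using that by (auto simp: integrable_density integral_density)
    have c: "char (density lborel (normal_density 0 \<sigma>)) 1 = exp (- \<sigma>\<^sup>2 / 2)"
    proof -
      interpret S: prob_space std_normal_distribution by (rule prob_space_normal_density) simp
      have "distributed std_normal_distribution lborel (\<lambda>x. x) std_normal_density"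
        by (auto simp: distributed_def distr_id2)
      from S.normal_density_affine[OF this, of \<sigma> 0] s
      have "distr std_normal_distribution lborel (\<lambda>x. \<sigma> * x) = density lborel (normal_density 0 \<sigma>)"
        by (simp add: distributed_def)
      from this[symmetric] have "char (density lborel (normal_density 0 \<sigma>)) 1 = char std_normal_distribution \<sigma>"
        by (simp add: char_def integral_distr)
      then show ?thesis by (simp add: char_std_normal_distribution)
    qed
    have T: "integrable N (\<lambda>\<omega>. g (X \<omega>)) \<longleftrightarrow> integrable lborel (\<lambda>x. normal_density m \<sigma> x * g x)"
      "integral\<^sup>L N (\<lambda>\<omega>. g (X \<omega>)) = integral\<^sup>L lborel (\<lambda>x. normal_density m \<sigma> x * g x)"
      if "g \<in> borel_measurable borel" for g :: "real \<Rightarrow> real"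
      unfolding tr[OF that] L by (rule i[OF that])+
    have id: "(\<lambda>x::real. x) \<in> borel_measurable borel" and sq: "(\<lambda>x::real. x\<^sup>2) \<in> borel_measurable borel"
      by measurable
    have "integrable N X" "integral\<^sup>L N X = m"
      unfolding T[OF id] using s by (rule integrable_normal_moment_nz_1 integral_normal_moment_nz_1)+
    moreover have "integrable N (\<lambda>\<omega>. (X \<omega>)\<^sup>2)" if "m = 0"
      unfolding T[OF sq] using integrable_normal_moment[OF s, of 0 2] that by simp
    moreover have "integral\<^sup>L N (\<lambda>\<omega>. (X \<omega>)\<^sup>2) = \<sigma>\<^sup>2" if "m = 0"
      unfolding T[OF sq] using integral_normal_moment_even[OF s, of 0 1] that by (simp add: fact_2)
    moreover have "char (distr N borel X) 1 = exp (- \<sigma>\<^sup>2 / 2)" if "m = 0"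
      using c that unfolding d L by simp
    ultimately show ?thesis by blast
  qed
  then show "integrable N X" "integral\<^sup>L N X = m"
    "m = 0 \<Longrightarrow> integrable N (\<lambda>\<omega>. (X \<omega>)\<^sup>2)" "m = 0 \<Longrightarrow> integral\<^sup>L N (\<lambda>\<omega>. (X \<omega>)\<^sup>2) = \<sigma>\<^sup>2"
    "m = 0 \<Longrightarrow> char (distr N borel X) 1 = exp (- \<sigma>\<^sup>2 / 2)"
    by blast+
qed

text \<open>A linear combination is normal by definition of the process, with unspecified
  parameters. The mean and covariance conditions identify them, and hence the characteristic
  function.\<close>

lemma bridge_linear_combination:
  fixes C :: "real ^ 'd \<Rightarrow> real"
  assumes N: "prob_space N" and B: "copula_bridge N C B"
  shows "u \<in> {0..1} \<Longrightarrow> B u \<in> borel_measurable N"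
    and "u \<in> {0..1} \<Longrightarrow> integrable N (\<lambda>\<omega>. (B u \<omega>)\<^sup>2)"
    and "u \<in> {0..1} \<Longrightarrow> integral\<^sup>L N (\<lambda>\<omega>. (B u \<omega>)\<^sup>2) = C u - C u * C u"
    and "finite S \<Longrightarrow> S \<subseteq> {0..1} \<Longrightarrow> char (distr N borel (\<lambda>\<omega>. \<Sum>u\<in>S. a u * B u \<omega>)) 1 =
      exp (- (\<Sum>u\<in>S. \<Sum>w\<in>S. a u * a w * (C (inf u w) - C u * C w)) / 2)"
proof -
  note B' = B[unfolded copula_bridge_def gaussian_process_def]
  have cov: "integral\<^sup>L N (\<lambda>\<omega>. B u \<omega> * B w \<omega>) = C (inf u w) - C u * C w" if "u \<in> {0..1}" "w \<in> {0..1}" for u w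
    using B' that by blast
  show m: "u \<in> {0..1} \<Longrightarrow> B u \<in> borel_measurable N" for u using B' by blast
  \<comment> \<open>Integrability is derived from the normal law first: the integral of a
    nonintegrable function is 0 by default, so the mean condition alone would not give it.\<close>
  have one: "integrable N (B u) \<and> integrable N (\<lambda>\<omega>. (B u \<omega>)\<^sup>2)" if u: "u \<in> {0..1}" for u
  proof -
    have "\<exists>m \<sigma>. 0 \<le> \<sigma> \<and> distr N borel (\<lambda>\<omega>. \<Sum>w\<in>{u}. (\<lambda>_. 1) w * B w \<omega>) = normal_law m \<sigma>"
      using B' u by (meson finite.emptyI finite.insertI empty_subsetI insert_subset)
    then obtain m' \<sigma> where *: "0 \<le> \<sigma>" "distr N borel (B u) = normal_law m' \<sigma>" by auto
    have "integral\<^sup>L N (B u) = 0" using B' u by blast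
    then have "m' = 0" using normal_law_props(2)[OF N m[OF u] *(2,1)] by simp
    then show ?thesis using normal_law_props(1,3)[OF N m[OF u] *(2,1)] by simp
  qed
  then show "integrable N (\<lambda>\<omega>. (B u \<omega>)\<^sup>2)" if "u \<in> {0..1}" using that by blast
  show "integral\<^sup>L N (\<lambda>\<omega>. (B u \<omega>)\<^sup>2) = C u - C u * C u" if "u \<in> {0..1}"
    using cov[OF that that] by (simp add: power2_eq_square)
  show "char (distr N borel (\<lambda>\<omega>. \<Sum>u\<in>S. a u * B u \<omega>)) 1 =
      exp (- (\<Sum>u\<in>S. \<Sum>w\<in>S. a u * a w * (C (inf u w) - C u * C w)) / 2)" if S: "finite S" "S \<subseteq> {0..1}"
  proof -
    let ?L = "\<lambda>\<omega>. \<Sum>u\<in>S. a u * B u \<omega>"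
    obtain m' \<sigma> where *: "0 \<le> \<sigma>" "distr N borel ?L = normal_law m' \<sigma>" using B' S by blast
    have Lm: "?L \<in> borel_measurable N" using m S by (intro borel_measurable_sum borel_measurable_times borel_measurable_const) blast
    note pr = normal_law_props[OF N Lm *(2,1)]
    have "integral\<^sup>L N ?L = (\<Sum>u\<in>S. a u * integral\<^sup>L N (B u))"
      using one S by (subst Bochner_Integration.integral_sum) (simp_all add: subset_iff del: atLeastAtMost_iff)
    also have "\<dots> = 0"
    proof (rule sum.neutral, rule ballI)
      fix u assume "u \<in> S"
      then have "integral\<^sup>L N (B u) = 0" using B' S by blast
      then show "a u * integral\<^sup>L N (B u) = 0" by simp
    qed
    finally have m0: "m' = 0" using pr(2) by simp
    have prod: "integrable N (\<lambda>\<omega>. B u \<omega> * B w \<omega>)" if "u \<in> S" "w \<in> S" for u w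
    proof (rule Bochner_Integration.integrable_bound)
      show "integrable N (\<lambda>\<omega>. (B u \<omega>)\<^sup>2 + (B w \<omega>)\<^sup>2)" using one that S by (intro Bochner_Integration.integrable_add) blast+
      show "(\<lambda>\<omega>. B u \<omega> * B w \<omega>) \<in> borel_measurable N" using m that S by (intro borel_measurable_times) blast+
      have "\<bar>x * y\<bar> \<le> x\<^sup>2 + y\<^sup>2" for x y :: real
      proof -
        have "2 * (\<bar>x\<bar> * \<bar>y\<bar>) \<le> x\<^sup>2 + y\<^sup>2" using sum_squares_bound[of "\<bar>x\<bar>" "\<bar>y\<bar>"] by (simp add: mult.assoc)
        moreover have "0 \<le> \<bar>x\<bar> * \<bar>y\<bar>" by simp
        ultimately show ?thesis unfolding abs_mult by linarith
      qed
      then show "AE \<omega> in N. norm (B u \<omega> * B w \<omega>) \<le> norm ((B u \<omega>)\<^sup>2 + (B w \<omega>)\<^sup>2)" by simp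
    qed
    have "\<sigma>\<^sup>2 = integral\<^sup>L N (\<lambda>\<omega>. (?L \<omega>)\<^sup>2)" using pr(4) m0 by simp
    also have "\<dots> = integral\<^sup>L N (\<lambda>\<omega>. \<Sum>u\<in>S. \<Sum>w\<in>S. a u * a w * (B u \<omega> * B w \<omega>))"
      by (intro Bochner_Integration.integral_cong) (auto simp: power2_eq_square sum_product algebra_simps)
    also have "\<dots> = (\<Sum>u\<in>S. \<Sum>w\<in>S. a u * a w * integral\<^sup>L N (\<lambda>\<omega>. B u \<omega> * B w \<omega>))"
      using prod by simp
    also have "\<dots> = (\<Sum>u\<in>S. \<Sum>w\<in>S. a u * a w * (C (inf u w) - C u * C w))"
      using S cov by (intro sum.cong refl arg_cong2[where f="(*)"]) blast
    finally show ?thesis using pr(5) m0 by simp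
  qed
qed

context copula_sample
begin

text \<open>Distinct summands are uncorrelated, so the bound is uniform in \<open>n\<close>, as the
  truncation in \<open>cramer_wold_expectation\<close> requires.\<close>

lemma \<alpha>_second_moment:
  assumes u: "u \<in> {0..1}"
  shows "integrable M (\<lambda>\<omega>. (\<alpha> n u \<omega>)\<^sup>2)" "expectation (\<lambda>\<omega>. (\<alpha> n u \<omega>)\<^sup>2) \<le> 1"
proof -
  have bd: "\<bar>\<alpha> n u \<omega>\<bar> \<le> real n" for \<omega>
  proof (cases "n = 0")
    case True then show ?thesis by (simp add: \<alpha>_eq)
  next
    case False
    have "\<bar>\<Sum>k<n. \<xi> k u \<omega>\<bar> \<le> (\<Sum>k<n. 1)"
      by (rule order_trans[OF sum_abs]) (intro sum_mono \<xi>_bound u)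
    then have "\<bar>\<alpha> n u \<omega>\<bar> \<le> real n / sqrt (real n)" by (simp add: \<alpha>_eq divide_right_mono)
    also have "\<dots> = sqrt (real n)" by (simp add: real_div_sqrt)
    also have "\<dots> \<le> sqrt (real n) * sqrt (real n)" using False mult_right_mono[of 1 "sqrt (real n)" "sqrt (real n)"] by simp
    also have "\<dots> = real n" by simp
    finally show ?thesis .
  qed
  show int: "integrable M (\<lambda>\<omega>. (\<alpha> n u \<omega>)\<^sup>2)"
    by (rule integrable_const_bound[where B="(real n)\<^sup>2"]) (use bd in \<open>auto simp: abs_le_square_iff[symmetric]\<close>)
  have uncor: "expectation (\<lambda>\<omega>. \<xi> j u \<omega> * \<xi> k u \<omega>) = 0 \<and> integrable M (\<lambda>\<omega>. \<xi> j u \<omega> * \<xi> k u \<omega>)" if "j \<noteq> k" for j k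
  proof -
    have "indep_vars (\<lambda>_. borel) (\<lambda>k. \<xi> k u) UNIV"
      unfolding \<xi>_def by (rule indep_functional[of "\<lambda>y. indicator {..u} y - C u"]) measurable
    then have iv: "indep_vars (\<lambda>_. borel) (\<lambda>k. \<xi> k u) {j, k}" by (rule indep_vars_subset) auto
    have "expectation (\<lambda>\<omega>. \<Prod>l\<in>{j,k}. \<xi> l u \<omega>) = (\<Prod>l\<in>{j,k}. expectation (\<xi> l u))"
      by (rule indep_vars_lebesgue_integral[OF _ iv]) (auto intro: \<xi>_integrable)
    moreover have "integrable M (\<lambda>\<omega>. \<Prod>l\<in>{j,k}. \<xi> l u \<omega>)"
      by (rule indep_vars_integrable[OF _ iv]) (auto intro: \<xi>_integrable)
    ultimately show ?thesis using that \<xi>_mean[OF u] by simp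
  qed
  have i2: "integrable M (\<lambda>\<omega>. \<xi> j u \<omega> * \<xi> k u \<omega>)" for j k
    using uncor[of j k] \<xi>_mult_integrable[OF u u, of k] by (cases "j = k") auto
  have e2: "expectation (\<lambda>\<omega>. \<xi> j u \<omega> * \<xi> k u \<omega>) = (if j = k then C u - C u * C u else 0)" for j k
    using uncor[of j k] \<xi>_covariance[OF u u, of k] by auto
  show "expectation (\<lambda>\<omega>. (\<alpha> n u \<omega>)\<^sup>2) \<le> 1"
  proof (cases "n = 0")
    case False
    have "(\<alpha> n u \<omega>)\<^sup>2 = (\<Sum>j<n. \<Sum>k<n. \<xi> j u \<omega> * \<xi> k u \<omega>) / real n" for \<omega>
      by (simp add: \<alpha>_eq power_divide power2_eq_square[of "sum _ _"] sum_product)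
    then have "expectation (\<lambda>\<omega>. (\<alpha> n u \<omega>)\<^sup>2) = (\<Sum>j<n. \<Sum>k<n. expectation (\<lambda>\<omega>. \<xi> j u \<omega> * \<xi> k u \<omega>)) / real n"
      using i2 by simp
    also have "\<dots> = C u - C u * C u" using False by (simp add: e2)
    also have "\<dots> \<le> 1" using copula_range[OF copula u] by simp (smt (verit) mult_nonneg_nonneg)
    finally show ?thesis .
  qed (simp add: \<alpha>_eq)
qed

text \<open>A linear combination of values of \<open>\<alpha> n\<close> is itself a normalized sum
  of independent centered variables, and \<open>V\<close> is the variance of one summand.\<close>

lemma char_linear_combination:
  assumes S: "finite S" "S \<subseteq> {0..1}"
  shows "(\<lambda>n. char (distr M borel (\<lambda>\<omega>. \<Sum>u\<in>S. a u * \<alpha> n u \<omega>)) 1) \<longlonglongrightarrow>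
    exp (- (\<Sum>u\<in>S. \<Sum>w\<in>S. a u * a w * (C (inf u w) - C u * C w)) / 2)"
proof -
  define f where "f y = (\<Sum>u\<in>S. a u * (indicator {..u} y - C u))" for y
  have f[measurable]: "f \<in> borel_measurable borel" unfolding f_def by measurable
  define X where "X k \<omega> = f (U k \<omega>)" for k \<omega>
  have X[measurable]: "X k \<in> borel_measurable M" for k unfolding X_def by measurable
  have X\<xi>: "X k \<omega> = (\<Sum>u\<in>S. a u * \<xi> k u \<omega>)" for k \<omega> by (simp add: X_def f_def \<xi>_def)
  define V where "V = (\<Sum>u\<in>S. \<Sum>w\<in>S. a u * a w * (C (inf u w) - C u * C w))"
  have sum_X: "(\<Sum>u\<in>S. a u * \<alpha> n u \<omega>) = (\<Sum>k<n. X k \<omega>) / sqrt (real n)" for n \<omega>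
  proof -
    have "(\<Sum>u\<in>S. a u * \<alpha> n u \<omega>) = (\<Sum>u\<in>S. \<Sum>k<n. a u * \<xi> k u \<omega>) / sqrt (real n)"
      by (simp add: \<alpha>_eq sum_distrib_left sum_divide_distrib)
    also have "(\<Sum>u\<in>S. \<Sum>k<n. a u * \<xi> k u \<omega>) = (\<Sum>k<n. X k \<omega>)" unfolding X\<xi> by (rule sum.swap)
    finally show ?thesis .
  qed
  have indX: "indep_vars (\<lambda>_. borel) X UNIV" unfolding X_def by (rule indep_functional[OF f])
  have mean: "expectation (X k) = 0" for k
  proof -
    have "expectation (X k) = (\<Sum>u\<in>S. a u * expectation (\<xi> k u))"
      unfolding X\<xi> using \<xi>_integrable by simp
    also have "\<dots> = 0" using \<xi>_mean S by (intro sum.neutral) auto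
    finally show ?thesis .
  qed
  have sqX: "(X k \<omega>)\<^sup>2 = (\<Sum>u\<in>S. \<Sum>w\<in>S. a u * a w * (\<xi> k u \<omega> * \<xi> k w \<omega>))" for k \<omega>
    unfolding X\<xi> by (simp add: power2_eq_square sum_product algebra_simps)
  have int2: "integrable M (\<lambda>\<omega>. (X k \<omega>)\<^sup>2)" for k
    unfolding sqX using S
    by (intro Bochner_Integration.integrable_sum integrable_mult_right \<xi>_mult_integrable) (auto simp del: atLeastAtMost_iff)
  have E2: "expectation (\<lambda>\<omega>. (X k \<omega>)\<^sup>2) = V" for k
  proof -
    have i: "integrable M (\<lambda>\<omega>. \<xi> k u \<omega> * \<xi> k w \<omega>)" if "u \<in> S" "w \<in> S" for u w
      using \<xi>_mult_integrable that S(2) by blast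
    have "expectation (\<lambda>\<omega>. (X k \<omega>)\<^sup>2) = (\<Sum>u\<in>S. \<Sum>w\<in>S. a u * a w * expectation (\<lambda>\<omega>. \<xi> k u \<omega> * \<xi> k w \<omega>))"
      unfolding sqX using i by simp
    also have "\<dots> = V" unfolding V_def by (intro sum.cong refl) (use S \<xi>_covariance in \<open>simp add: subset_iff del: atLeastAtMost_iff\<close>)
    finally show ?thesis .
  qed
  have V0: "0 \<le> V" unfolding E2[of 0, symmetric] by (rule integral_nonneg_AE) auto
  show ?thesis unfolding V_def[symmetric] sum_X
  proof (cases "V = 0")
    \<comment> \<open>The central limit theorem divides by the standard deviation; for variance 0
      the summands vanish almost surely instead.\<close>
    case True
    have "AE \<omega> in M. (X k \<omega>)\<^sup>2 = 0" for k
      using integral_nonneg_eq_0_iff_AE[OF int2[of k]] E2[of k] True by simp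
    then have ae: "AE \<omega> in M. \<forall>k. X k \<omega> = 0" by (simp add: AE_all_countable)
    have "char (distr M borel (\<lambda>\<omega>. (\<Sum>k<n. X k \<omega>) / sqrt (real n))) 1 = 1" for n
    proof -
      have "char (distr M borel (\<lambda>\<omega>. (\<Sum>k<n. X k \<omega>) / sqrt (real n))) 1 =
        (CLINT \<omega>|M. iexp ((\<Sum>k<n. X k \<omega>) / sqrt (real n)))"
        by (simp add: char_def integral_distr)
      also have "\<dots> = (CLINT \<omega>|M. 1)"
        by (rule integral_cong_AE) (use ae in \<open>auto elim!: eventually_mono\<close>)
      finally show ?thesis by (simp add: prob_space)
    qed
    then show "(\<lambda>n. char (distr M borel (\<lambda>\<omega>. (\<Sum>k<n. X k \<omega>) / sqrt (real n))) 1) \<longlonglongrightarrow> exp (- V / 2)"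
      using True by simp
  next
    case False
    define \<sigma> where "\<sigma> = sqrt V"
    have \<sigma>: "0 < \<sigma>" "\<sigma>\<^sup>2 = V" using False V0 by (auto simp: \<sigma>_def)
    have dX: "distr M borel (X k) = distr \<nu> borel f" for k
      unfolding X_def[abs_def] law[of k, symmetric] by (subst distr_distr) (auto simp: comp_def)
    have "weak_conv_m (\<lambda>n. distr M borel (\<lambda>\<omega>. (\<Sum>k<n. X k \<omega>) / sqrt (real n * \<sigma>\<^sup>2))) std_normal_distribution"
      using mean E2 \<sigma> int2 dX by (intro central_limit_theorem_zero_mean[OF indX]) auto
    \<comment> \<open>Evaluating at \<open>\<sigma>\<close> undoes the division by
      \<open>\<sigma>\<close>, so only the factor \<open>1 / sqrt n\<close> remains at argument
      1.\<close>
    then have "(\<lambda>n. char (distr M borel (\<lambda>\<omega>. (\<Sum>k<n. X k \<omega>) / sqrt (real n * \<sigma>\<^sup>2))) \<sigma>) \<longlonglongrightarrow> char std_normal_distribution \<sigma>"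
      by (intro levy_continuity1 real_dist_normal_dist real_distribution_distr) auto
    moreover have "char (distr M borel (\<lambda>\<omega>. (\<Sum>k<n. X k \<omega>) / sqrt (real n * \<sigma>\<^sup>2))) \<sigma> =
      char (distr M borel (\<lambda>\<omega>. (\<Sum>k<n. X k \<omega>) / sqrt (real n))) 1" for n
      using \<sigma>(1) by (simp add: char_def integral_distr real_sqrt_mult)
    ultimately show "(\<lambda>n. char (distr M borel (\<lambda>\<omega>. (\<Sum>k<n. X k \<omega>) / sqrt (real n))) 1) \<longlonglongrightarrow> exp (- V / 2)"
      by (simp add: char_std_normal_distribution \<sigma>(2))
  qed
qed

end

section \<open>Convergence of the statistic\<close>

lemma iexp_lipschitz: "cmod (iexp x - iexp y) \<le> \<bar>x - y\<bar>" for x y :: real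
proof -
  have "iexp x = iexp y * iexp (x - y)" by (simp add: exp_add[symmetric] algebra_simps)
  then have "iexp x - iexp y = iexp y * (iexp (x - y) - 1)" by (simp add: algebra_simps)
  then have "cmod (iexp x - iexp y) = cmod (iexp (x - y) - 1)" by (simp add: norm_mult)
  also have "\<dots> \<le> \<bar>x - y\<bar>" using iexp_approx1[of "x - y" 0] by simp
  finally show ?thesis .
qed

text \<open>On \<open>A\<close> the exponentials differ by at most
  \<open>\<bar>t\<bar> * \<epsilon>\<close>; elsewhere they differ by at most 2, on a set of
  probability at most \<open>\<epsilon>\<close>.\<close>

lemma char_diff_le:
  assumes M: "prob_space M" and [measurable]: "X \<in> borel_measurable M" "Y \<in> borel_measurable M" "A \<in> sets M"
    and A: "1 - \<epsilon> \<le> measure M A" "\<And>\<omega>. \<omega> \<in> A \<Longrightarrow> \<bar>X \<omega> - Y \<omega>\<bar> \<le> \<epsilon>"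
  shows "cmod (char (distr M borel X) t - char (distr M borel Y) t) \<le> (\<bar>t\<bar> + 2) * \<epsilon>"
proof -
  interpret prob_space M by fact
  have int: "complex_integrable M (\<lambda>\<omega>. iexp (t * W \<omega>))" if [measurable]: "W \<in> borel_measurable M" for W
    by (rule integrable_const_bound[where B=1]) auto
  have A0: "A \<noteq> {} \<Longrightarrow> 0 \<le> \<epsilon>" using A(2) abs_ge_zero order_trans by blast
  have pt: "cmod (iexp (t * X \<omega>) - iexp (t * Y \<omega>)) \<le> \<bar>t\<bar> * \<epsilon> * indicator A \<omega> + 2 * indicator (space M - A) \<omega>"
    if w: "\<omega> \<in> space M" for \<omega>
  proof (cases "\<omega> \<in> A")
    case True
    have "cmod (iexp (t * X \<omega>) - iexp (t * Y \<omega>)) \<le> \<bar>t * X \<omega> - t * Y \<omega>\<bar>" by (rule iexp_lipschitz)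
    also have "\<dots> = \<bar>t\<bar> * \<bar>X \<omega> - Y \<omega>\<bar>" by (simp add: abs_mult flip: right_diff_distrib)
    also have "\<dots> \<le> \<bar>t\<bar> * \<epsilon>" by (intro mult_left_mono A(2) True) simp
    finally show ?thesis using True by simp
  next
    case False
    have "cmod (iexp (t * X \<omega>) - iexp (t * Y \<omega>)) \<le> cmod (iexp (t * X \<omega>)) + cmod (iexp (t * Y \<omega>))"
      by (rule norm_triangle_ineq4)
    then show ?thesis using False w by simp
  qed
  have "char (distr M borel X) t - char (distr M borel Y) t = (CLINT \<omega>|M. iexp (t * X \<omega>) - iexp (t * Y \<omega>))"
    using int by (simp add: char_def integral_distr)
  also have "cmod \<dots> \<le> (LINT \<omega>|M. cmod (iexp (t * X \<omega>) - iexp (t * Y \<omega>)))"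
    by (rule integral_norm_bound)
  also have "\<dots> \<le> (LINT \<omega>|M. \<bar>t\<bar> * \<epsilon> * indicator A \<omega> + 2 * indicator (space M - A) \<omega>)"
    by (intro integral_mono pt integrable_norm Bochner_Integration.integrable_diff int
          Bochner_Integration.integrable_add integrable_mult_right)
      (auto simp: emeasure_eq_measure less_top[symmetric])
  also have "\<dots> = \<bar>t\<bar> * \<epsilon> * prob A + 2 * prob (space M - A)"
    by (simp add: emeasure_eq_measure less_top[symmetric])
  also have "\<dots> \<le> \<bar>t\<bar> * \<epsilon> + 2 * \<epsilon>"
  proof -
    have "prob (space M - A) \<le> \<epsilon>" using A(1) by (simp add: prob_compl)
    moreover have "\<bar>t\<bar> * \<epsilon> * prob A \<le> \<bar>t\<bar> * \<epsilon>"
    proof -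
      have "0 \<le> \<epsilon>" using \<open>prob (space M - A) \<le> \<epsilon>\<close> measure_nonneg[of M "space M - A"] by linarith
      then show ?thesis by (simp add: mult_left_le)
    qed
    ultimately show ?thesis by simp
  qed
  finally show ?thesis by (simp add: algebra_simps)
qed

text \<open>The usual interchange of limits: \<open>W m n\<close> tends to \<open>V m\<close> in law
  as \<open>n\<close> grows, \<open>V m\<close> tends to \<open>Z\<close> as \<open>m\<close> grows,
  and \<open>W m n\<close> is close to \<open>T n\<close> in probability. The interchange takes
  place in the characteristic functions, for each \<open>t\<close> separately.\<close>

lemma converges_in_distribution_approx:
  assumes M: "prob_space M" and N: "prob_space N"
    and T[measurable]: "\<And>n. T n \<in> borel_measurable M" and Z[measurable]: "Z \<in> borel_measurable N"
    and W[measurable]: "\<And>m n. W m n \<in> borel_measurable M" and V[measurable]: "\<And>m. V m \<in> borel_measurable N"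
    and char: "\<And>m t. (\<lambda>n. char (distr M borel (W m n)) t) \<longlonglongrightarrow> char (distr N borel (V m)) t"
    and VZ: "AE \<omega> in N. (\<lambda>m. V m \<omega>) \<longlonglongrightarrow> Z \<omega>"
    and appr: "\<And>\<epsilon>. 0 < \<epsilon> \<Longrightarrow> \<forall>\<^sub>F m in sequentially. \<forall>\<^sub>F n in sequentially.
       \<exists>A\<in>sets M. 1 - \<epsilon> \<le> measure M A \<and> (\<forall>\<omega>\<in>A. \<bar>T n \<omega> - W m n \<omega>\<bar> \<le> \<epsilon>)"
  shows "converges_in_distribution M T N Z"
  unfolding converges_in_distribution_def
proof (intro conjI allI T Z levy_continuity)
  interpret M: prob_space M by fact
  interpret N: prob_space N by fact
  show "real_distribution (distr M borel (T n))" for n by (rule M.real_distribution_distr) measurable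
  show "real_distribution (distr N borel Z)" by (rule N.real_distribution_distr) measurable
  fix t
  have VZc: "(\<lambda>m. char (distr N borel (V m)) t) \<longlonglongrightarrow> char (distr N borel Z) t"
  proof -
    have "(\<lambda>m. CLINT \<omega>|N. iexp (t * V m \<omega>)) \<longlonglongrightarrow> (CLINT \<omega>|N. iexp (t * Z \<omega>))"
    proof (rule integral_dominated_convergence[where w="\<lambda>_. 1"])
      show "AE \<omega> in N. (\<lambda>m. iexp (t * V m \<omega>)) \<longlonglongrightarrow> iexp (t * Z \<omega>)"
        using VZ by eventually_elim (intro tendsto_intros)
    qed auto
    then show ?thesis by (simp add: char_def integral_distr)
  qed
  show "(\<lambda>n. char (distr M borel (T n)) t) \<longlonglongrightarrow> char (distr N borel Z) t"
  proof (rule LIMSEQ_I)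
    fix r :: real assume r: "0 < r"
    define c where "c = \<bar>t\<bar> + 2"
    have c: "0 < c" unfolding c_def by linarith
    \<comment> \<open>Each of the three differences between the characteristic functions of
      \<open>T n\<close>, \<open>W m n\<close>, \<open>V m\<close> and \<open>Z\<close> gets a third
      of \<open>r\<close>.\<close>
    define \<epsilon> where "\<epsilon> = r / (3 * c)"
    have \<epsilon>: "0 < \<epsilon>" "(\<bar>t\<bar> + 2) * \<epsilon> = r / 3"
      unfolding \<epsilon>_def c_def[symmetric] using r c by auto
    have r3: "0 < r / 3" using r by simp
    have "\<forall>\<^sub>F m in sequentially. dist (char (distr N borel (V m)) t) (char (distr N borel Z) t) < r / 3"
      using tendstoD[OF VZc r3] .
    then obtain m where m: "dist (char (distr N borel (V m)) t) (char (distr N borel Z) t) < r / 3"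
      and ev: "\<forall>\<^sub>F n in sequentially. \<exists>A\<in>sets M. 1 - \<epsilon> \<le> measure M A \<and> (\<forall>\<omega>\<in>A. \<bar>T n \<omega> - W m n \<omega>\<bar> \<le> \<epsilon>)"
      using eventually_conj[OF _ appr[OF \<epsilon>(1)]] eventually_happens'[OF sequentially_bot] by blast
    from ev have "\<forall>\<^sub>F n in sequentially. cmod (char (distr M borel (T n)) t - char (distr N borel Z) t) < r"
      using tendstoD[OF char[of m t] r3]
    proof eventually_elim
      case (elim n)
      then obtain A where A: "A \<in> sets M" "1 - \<epsilon> \<le> measure M A" "\<And>\<omega>. \<omega> \<in> A \<Longrightarrow> \<bar>T n \<omega> - W m n \<omega>\<bar> \<le> \<epsilon>"
        by blast
      have 1: "cmod (char (distr M borel (T n)) t - char (distr M borel (W m n)) t) \<le> r / 3"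
        using char_diff_le[OF M T W A, of t] \<epsilon>(2) by simp
      have "cmod (char (distr M borel (T n)) t - char (distr N borel Z) t) \<le>
        cmod (char (distr M borel (T n)) t - char (distr M borel (W m n)) t) +
        dist (char (distr M borel (W m n)) t) (char (distr N borel (V m)) t) +
        dist (char (distr N borel (V m)) t) (char (distr N borel Z) t)"
        unfolding dist_norm by norm
      then show ?case using 1 m elim by linarith
    qed
    then show "\<exists>no. \<forall>n\<ge>no. cmod (char (distr M borel (T n)) t - char (distr N borel Z) t) < r"
      unfolding eventually_sequentially .
  qed
qed

text \<open>Reduces characteristic functions to expectations of real bounded continuous functions,
  the form of \<open>cramer_wold_expectation\<close>.\<close>

lemma char_cos_sin:
  assumes "prob_space M" and [measurable]: "X \<in> borel_measurable M"
  shows "char (distr M borel X) t =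
    complex_of_real (LINT \<omega>|M. cos (t * X \<omega>)) + \<i> * complex_of_real (LINT \<omega>|M. sin (t * X \<omega>))"
proof -
  interpret prob_space M by fact
  have c: "integrable M (\<lambda>\<omega>. cos (t * X \<omega>))" and s: "integrable M (\<lambda>\<omega>. sin (t * X \<omega>))"
    by (rule integrable_const_bound[where B=1]; simp)+
  have "char (distr M borel X) t = (CLINT \<omega>|M. complex_of_real (cos (t * X \<omega>)) + \<i> * complex_of_real (sin (t * X \<omega>)))"
    by (simp add: char_def integral_distr exp_Euler cos_of_real sin_of_real flip: of_real_mult)
  also have "\<dots> = (CLINT \<omega>|M. complex_of_real (cos (t * X \<omega>))) + (CLINT \<omega>|M. \<i> * complex_of_real (sin (t * X \<omega>)))"
    using c s by (intro Bochner_Integration.integral_add) auto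
  finally show ?thesis by simp
qed

section \<open>Maxima over finite nets\<close>

lemma continuous_on_finite_SUP:
  fixes g :: "'i \<Rightarrow> 'x::topological_space \<Rightarrow> real"
  assumes "finite F" "F \<noteq> {}" "\<And>u. u \<in> F \<Longrightarrow> continuous_on S (g u)"
  shows "continuous_on S (\<lambda>y. SUP u\<in>F. g u y)"
  using assms
proof (induction rule: finite_ne_induct)
  case (insert u F)
  have "(SUP v\<in>insert u F. g v y) = max (g u y) (SUP v\<in>F. g v y)" for y
    using insert by (subst cSUP_insert) (auto simp: sup_max)
  then show ?case using insert by (simp add: continuous_on_max)
qed simp

lemma lin_process_product_continuous: "continuous_on UNIV (\<lambda>y. lin_process C y u)"
  unfolding lin_process_def
proof (intro continuous_on_diff continuous_on_sum continuous_on_product_coordinates)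
  fix i
  show "continuous_on UNIV (\<lambda>y. if 0 < u $ i \<and> u $ i < 1 then partial_deriv C i u * y (vec_upd 1 i (u $ i)) else 0)"
    by (cases "0 < u $ i \<and> u $ i < 1")
      (auto intro!: continuous_on_mult continuous_on_const continuous_on_product_coordinates)
qed

definition net_sup :: "(real ^ 'd \<Rightarrow> real) \<Rightarrow> (real ^ 'd \<Rightarrow> real) \<Rightarrow> (real ^ 'd) set \<Rightarrow> (real ^ 'd \<Rightarrow> real) \<Rightarrow> real" where
  "net_sup C f F a = (SUP u\<in>F. lin_process C a u * sgn (f u))"

lemma net_sup_measurable:
  fixes C :: "real ^ 'd \<Rightarrow> real"
  assumes "finite F" "F \<subseteq> {0..1}" and B: "\<And>u. u \<in> {0..1} \<Longrightarrow> B u \<in> borel_measurable N"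
  shows "(\<lambda>\<omega>. net_sup C f F (\<lambda>u. B u \<omega>)) \<in> borel_measurable N"
  unfolding net_sup_def
proof (rule borel_measurable_cSUP)
  show "countable F" using assms(1) by (rule countable_finite)
  fix u assume "u \<in> F"
  then show "(\<lambda>\<omega>. lin_process C (\<lambda>u. B u \<omega>) u * sgn (f u)) \<in> borel_measurable N"
    using assms(2) by (intro borel_measurable_times lin_process_measurable[OF B]) auto
qed (use assms(1) in auto)

lemma net_sup_continuous:
  assumes "finite F" "F \<noteq> {}"
  shows "continuous_on UNIV (net_sup C f F)"
  unfolding net_sup_def[abs_def]
  by (intro continuous_on_finite_SUP assms continuous_on_mult lin_process_product_continuous continuous_on_const)

lemma net_sup_cong:
  assumes "\<And>u. u \<in> F \<Longrightarrow> a u = b u" "\<And>u i. u \<in> F \<Longrightarrow> a (vec_upd 1 i (u $ i)) = b (vec_upd 1 i (u $ i))"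
  shows "net_sup C f F a = net_sup C f F b"
proof -
  have "lin_process C a u = lin_process C b u" if "u \<in> F" for u
    unfolding lin_process_def using assms that
    by (intro arg_cong2[where f="(-)"] sum.cong) simp_all
  then show ?thesis unfolding net_sup_def by (intro arg_cong[where f=Sup] image_cong) simp_all
qed

text \<open>The quantifier over paths stands inside: how fine the net must be depends on
  \<open>\<delta>\<close> and \<open>f\<close> only, so \<open>m\<close> can be fixed before
  \<open>n\<close> and the sample.\<close>

lemma net_sup_approx:
  fixes C f :: "real ^ 'd \<Rightarrow> real"
  assumes f: "continuous_on {0..1} f" and nz: "\<exists>u\<in>{0..1}. f u \<noteq> 0"
  defines "K \<equiv> argmax_set (\<lambda>u. \<bar>f u\<bar>)"
  assumes F: "\<And>m. finite (F m)" "\<And>m. F m \<subseteq> K" "\<And>m. F m \<noteq> {}"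
      "\<And>m u. u \<in> K \<Longrightarrow> \<exists>w\<in>F m. \<forall>i. \<bar>u $ i - w $ i\<bar> \<le> 1 / real (Suc m)"
    and \<delta>: "0 < \<delta>"
  shows "\<forall>\<^sub>F m in sequentially. \<forall>a. cube_modulus (lin_process C a) \<delta> \<epsilon> \<longrightarrow>
    \<bar>(SUP u\<in>K. lin_process C a u * sgn (f u)) - net_sup C f (F m) a\<bar> \<le> \<epsilon>"
proof -
  note K = argmax_set_props[OF f nz, folded K_def]
  obtain \<delta>s where \<delta>s: "0 < \<delta>s"
    "\<And>u w. w \<in> K \<Longrightarrow> u \<in> {0..1} \<Longrightarrow> (\<And>i. \<bar>u $ i - w $ i\<bar> \<le> \<delta>s) \<Longrightarrow> sgn (f u) = sgn (f w)"
    using argmax_sign_constant[OF f nz] unfolding K_def by metis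
  have "\<forall>\<^sub>F m in sequentially. 1 / real (Suc m) < min \<delta> \<delta>s"
    using LIMSEQ_inverse_real_of_nat \<delta> \<delta>s(1) by (intro order_tendstoD(2)) (simp_all add: inverse_eq_divide)
  then show ?thesis
  proof (eventually_elim, intro allI impI)
    fix m a assume "1 / real (Suc m) < min \<delta> \<delta>s" and mod: "cube_modulus (lin_process C a) \<delta> \<epsilon>"
    then have mesh: "1 / real (Suc m) \<le> \<delta>" "1 / real (Suc m) \<le> \<delta>s" by linarith+
    show "\<bar>(SUP u\<in>K. lin_process C a u * sgn (f u)) - net_sup C f (F m) a\<bar> \<le> \<epsilon>"
      unfolding net_sup_def
    proof (rule sup_net_approx[OF _ F(2,3,1)])
      show "cube_modulus (lin_process C a) (1 / real (Suc m)) \<epsilon>"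
        using mod mesh(1) unfolding cube_modulus_def by (meson order_trans)
      show "K \<subseteq> {0..1}" using K(4) by blast
      show "sgn (f u) = sgn (f v)" if "u \<in> K" "v \<in> K" "\<And>i. \<bar>u $ i - v $ i\<bar> \<le> 1 / real (Suc m)" for u v
      proof (rule \<delta>s(2)[OF that(2)])
        show "u \<in> {0..1}" using K(4) that(1) by blast
        show "\<bar>u $ i - v $ i\<bar> \<le> \<delta>s" for i using that(3)[of i] mesh(2) by linarith
      qed
    qed (rule F(4))
  qed
qed

lemma net_sup_tendsto:
  fixes C f :: "real ^ 'd \<Rightarrow> real"
  assumes f: "continuous_on {0..1} f" and nz: "\<exists>u\<in>{0..1}. f u \<noteq> 0"
  defines "K \<equiv> argmax_set (\<lambda>u. \<bar>f u\<bar>)"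
  assumes F: "\<And>m. finite (F m)" "\<And>m. F m \<subseteq> K" "\<And>m. F m \<noteq> {}"
      "\<And>m u. u \<in> K \<Longrightarrow> \<exists>w\<in>F m. \<forall>i. \<bar>u $ i - w $ i\<bar> \<le> 1 / real (Suc m)"
    and L: "continuous_on {0..1} (lin_process C a)"
  shows "(\<lambda>m. net_sup C f (F m) a) \<longlonglongrightarrow> (SUP u\<in>K. lin_process C a u * sgn (f u))"
proof (rule tendstoI)
  fix r :: real assume "0 < r"
  then have r: "0 < r / 2" "r / 2 < r" by simp_all
  obtain \<delta> where \<delta>: "0 < \<delta>" "cube_modulus (lin_process C a) \<delta> (r / 2)" using continuous_imp_cube_modulus[OF L r(1)] .
  from net_sup_approx[OF f nz F[unfolded K_def] \<delta>(1), folded K_def]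
  show "\<forall>\<^sub>F m in sequentially. dist (net_sup C f (F m) a) (SUP u\<in>K. lin_process C a u * sgn (f u)) < r"
  proof (rule eventually_mono)
    fix m assume "\<forall>b. cube_modulus (lin_process C b) \<delta> (r / 2) \<longrightarrow>
      \<bar>(SUP u\<in>K. lin_process C b u * sgn (f u)) - net_sup C f (F m) b\<bar> \<le> r / 2"
    then have "\<bar>(SUP u\<in>K. lin_process C a u * sgn (f u)) - net_sup C f (F m) a\<bar> \<le> r / 2" using \<delta>(2) by blast
    then show "dist (net_sup C f (F m) a) (SUP u\<in>K. lin_process C a u * sgn (f u)) < r"
      using r(2) by (simp add: dist_real_def abs_minus_commute)
  qed
qed

context copula_sample
begin

lemma net_sup_char:
  assumes N: "prob_space N" and B: "copula_bridge N C B"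
    and F: "finite F" "F \<noteq> {}" "F \<subseteq> {0..1}"
  shows "(\<lambda>n. char (distr M borel (\<lambda>\<omega>. net_sup C f F (\<lambda>u. \<alpha> n u \<omega>))) t)
    \<longlonglongrightarrow> char (distr N borel (\<lambda>\<omega>. net_sup C f F (\<lambda>u. B u \<omega>))) t"
proof -
  note bl = bridge_linear_combination[OF N B]
  \<comment> \<open>Extension by 0 outside the cube: \<open>cramer_wold_expectation\<close> asks for
    measurability and moments at every index, and these are known only in the cube.\<close>
  define Y where "Y n u \<omega> = (if u \<in> {0..1} then \<alpha> n u \<omega> else 0)" for n u \<omega>
  define Z where "Z u \<omega> = (if u \<in> {0..1} then B u \<omega> else 0)" for u \<omega>
  have Ym: "Y n u \<in> borel_measurable M" for n u
    unfolding Y_def[abs_def] by (cases "u \<in> {0..1}") (simp_all del: atLeastAtMost_iff)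
  have Zm: "Z u \<in> borel_measurable N" for u
    unfolding Z_def[abs_def] by (cases "u \<in> {0..1}") (simp_all del: atLeastAtMost_iff add: bl(1))
  have up: "vec_upd 1 i (u $ i) \<in> {0..1}" if "u \<in> F" for u i
    using F(3) that by (auto simp: mem_cube_iff simp del: atLeastAtMost_iff)
  have eqY: "net_sup C f F (\<lambda>u. Y n u \<omega>) = net_sup C f F (\<lambda>u. \<alpha> n u \<omega>)" for n \<omega>
    using F(3) up by (intro net_sup_cong) (auto simp: Y_def subset_iff simp del: atLeastAtMost_iff)
  have eqZ: "net_sup C f F (\<lambda>u. Z u \<omega>) = net_sup C f F (\<lambda>u. B u \<omega>)" for \<omega>
    using F(3) up by (intro net_sup_cong) (auto simp: Z_def subset_iff simp del: atLeastAtMost_iff)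
  \<comment> \<open>The finitely many points whose values \<open>net_sup\<close> reads: the net and
    the associated points on the axes through the corner 1.\<close>
  define P where "P = F \<union> (\<lambda>(u, i). vec_upd 1 i (u $ i)) ` (F \<times> UNIV)"
  have P: "finite P" using F(1) by (simp add: P_def)
  have Pc: "net_sup C f F y = net_sup C f F y'" if "\<forall>u\<in>P. y u = y' u" for y y'
  proof (rule net_sup_cong)
    fix u assume u: "u \<in> F"
    then show "y u = y' u" using that by (simp add: P_def)
    fix i
    have "vec_upd 1 i (u $ i) \<in> P" unfolding P_def using u by (intro UnI2 image_eqI[of _ _ "(u, i)"]) simp_all
    then show "y (vec_upd 1 i (u $ i)) = y' (vec_upd 1 i (u $ i))" using that by blast
  qed
  have nY: "(\<lambda>\<omega>. net_sup C f F (\<lambda>u. Y n u \<omega>)) \<in> borel_measurable M" for n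
    by (rule net_sup_measurable[OF F(1,3) Ym])
  have nZ: "(\<lambda>\<omega>. net_sup C f F (\<lambda>u. Z u \<omega>)) \<in> borel_measurable N"
    by (rule net_sup_measurable[OF F(1,3) Zm])
  have lin: "(\<lambda>n. char (distr M borel (\<lambda>\<omega>. \<Sum>u\<in>S. a u * Y n u \<omega>)) 1)
         \<longlonglongrightarrow> char (distr N borel (\<lambda>\<omega>. \<Sum>u\<in>S. a u * Z u \<omega>)) 1" if S: "finite S" for S a
  proof -
    let ?S = "S \<inter> {0..1}"
    have "(\<Sum>u\<in>S. a u * Y n u \<omega>) = (\<Sum>u\<in>?S. a u * \<alpha> n u \<omega>)" for n \<omega>
      using S by (intro sum.mono_neutral_cong_right) (auto simp: Y_def)
    moreover have "(\<Sum>u\<in>S. a u * Z u \<omega>) = (\<Sum>u\<in>?S. a u * B u \<omega>)" for \<omega>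
      using S by (intro sum.mono_neutral_cong_right) (auto simp: Z_def)
    ultimately show ?thesis
      using char_linear_combination[of ?S a] bl(4)[of ?S a] S by simp
  qed
  have Y2: "integrable M (\<lambda>\<omega>. (Y n u \<omega>)\<^sup>2) \<and> expectation (\<lambda>\<omega>. (Y n u \<omega>)\<^sup>2) \<le> 1" for n u
    unfolding Y_def using \<alpha>_second_moment[of u n] by (cases "u \<in> {0..1}") (simp_all del: atLeastAtMost_iff)
  have Z2: "integrable N (\<lambda>\<omega>. (Z u \<omega>)\<^sup>2) \<and> integral\<^sup>L N (\<lambda>\<omega>. (Z u \<omega>)\<^sup>2) \<le> 1" for u
  proof (cases "u \<in> {0..1}")
    case True
    have "C u - C u * C u \<le> 1" using copula_range[OF copula True] by simp (smt (verit) mult_nonneg_nonneg)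
    then show ?thesis unfolding Z_def using True bl(2,3)[OF True] by (simp del: atLeastAtMost_iff)
  qed (simp add: Z_def del: atLeastAtMost_iff)
  have conv: "(\<lambda>n. expectation (\<lambda>\<omega>. k (net_sup C f F (\<lambda>u. \<alpha> n u \<omega>)))) \<longlonglongrightarrow>
      integral\<^sup>L N (\<lambda>\<omega>. k (net_sup C f F (\<lambda>u. B u \<omega>)))"
    if k: "continuous_on UNIV k" "\<And>x. \<bar>k x\<bar> \<le> 1" for k :: "real \<Rightarrow> real"
  proof -
    have km: "k \<in> borel_measurable borel" by (rule borel_measurable_continuous_onI[OF k(1)])
    have "(\<lambda>n. expectation (\<lambda>\<omega>. k (net_sup C f F (\<lambda>u. Y n u \<omega>)))) \<longlonglongrightarrow>
      integral\<^sup>L N (\<lambda>\<omega>. k (net_sup C f F (\<lambda>u. Z u \<omega>)))"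
    proof (rule cramer_wold_expectation[OF prob_space_axioms N Ym Zm lin, where V=1 and H=1 and S=P])
      show "continuous_on UNIV (\<lambda>y. k (net_sup C f F y))"
        by (rule continuous_on_compose2[OF k(1) net_sup_continuous[OF F(1,2)]]) simp
      show "k (net_sup C f F y) = k (net_sup C f F y')" if "\<forall>u\<in>P. y u = y' u" for y y'
        using Pc[OF that] by simp
      show "(\<lambda>\<omega>. k (net_sup C f F (\<lambda>u. Y n u \<omega>))) \<in> borel_measurable M" for n
        by (rule measurable_compose[OF nY km])
      show "(\<lambda>\<omega>. k (net_sup C f F (\<lambda>u. Z u \<omega>))) \<in> borel_measurable N"
        by (rule measurable_compose[OF nZ km])
    qed (use Y2 Z2 P k(2) in simp_all)
    then show ?thesis unfolding eqY eqZ .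
  qed
  have nB: "(\<lambda>\<omega>. net_sup C f F (\<lambda>u. B u \<omega>)) \<in> borel_measurable N"
    by (rule net_sup_measurable[OF F(1,3) bl(1)])
  have n\<alpha>: "(\<lambda>\<omega>. net_sup C f F (\<lambda>u. \<alpha> n u \<omega>)) \<in> borel_measurable M" for n
    by (rule net_sup_measurable[OF F(1,3) \<alpha>_measurable])
  show ?thesis
    unfolding char_cos_sin[OF prob_space_axioms n\<alpha>] char_cos_sin[OF N nB]
    by (intro tendsto_add tendsto_mult tendsto_const tendsto_of_real conv continuous_intros) auto
qed

text \<open>All constants are fixed before the sample: first \<open>\<epsilon>1\<close>, then
  \<open>\<delta>\<close> from equicontinuity, the bound \<open>R\<close>, the modulus
  \<open>\<delta>'\<close> of the linearized paths, and finally the thresholds for \<open>n\<close>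
  and \<open>m\<close>. On the resulting event the argument is deterministic.\<close>

lemma empirical_copula_expansion:
  assumes cp: "\<And>i. continuous_partial C i" and D: "copula D" and nz: "\<exists>u\<in>{0..1}. C u - D u \<noteq> 0"
  defines "f \<equiv> \<lambda>u. C u - D u"
  defines "K \<equiv> argmax_set (\<lambda>u. \<bar>f u\<bar>)"
  assumes F: "\<And>m. finite (F m)" "\<And>m. F m \<subseteq> K" "\<And>m. F m \<noteq> {}"
      "\<And>m u. u \<in> K \<Longrightarrow> \<exists>w\<in>F m. \<forall>i. \<bar>u $ i - w $ i\<bar> \<le> 1 / real (Suc m)"
    and \<epsilon>: "0 < \<epsilon>"
  shows "\<forall>\<^sub>F m in sequentially. \<forall>\<^sub>F n in sequentially. \<exists>A\<in>events. 1 - \<epsilon> \<le> prob A \<and>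
    (\<forall>\<omega>\<in>A. generic_sample n (\<lambda>k. U k \<omega>) \<and>
      \<bar>sqrt (real n) * (sup_norm (\<lambda>u. emp_copula n (\<lambda>k. U k \<omega>) u - D u) - sup_norm f)
        - net_sup C f (F m) (\<lambda>u. \<alpha> n u \<omega>)\<bar> \<le> \<epsilon>)"
    (is "\<forall>\<^sub>F m in _. \<forall>\<^sub>F n in _. \<exists>A\<in>_. ?P A \<and> (\<forall>\<omega>\<in>A. ?Q n \<omega> \<and> ?R m n \<omega>)")
proof -
  have f: "continuous_on {0..1} f"
    unfolding f_def by (intro continuous_on_diff copula_continuous copula D)
  have nz: "\<exists>u\<in>{0..1}. f u \<noteq> 0" using nz by (simp add: f_def)
  note K = argmax_set_props[OF f nz, folded K_def]
  define c where "c = 1 + 4 * real CARD('d)"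
  have c: "1 \<le> c" "1 + 2 * real CARD('d) \<le> c" by (auto simp: c_def)
  \<comment> \<open>The expansion of the supremum norm costs \<open>2 * (c * \<epsilon>1)\<close>
    and the finite net another \<open>c * \<epsilon>1\<close>. The factor \<open>c\<close> covers
    both the linearization error and the modulus of the linearized path.\<close>
  define \<epsilon>1 where "\<epsilon>1 = \<epsilon> / (3 * c)"
  have \<epsilon>1: "0 < \<epsilon>1" "3 * (c * \<epsilon>1) = \<epsilon>" using \<epsilon> c by (auto simp: \<epsilon>1_def)
  obtain \<delta> n1 where \<delta>: "0 < \<delta>" and n1: "\<And>n. n1 \<le> n \<Longrightarrow> \<exists>A\<in>events. 1 - \<epsilon> \<le> prob A \<and>
       (\<forall>\<omega>\<in>A. generic_sample n (\<lambda>k. U k \<omega>) \<and> cube_modulus (emp_process C n (\<lambda>k. U k \<omega>)) \<delta> \<epsilon>1)"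
    using asymptotic_equicontinuity[OF \<epsilon>1(1) \<epsilon>] by blast
  define mm where "mm = nat \<lceil>1 / \<delta>\<rceil>"
  have mm: "1 \<le> real mm * \<delta>"
  proof -
    have "1 / \<delta> \<le> real mm" unfolding mm_def by linarith
    then show ?thesis using \<delta> by (simp add: field_simps)
  qed
  define R where "R = real mm * \<epsilon>1"
  have R0: "0 \<le> R" using \<epsilon>1 by (simp add: R_def)
  obtain \<delta>' where \<delta>': "0 < \<delta>'"
    "\<And>a. cube_modulus a \<delta> \<epsilon>1 \<Longrightarrow> (\<And>u. u \<in> {0..1} \<Longrightarrow> \<bar>a u\<bar> \<le> R) \<Longrightarrow>
       (\<And>i. a (vec_upd 1 i 0) = 0) \<Longrightarrow> a 1 = 0 \<Longrightarrow>
       cube_modulus (lin_process C a) \<delta>' ((1 + 2 * real CARD('d)) * \<epsilon>1)"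
    by (rule lin_process_modulus[OF copula cp \<delta> \<epsilon>1(1) R0]) blast
  obtain n2 where n2: "\<And>n x u. n2 \<le> n \<Longrightarrow> generic_sample n x \<Longrightarrow> cube_modulus (emp_process C n x) \<delta> \<epsilon>1 \<Longrightarrow> u \<in> {0..1} \<Longrightarrow>
       \<bar>sqrt (real n) * (emp_copula n x u - C u) - lin_process C (emp_process C n x) u\<bar> \<le> c * \<epsilon>1"
    unfolding c_def by (rule emp_copula_linearization[OF copula cp \<delta> \<epsilon>1(1)]) blast
  define R' where "R' = (1 + real CARD('d)) * R + c * \<epsilon>1"
  have R': "0 \<le> R'" using R0 \<epsilon>1 c by (simp add: R'_def)
  obtain s0 where s0: "0 < s0"
    "\<And>s h g \<epsilon>. 0 < s \<Longrightarrow> s \<le> s0 \<Longrightarrow> (\<And>u. u \<in> {0..1} \<Longrightarrow> \<bar>h u\<bar> \<le> R') \<Longrightarrow>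
       (\<And>u. u \<in> {0..1} \<Longrightarrow> \<bar>h u - g u\<bar> \<le> \<epsilon>) \<Longrightarrow> cube_modulus g \<delta>' \<epsilon> \<Longrightarrow>
       \<bar>(sup_norm (\<lambda>u. f u + s * h u) - sup_norm f) / s -
         (SUP u\<in>argmax_set (\<lambda>u. \<bar>f u\<bar>). g u * sgn (f u))\<bar> \<le> 2 * \<epsilon>"
  proof (rule sup_norm_expansion[OF f nz \<delta>'(1) R'], goal_cases)
    case (1 s0)
    show ?case by (rule 1(1)[OF 1(2)]) (rule 1(3))
  qed
  have approx: "\<forall>\<^sub>F m in sequentially. \<forall>a. cube_modulus (lin_process C a) \<delta>' (c * \<epsilon>1) \<longrightarrow>
      \<bar>(SUP u\<in>K. lin_process C a u * sgn (f u)) - net_sup C f (F m) a\<bar> \<le> c * \<epsilon>1"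
    unfolding K_def by (rule net_sup_approx[OF f nz F[unfolded K_def] \<delta>'(1)])
  \<comment> \<open>The step size of the expansion will be \<open>1 / sqrt n\<close>; this makes it
    at most \<open>s0\<close>.\<close>
  obtain n3 :: nat where n3: "(1 / s0)\<^sup>2 \<le> real n3" using real_arch_simple by blast
  from approx show ?thesis
  proof eventually_elim
    case (elim m)
    show ?case
      unfolding eventually_sequentially
    proof (rule exI[of _ "Suc (max n1 (max n2 n3))"], intro allI impI)
      fix n assume n: "Suc (max n1 (max n2 n3)) \<le> n"
      then have "n1 \<le> n" by simp
      from n1[OF this] obtain A where A: "A \<in> events" "1 - \<epsilon> \<le> prob A"
        "\<And>\<omega>. \<omega> \<in> A \<Longrightarrow> generic_sample n (\<lambda>k. U k \<omega>)"
        "\<And>\<omega>. \<omega> \<in> A \<Longrightarrow> cube_modulus (emp_process C n (\<lambda>k. U k \<omega>)) \<delta> \<epsilon>1" by blast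
      have "?R m n \<omega>" if w: "\<omega> \<in> A" for \<omega>
      proof -
        define x where "x = (\<lambda>k. U k \<omega>)"
        define a where "a = emp_process C n x"
        have gs: "generic_sample n x" and mod: "cube_modulus a \<delta> \<epsilon>1" using A(3,4)[OF w] by (auto simp: a_def x_def)
        have bdry: "a (vec_upd 1 i 0) = 0" "a 1 = 0" "a 0 = 0" for i
          unfolding a_def using emp_process_boundary(2)[OF copula gs]
            emp_process_boundary(1)[OF copula gs, of "vec_upd 1 i 0" i] emp_process_boundary(1)[OF copula gs, of 0 i]
          by (auto simp del: atLeastAtMost_iff simp: mem_cube_iff)
        have aR: "\<bar>a v\<bar> \<le> R" if "v \<in> {0..1}" for v
          unfolding R_def by (rule cube_modulus_bound[OF mod bdry(3) mm that])
        let ?L = "lin_process C a"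
        have "(1 + 2 * real CARD('d)) * \<epsilon>1 \<le> c * \<epsilon>1" using c \<epsilon>1 by (intro mult_right_mono) auto
        then have modL: "cube_modulus ?L \<delta>' (c * \<epsilon>1)"
          using \<delta>'(2)[OF mod aR bdry(1,2)] unfolding cube_modulus_def by force
        define q where "q = sqrt (real n)"
        have q: "0 < q" using n by (simp add: q_def)
        \<comment> \<open>Perturbing \<open>C - D\<close> by \<open>h\<close> with step
          \<open>1 / q\<close> gives exactly the difference of the empirical copula and
          \<open>D\<close>.\<close>
        define h where "h u = q * (emp_copula n x u - C u)" for u
        have hL: "\<bar>h u - ?L u\<bar> \<le> c * \<epsilon>1" if "u \<in> {0..1}" for u
          using n2[OF _ gs _ that, of] n mod unfolding h_def q_def a_def by simp
        have hR: "\<bar>h u\<bar> \<le> R'" if "u \<in> {0..1}" for u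
          using hL[OF that] lin_process_bound[where a=a and R=R, OF copula cp aR that] unfolding R'_def by linarith
        have "1 / q \<le> s0"
        proof -
          have "(1 / s0)\<^sup>2 \<le> real n" using n3 n by linarith
          then have "1 / s0 \<le> q" unfolding q_def by (rule real_le_rsqrt)
          then show ?thesis using q s0(1) by (simp add: field_simps)
        qed
        then have e1: "\<bar>(sup_norm (\<lambda>u. f u + (1 / q) * h u) - sup_norm f) / (1 / q) - (SUP u\<in>K. ?L u * sgn (f u))\<bar> \<le> 2 * (c * \<epsilon>1)"
          unfolding K_def using q by (intro s0(2) hR hL modL) simp
        have fh: "f u + (1 / q) * h u = emp_copula n x u - D u" for u
          using q by (simp add: f_def h_def)
        have e2: "\<bar>(SUP u\<in>K. ?L u * sgn (f u)) - net_sup C f (F m) (\<lambda>u. \<alpha> n u \<omega>)\<bar> \<le> c * \<epsilon>1"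
          using elim modL unfolding a_def x_def \<alpha>_def by blast
        show ?thesis
          using e1 e2 \<epsilon>1(2) unfolding fh x_def[symmetric] q_def[symmetric] by (simp add: mult.commute)
      qed
      then show "\<exists>A\<in>events. ?P A \<and> (\<forall>\<omega>\<in>A. ?Q n \<omega> \<and> ?R m n \<omega>)"
        using A by (intro bexI[OF _ A(1)]) blast
    qed
  qed
qed

end

theorem proposition4p1:
  fixes C D :: "real ^ 'd \<Rightarrow> real"
    and P :: "(real ^ 'd) measure"
    and M :: "'a measure" and X :: "nat \<Rightarrow> 'a \<Rightarrow> real ^ 'd"
    and N :: "'b measure" and B :: "real ^ 'd \<Rightarrow> 'b \<Rightarrow> real"
  defines "T \<equiv> (\<lambda>n \<omega>. sqrt (real n) *
              (sup_norm (\<lambda>u. emp_copula n (\<lambda>k. X k \<omega>) u - D u) - sup_norm (\<lambda>u. C u - D u)))"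
    and "Z \<equiv> (\<lambda>\<omega>. SUP u\<in>argmax_set (\<lambda>u. \<bar>C u - D u\<bar>).
              limit_process C B u \<omega> * sgn (C u - D u))"
  assumes "copula C"
    and "\<And>i. continuous_partial C i"
    and "prob_space P" and "sets P = sets borel"
    and "copula_of C P"
    and "\<And>i. continuous_on UNIV (marginal_cdf P i)"
    and "prob_space M"
    and "prob_space.indep_vars M (\<lambda>_. borel) X UNIV"
    and "\<And>k. distr M borel (X k) = P"
    and "copula D" and "\<exists>u\<in>{0..1}. D u \<noteq> C u"
    and "prob_space N" and "copula_bridge N C B"
  shows "converges_in_distribution M T N Z \<and>
         (AE \<omega> in N. has_hadamard_dir_deriv sup_norm
            (\<lambda>u. C u - D u) (\<lambda>u. limit_process C B u \<omega>) (Z \<omega>))"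
proof -
  define f where "f = (\<lambda>u. C u - D u)"
  define F where "F i = marginal_cdf P i" for i
  define G where "G = (\<lambda>x::real^'d. \<chi> i. F i (x $ i))"
  define U where "U k \<omega> = G (X k \<omega>)" for k \<omega>
  have C: "copula C" and D: "copula D" and cp: "\<And>i. continuous_partial C i"
    and N: "prob_space N" and B: "copula_bridge N C B" and P: "prob_space P" "sets P = sets borel"
    using assms by blast+
  interpret M: prob_space M by fact
  interpret N: prob_space N by fact
  have f: "continuous_on {0..1} f"
    unfolding f_def by (intro continuous_on_diff copula_continuous C D)
  have nz: "\<exists>u\<in>{0..1}. f u \<noteq> 0" using \<open>\<exists>u\<in>{0..1}. D u \<noteq> C u\<close> unfolding f_def by (metis right_minus_eq)
  define K where "K = argmax_set (\<lambda>u. \<bar>f u\<bar>)"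
  note K = argmax_set_props[OF f nz, folded K_def]
  have X[measurable]: "X k \<in> borel_measurable M" for k
    using \<open>M.indep_vars (\<lambda>_. borel) X UNIV\<close> unfolding M.indep_vars_def by auto
  note pit = probability_integral_transform[OF P C \<open>copula_of C P\<close> assms(8), folded F_def, folded G_def]
  have G: "G \<in> borel_measurable borel" and cdf: "\<And>u. u \<in> {0..1} \<Longrightarrow> measure (distr P borel G) {..u} = C u"
    by (rule pit(1), rule pit(2))
  interpret S: copula_sample M U C "distr P borel G"
  proof
    show "M.indep_vars (\<lambda>_. borel) U UNIV"
      unfolding U_def by (rule M.indep_vars_compose2[OF \<open>M.indep_vars (\<lambda>_. borel) X UNIV\<close>]) (rule G)
    show "distr M borel (U k) = distr P borel G" for k
      using distr_distr[OF G X, of k] \<open>\<And>k. distr M borel (X k) = P\<close>[of k] by (simp add: U_def[abs_def] comp_def)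
    show "0 \<le> U k \<omega> $ i \<and> U k \<omega> $ i \<le> 1" for k \<omega> i
      using marginal_cdf_props[OF P] by (simp add: U_def G_def F_def)
  qed (fact cdf C)+
  have F_mono: "mono (F i)" for i unfolding F_def by (rule marginal_cdf_props[OF P])
  have emp: "emp_copula n (\<lambda>k. X k \<omega>) u = emp_copula n (\<lambda>k. U k \<omega>) u"
    if "generic_sample n (\<lambda>k. U k \<omega>)" "0 < n" for n \<omega> u
    using emp_copula_transform[OF that(2) F_mono, where x="\<lambda>k. X k \<omega>"] that(1) by (simp add: U_def G_def)
  have "\<exists>Fm. finite Fm \<and> Fm \<subseteq> K \<and> Fm \<noteq> {} \<and> (\<forall>u\<in>K. \<exists>w\<in>Fm. \<forall>i. \<bar>u $ i - w $ i\<bar> \<le> 1 / real (Suc m))" for m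
    by (rule finite_net[OF K(3,2), of "1 / real (Suc m)"]) (simp, metis)
  then obtain Fm where Fm: "\<And>m. finite (Fm m)" "\<And>m. Fm m \<subseteq> K" "\<And>m. Fm m \<noteq> {}"
      "\<And>m u. u \<in> K \<Longrightarrow> \<exists>w\<in>Fm m. \<forall>i. \<bar>u $ i - w $ i\<bar> \<le> 1 / real (Suc m)"
    by metis
  have Fc: "Fm m \<subseteq> {0..1}" for m using Fm(2) K(4) by blast
  note bl = bridge_linear_combination[OF N B]
  have Bc: "continuous_on {0..1} (\<lambda>u. B u \<omega>)" if "\<omega> \<in> space N" for \<omega>
    using B that unfolding copula_bridge_def by blast
  have Z_eq: "Z = (\<lambda>\<omega>. SUP u\<in>K. lin_process C (\<lambda>u. B u \<omega>) u * sgn (f u))"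
    unfolding Z_def K_def f_def limit_process_eq_lin ..
  have T_eq: "T n \<omega> = sqrt (real n) * (sup_norm (\<lambda>u. emp_copula n (\<lambda>k. X k \<omega>) u - D u) - sup_norm f)" for n \<omega>
    unfolding T_def f_def ..
  have Zm: "Z \<in> borel_measurable N"
    unfolding Z_eq K_def by (rule limit_functional_measurable[OF C cp f nz bl(1) Bc])
  have Tm: "T n \<in> borel_measurable M" for n
  \<comment> \<open>For \<open>n = 0\<close> the factor \<open>sqrt 0\<close> makes the statistic
    constant, whatever the empirical copula of an empty sample is.\<close>
  proof (cases "n = 0")
    case True
    then show ?thesis by (simp add: T_eq[abs_def])
  next
    case False
    then have "(\<lambda>\<omega>. sup_norm (\<lambda>u. emp_copula n (\<lambda>k. X k \<omega>) u - D u)) \<in> borel_measurable M"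
      by (intro sup_norm_emp_copula_measurable X D) simp
    then show ?thesis unfolding T_eq[abs_def] by measurable
  qed
  \<comment> \<open>Both conclusions rest on this: it makes the maxima over the nets converge to
    \<open>Z\<close>, and it puts the limit path among the directions in which the supremum norm is
    differentiated.\<close>
  have Lc: "AE \<omega> in N. continuous_on {0..1} (lin_process C (\<lambda>u. B u \<omega>))"
    by (rule AE_limit_process_continuous[OF C cp bl(2,3) Bc])
  have "converges_in_distribution M T N Z"
  proof (rule converges_in_distribution_approx[OF \<open>prob_space M\<close> N Tm Zm,
        where W="\<lambda>m n \<omega>. net_sup C f (Fm m) (\<lambda>u. S.\<alpha> n u \<omega>)" and V="\<lambda>m \<omega>. net_sup C f (Fm m) (\<lambda>u. B u \<omega>)"])
    show "(\<lambda>\<omega>. net_sup C f (Fm m) (\<lambda>u. S.\<alpha> n u \<omega>)) \<in> borel_measurable M" for m n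
      by (rule net_sup_measurable[OF Fm(1) Fc S.\<alpha>_measurable])
    show "(\<lambda>\<omega>. net_sup C f (Fm m) (\<lambda>u. B u \<omega>)) \<in> borel_measurable N" for m
      by (rule net_sup_measurable[OF Fm(1) Fc bl(1)])
    show "(\<lambda>n. char (distr M borel (\<lambda>\<omega>. net_sup C f (Fm m) (\<lambda>u. S.\<alpha> n u \<omega>))) t)
        \<longlonglongrightarrow> char (distr N borel (\<lambda>\<omega>. net_sup C f (Fm m) (\<lambda>u. B u \<omega>))) t" for m t
      by (rule S.net_sup_char[OF N B Fm(1,3) Fc])
    show "AE \<omega> in N. (\<lambda>m. net_sup C f (Fm m) (\<lambda>u. B u \<omega>)) \<longlonglongrightarrow> Z \<omega>"
      using Lc
    proof eventually_elim
      case (elim \<omega>)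
      show ?case
        unfolding Z_eq K_def by (rule net_sup_tendsto[OF f nz Fm[unfolded K_def] elim])
    qed
    fix \<epsilon> :: real assume \<epsilon>: "0 < \<epsilon>"
    show "\<forall>\<^sub>F m in sequentially. \<forall>\<^sub>F n in sequentially. \<exists>A\<in>M.events. 1 - \<epsilon> \<le> M.prob A \<and>
       (\<forall>\<omega>\<in>A. \<bar>T n \<omega> - net_sup C f (Fm m) (\<lambda>u. S.\<alpha> n u \<omega>)\<bar> \<le> \<epsilon>)"
    proof (rule eventually_mono)
      show "\<forall>\<^sub>F m in sequentially. \<forall>\<^sub>F n in sequentially. \<exists>A\<in>M.events. 1 - \<epsilon> \<le> M.prob A \<and>
        (\<forall>\<omega>\<in>A. generic_sample n (\<lambda>k. U k \<omega>) \<and>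
          \<bar>sqrt (real n) * (sup_norm (\<lambda>u. emp_copula n (\<lambda>k. U k \<omega>) u - D u) - sup_norm f)
            - net_sup C f (Fm m) (\<lambda>u. S.\<alpha> n u \<omega>)\<bar> \<le> \<epsilon>)" (is "eventually ?E _")
        unfolding f_def by (rule S.empirical_copula_expansion[OF cp D nz[unfolded f_def] Fm[unfolded K_def f_def] \<epsilon>])
      fix m assume elim: "?E m"
      from elim eventually_gt_at_top[of 0]
      show "\<forall>\<^sub>F n in sequentially. \<exists>A\<in>M.events. 1 - \<epsilon> \<le> M.prob A \<and>
        (\<forall>\<omega>\<in>A. \<bar>T n \<omega> - net_sup C f (Fm m) (\<lambda>u. S.\<alpha> n u \<omega>)\<bar> \<le> \<epsilon>)"
      proof eventually_elim
        case (elim n)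
        \<comment> \<open>On the event where the transformed sample is generic, the two empirical
          copulas coincide, so the event found for \<open>U\<close> also serves for
          \<open>X\<close>.\<close>
        have "T n \<omega> = sqrt (real n) * (sup_norm (\<lambda>u. emp_copula n (\<lambda>k. U k \<omega>) u - D u) - sup_norm f)"
          if "generic_sample n (\<lambda>k. U k \<omega>)" for \<omega>
          unfolding T_eq emp[OF that elim(2)] ..
        with elim(1) show ?case
          by (elim bexE conjE, intro bexI conjI ballI) (assumption | simp)+
      qed
    qed
  qed
  moreover have "AE \<omega> in N. has_hadamard_dir_deriv sup_norm (\<lambda>u. C u - D u) (\<lambda>u. limit_process C B u \<omega>) (Z \<omega>)"
    using Lc
  proof eventually_elim
    case (elim \<omega>)
    show ?case
      using sup_norm_hadamard[OF f elim nz] unfolding Z_def limit_process_eq_lin f_def .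
  qed
  ultimately show ?thesis ..
qed

end
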